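(* Let $n>1$ be an integer, $1<p<\frac{2n-1}{2(n-1)}$, $0\leq\gamma<2n$, and let $\mu$ be a nonnegative Borel measure on the open unit ball $B\subset\mathbb{C}^n$ satisfying $\int_B(1-|w|^2)^n\,d\mu(w)<\infty$. Let $G_\mu$ be the invariant Green potential of $\mu$ and let $d\lambda(z)=(1-|z|)^n\,d\mu(z)$. Then $$m_p(r,G_\mu)=o\left((1-r)^{\gamma-n}\right),\quad r\to1-,$$ holds if and only if $$\left(\int_S\lambda^p\left(C(\xi,\delta)\right)d\sigma(\xi)\right)^{\frac{1}{p}}=o\left(\delta^\gamma\right),\quad \delta\to0+.$$
   Context: Notation: $\langle z,w\rangle=\sum_{j=1}^n z_j\overline{w}_j$ and $|z|=\sqrt{\langle z,z\rangle}$ on $\mathbb{C}^n$; $B=\{z\in\mathbb{C}^n:|z|<1\}$; $S=\{z\in\mathbb{C}^n:|z|=1\}$; $\sigma$ is the Lebesgue (rotation-invariant surface) measure on $S$ normalized so that $\sigma(S)=1$. For $z,w\in B$ the involutive automorphism $\varphi_w$ of $B$ is $\varphi_w(z)=\frac{w-P_wz-(1-|w|^2)^{1/2}Q_wz}{1-\langle z,w\rangle}$, where $P_0z=0$, $P_wz=\frac{\langle z,w\rangle}{|w|^2}w$ for $w\neq0$, and $Q_w=I-P_w$. The Green's function for the invariant Laplacian is $G(z,w)=g(\varphi_w(z))$, where $g(z)=\frac{n+1}{2n}\int_{|z|}^1(1-t^2)^{n-1}t^{-2n+1}\,dt$. For a nonnegative Borel measure $\mu$ on $B$ the (invariant) Green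 potential is $G_\mu(z)=\int_B G(z,w)\,d\mu(w)$, $z\in B$ (it is not identically $+\infty$ exactly when $\int_B(1-|w|^2)^n\,d\mu(w)<\infty$). For $0<p<\infty$ and a measurable function $u$ on $B$, $m_p(r,u)=\left(\int_S|u(r\xi)|^p\,d\sigma(\xi)\right)^{1/p}$ for $0<r<1$. For $a,b\in\overline{B}$, $d(a,b)=|1-\langle a,b\rangle|^{1/2}$. For $\xi\in S$ and $\delta>0$, $C(\xi,\delta)=\{z\in B: d(z,\xi)<\delta^{1/2}\}$. The notation $\lambda^p(E)$ means $(\lambda(E))^p$. *)

theory Defs
  imports "HOL-Analysis.Analysis"
begin

text \<open>
  \<open>\<complex>\<^sup>n\<close> is \<^typ>\<open>complex ^ 'n\<close> with \<open>n = CARD('n)\<close>. Its library norm is the Hermitian norm,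
  so \<open>B = ball 0 1\<close> and \<open>S = sphere 0 1\<close>. The inner product of the library is real-valued (it is
  the real part of the Hermitian product), hence the following definition.
\<close>

definition hprod :: "complex ^ 'n \<Rightarrow> complex ^ 'n \<Rightarrow> complex" where
  "hprod z w = (\<Sum>j\<in>UNIV. z $ j * cnj (w $ j))"

lemma hprod_self: "hprod z z = of_real ((norm z)\<^sup>2)"
  by (simp add: hprod_def norm_vec_def L2_set_def sum_nonneg complex_norm_square
           del: of_real_power)

definition cproj :: "complex ^ 'n \<Rightarrow> complex ^ 'n \<Rightarrow> complex ^ 'n" where
  "cproj w z = (if w = 0 then 0 else (hprod z w / of_real ((norm w)\<^sup>2)) *s w)"

definition ball_aut :: "complex ^ 'n \<Rightarrow> complex ^ 'n \<Rightarrow> complex ^ 'n" where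
  "ball_aut w z = inverse (1 - hprod z w) *s
     (w - cproj w z - of_real (sqrt (1 - (norm w)\<^sup>2)) *s (z - cproj w z))"

text \<open>
  The integral is taken in \<^typ>\<open>ennreal\<close>, since it is \<open>\<infinity>\<close> at \<open>z = 0\<close>; accordingly the Green
  function is \<open>\<infinity>\<close> on the diagonal, and potentials may take the value \<open>\<infinity>\<close>.
\<close>

definition green_radial :: "complex ^ 'n \<Rightarrow> ennreal" where
  "green_radial z =
     ennreal ((real CARD('n) + 1) / (2 * real CARD('n))) *
     (\<integral>\<^sup>+ t\<in>{norm z..1}.
        ennreal ((1 - t\<^sup>2) ^ (CARD('n) - 1) / t ^ (2 * CARD('n) - 1)) \<partial>lborel)"

definition green :: "complex ^ 'n \<Rightarrow> complex ^ 'n \<Rightarrow> ennreal" where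
  "green z w = green_radial (ball_aut w z)"

definition green_potential :: "(complex ^ 'n) measure \<Rightarrow> complex ^ 'n \<Rightarrow> ennreal" where
  "green_potential \<mu> z = (\<integral>\<^sup>+ w. green z w \<partial>\<mu>)"

text \<open>
  Normalized surface measure, as a measure with space \<open>S\<close>: the radial projection of normalized
  Lebesgue measure on \<open>B\<close>, i.e. \<open>\<sigma>(E) = vol {t \<xi> | 0 < t < 1, \<xi> \<in> E} / vol B\<close>.
\<close>

definition sphere_measure :: "(complex ^ 'n) measure" where
  "sphere_measure =
     restrict_space (distr (uniform_measure lborel (ball 0 1)) borel sgn) (sphere 0 1)"

lemma space_sphere_measure: "space (sphere_measure :: (complex ^ 'n) measure) = sphere 0 1"
  by (simp add: sphere_measure_def space_restrict_space)

lemma sets_sphere_measure: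
  "sets (sphere_measure :: (complex ^ 'n) measure) = sets (restrict_space borel (sphere 0 1))"
  by (simp add: sphere_measure_def sets_restrict_space)

lemma emeasure_sphere_measure_sphere:
  "emeasure (sphere_measure :: (complex ^ 'n) measure) (sphere 0 1) = 1"
proof -
  let ?U = "uniform_measure lborel (ball 0 1) :: (complex ^ 'n) measure"
  have sgn_meas: "sgn \<in> borel_measurable ?U"
    unfolding sgn_div_norm by measurable
  have vim: "sgn -` sphere 0 1 = (UNIV - {0} :: (complex ^ 'n) set)"
    by (auto simp: norm_sgn)
  have "ball 0 1 \<inter> (UNIV - {0}) = (ball 0 1 - {0} :: (complex ^ 'n) set)"
    by auto
  moreover have "emeasure lborel (ball 0 1 - {0} :: (complex ^ 'n) set) =
      emeasure lborel (ball 0 1 :: (complex ^ 'n) set)"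
    by (rule emeasure_Diff_null_set) auto
  moreover have "emeasure lborel (ball 0 1 :: (complex ^ 'n) set) \<noteq> 0"
    using unit_ball_vol_pos[of "real CARD('n) * 2"] by (simp add: emeasure_ball less_imp_neq[symmetric])
  ultimately have "emeasure ?U (UNIV - {0}) = 1"
    using emeasure_lborel_ball_finite[of "0 :: complex ^ 'n" 1]
    by (simp add: ennreal_divide_self)
  then show ?thesis
    by (simp add: sphere_measure_def emeasure_restrict_space emeasure_distr sgn_meas vim
        del: emeasure_uniform_measure)
qed

text \<open>For \<open>a > 0\<close>: the power function \<open>x\<^sup>a\<close> on \<open>[0, \<infinity>]\<close>.\<close>

definition enn_powr :: "ennreal \<Rightarrow> real \<Rightarrow> ennreal" where
  "enn_powr x a = (if x = \<infinity> then \<infinity> else ennreal (enn2real x powr a))"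

definition integral_mean :: "real \<Rightarrow> real \<Rightarrow> (complex ^ 'n \<Rightarrow> ennreal) \<Rightarrow> ennreal" where
  "integral_mean p r u = enn_powr (\<integral>\<^sup>+ \<xi>. enn_powr (u (r *\<^sub>R \<xi>)) p \<partial>sphere_measure) (1 / p)"

definition koranyi_dist :: "complex ^ 'n \<Rightarrow> complex ^ 'n \<Rightarrow> real" where
  "koranyi_dist a b = sqrt (cmod (1 - hprod a b))"

definition koranyi_region :: "complex ^ 'n \<Rightarrow> real \<Rightarrow> (complex ^ 'n) set" where
  "koranyi_region \<xi> \<delta> = {z \<in> ball 0 1. koranyi_dist z \<xi> < sqrt \<delta>}"

definition weighted :: "(complex ^ 'n) measure \<Rightarrow> (complex ^ 'n) measure" where
  "weighted \<mu> = density \<mu> (\<lambda>z. ennreal ((1 - norm z) ^ CARD('n)))"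

text \<open>
  The Landau symbol \<^const>\<open>smallo\<close> for \<open>[0, \<infinity>]\<close>-valued functions; in particular \<open>f\<close> is
  eventually finite.
\<close>

definition enn_smallo :: "'a filter \<Rightarrow> ('a \<Rightarrow> ennreal) \<Rightarrow> ('a \<Rightarrow> real) \<Rightarrow> bool" where
  "enn_smallo F f g \<longleftrightarrow> (\<forall>c>0. eventually (\<lambda>x. f x \<le> ennreal (c * \<bar>g x\<bar>)) F)"

lemma enn_smallo_ennreal:
  assumes "\<And>x. f x \<ge> 0"
  shows "enn_smallo F (\<lambda>x. ennreal (f x)) g \<longleftrightarrow> f \<in> o[F](g)"
  using assms by (simp add: enn_smallo_def smallo_def ennreal_le_iff)

end

theory Submission
  imports Defs
begin

text \<open>
  Write \<open>\<delta> = 1 - r\<close>. The identity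
  \<open>1 - |\<phi>\<^sub>w(z)|\<^sup>2 = (1 - |z|\<^sup>2)(1 - |w|\<^sup>2) / |1 - \<langle>z,w\<rangle>|\<^sup>2\<close> gives
  \<open>G(r\<xi>,w) \<ge> c \<delta>\<^bsup>-n\<^esup> (1 - |w|)\<^bsup>n\<^esup>\<close> for \<open>w \<in> C(\<xi>,\<delta>)\<close>, so \<open>G\<^sub>\<mu>(r\<xi>) \<ge> c \<delta>\<^bsup>-n\<^esup> \<lambda>(C(\<xi>,\<delta>))\<close>, which is
  one direction.

  Conversely, where \<open>|\<phi>\<^sub>w(r\<xi>)| \<ge> 1/2\<close> the kernel is dominated by a dyadic sum, which contributes
  \<open>\<delta>\<^bsup>-n\<^esup> \<Sum>\<^sub>k 4\<^bsup>-nk\<^esup> \<lambda>(C(\<xi>,2\<^bsup>k\<^esup>\<delta>))\<close>; Jensen's inequality with weights \<open>2\<^bsup>-k(2n-\<beta>)\<^esup>\<close>,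
  \<open>\<gamma> < \<beta> < 2n\<close>, controls its \<open>L\<^sup>p\<close> norm. Where \<open>|\<phi>\<^sub>w(r\<xi>)| < 1/2\<close> the kernel is of order
  \<open>|\<phi>\<^sub>w(r\<xi>)|\<^bsup>-(2n-2)\<^esup>\<close> and lives on \<open>C(\<xi>,12\<delta>)\<close>. The set of \<open>\<xi>\<close> with \<open>|\<phi>\<^sub>w(r\<xi>)| < s\<close> has measure
  \<open>O(s\<^bsup>2n-1\<^esup>\<delta>\<^bsup>n\<^esup>)\<close>, so the \<open>p\<close>-th power of the kernel has integral \<open>O(\<delta>\<^bsup>n\<^esup>)\<close> over \<open>\<xi>\<close> because
  \<open>p(2n-2) < 2n-1\<close>; Jensen's inequality and Fubini's theorem then bound the \<open>L\<^sup>p\<close> norm of this part by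
  that of \<open>\<lambda>(C(\<xi>,192\<delta>))\<close>.
\<close>

section \<open>Powers of extended nonnegative reals\<close>

text \<open>The two halves of the kernel meet different obstacles. The dyadic sum involves
  \<lambda>(C(\<xi>,t)) at arbitrarily large t, while the hypothesis speaks of small t only.
  Finiteness of the total mass fills the gap: for each \<epsilon> there is N such that the integral
  of \<lambda>(C(\<xi>,t))^p is at most \<epsilon> t^(\<gamma>p) + N t^(\<beta>p) for every t > 0.
  The second term is negligible as t tends to 0 because \<gamma> < \<beta>.

  For the singular half, fix w. The condition |\<phi>_w(r\<xi>)| < s leaves \<xi> a range of order
  s\<delta> in the imaginary part of \<langle>\<xi>,w/|w|\<rangle> and of order s\<delta>^(1/2) in
  each of the 2n-2 real complex-tangential directions, whence s^(2n-1) \<delta>^n. Jensen's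
  inequality leaves a factor \<lambda>(C(\<xi>,12\<delta>))^(p-1) that depends on \<xi> and prevents
  integrating the kernel over \<xi> on its own. It is removed by an engulfing property: of two
  regions containing w, each lies in the 16-fold enlargement of the other, and 16 * 12 =
  192.\<close>

lemma enn_powr_ennreal: "0 \<le> x \<Longrightarrow> enn_powr (ennreal x) a = ennreal (x powr a)"
  by (simp add: enn_powr_def)

lemma enn_powr_top [simp]: "enn_powr top a = top"
  by (simp add: enn_powr_def)

lemma enn_powr_0 [simp]: "enn_powr 0 a = 0"
  by (simp add: enn_powr_def)

lemma enn_powr_mono:
  assumes "x \<le> y" "0 \<le> a"
  shows "enn_powr x a \<le> enn_powr y a"
proof (cases "y = top")
  case False
  then obtain v where v: "y = ennreal v" "v \<ge> 0" by (cases y) auto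
  with assms obtain u where u: "x = ennreal u" "u \<ge> 0" by (cases x) (auto simp: top_unique)
  have "u \<le> v" using assms u v by simp
  then show ?thesis using u v assms by (simp add: enn_powr_ennreal powr_mono2)
qed simp

lemma enn_powr_mult:
  assumes "0 < a"
  shows "enn_powr (x * y) a = enn_powr x a * enn_powr y a"
proof (cases "x = top \<or> y = top")
  case True
  have *: "enn_powr (top * y) a = top * enn_powr y a" for y
  proof (cases y)
    case (real v)
    show ?thesis
    proof (cases "v = 0")
      case False
      with real show ?thesis by (simp add: enn_powr_ennreal ennreal_top_mult)
    qed (use real in simp)
  qed simp
  then show ?thesis using True *[of x] *[of y] by (auto simp: mult.commute)
next
  case False
  then obtain u v where "x = ennreal u" "u \<ge> 0" "y = ennreal v" "v \<ge> 0"
    by (cases x; cases y) auto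
  then show ?thesis by (simp add: enn_powr_ennreal powr_mult flip: ennreal_mult)
qed

lemma enn_powr_add:
  assumes "0 < a" "0 < b"
  shows "enn_powr x (a + b) = enn_powr x a * enn_powr x b"
  by (cases x) (simp_all add: enn_powr_ennreal powr_add ennreal_mult)

lemma enn_powr_powr: "enn_powr (enn_powr x a) b = enn_powr x (a * b)"
  by (cases x) (simp_all add: enn_powr_ennreal powr_powr)

lemma enn_powr_one [simp]: "enn_powr x 1 = x"
  by (cases x) (simp_all add: enn_powr_ennreal)

lemma measurable_enn_powr [measurable]:
  assumes [measurable]: "f \<in> borel_measurable M"
  shows "(\<lambda>x. enn_powr (f x) a) \<in> borel_measurable M"
  unfolding enn_powr_def by measurable

text \<open>Comparing \<open>x + y\<close> with twice the maximum gives a constant that is not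
  sharp, but uses only monotonicity and multiplicativity.\<close>

lemma enn_powr_add_le:
  assumes "0 < p"
  shows "enn_powr (x + y) p \<le> ennreal (2 powr p) * (enn_powr x p + enn_powr y p)"
proof -
  have "x + y \<le> ennreal 2 * max x y"
  proof -
    have "x + y \<le> max x y + max x y" by (intro add_mono) auto
    then show ?thesis by (simp add: mult_2)
  qed
  then have "enn_powr (x + y) p \<le> enn_powr (ennreal 2 * max x y) p"
    using assms by (intro enn_powr_mono) auto
  also have "\<dots> = ennreal (2 powr p) * enn_powr (max x y) p"
    using assms by (subst enn_powr_mult) (simp_all only: enn_powr_ennreal)
  also have "enn_powr (max x y) p \<le> enn_powr x p + enn_powr y p"
    by (auto simp: max_def intro: add_increasing add_increasing2)
  finally show ?thesis by (simp add: mult_left_mono)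
qed

lemma enn_powr_le_iff:
  assumes "0 < p" "0 \<le> y"
  shows "enn_powr x (1 / p) \<le> ennreal y \<longleftrightarrow> x \<le> ennreal (y powr p)"
proof
  assume "enn_powr x (1 / p) \<le> ennreal y"
  from enn_powr_mono[OF this, of p] assms show "x \<le> ennreal (y powr p)"
    by (simp add: enn_powr_powr enn_powr_ennreal)
next
  assume "x \<le> ennreal (y powr p)"
  from enn_powr_mono[OF this, of "1/p"] assms show "enn_powr x (1 / p) \<le> ennreal y"
    by (simp add: powr_powr enn_powr_ennreal)
qed

text \<open>The constant runs over all positive reals, so \<open>c\<close> and
  \<open>c powr p\<close> may be interchanged. This removes the outer p-th roots, and both sides of
  the equivalence become statements about integrals of p-th powers.\<close>

lemma enn_smallo_root_iff:
  assumes "0 < p"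
  shows "enn_smallo F (\<lambda>x. enn_powr (f x) (1 / p)) g \<longleftrightarrow>
    (\<forall>c>0. eventually (\<lambda>x. f x \<le> ennreal (c * \<bar>g x\<bar> powr p)) F)"
proof -
  have *: "enn_powr (f x) (1 / p) \<le> ennreal (c * \<bar>g x\<bar>) \<longleftrightarrow>
      f x \<le> ennreal (c powr p * \<bar>g x\<bar> powr p)" if "c > 0" for c x
    using that assms by (subst enn_powr_le_iff) (auto simp: powr_mult)
  show ?thesis
    unfolding enn_smallo_def
  proof (intro iffI allI impI)
    fix c :: real
    assume L: "\<forall>c>0. eventually (\<lambda>x. enn_powr (f x) (1 / p) \<le> ennreal (c * \<bar>g x\<bar>)) F" and "c > 0"
    have "c powr (1 / p) > 0" using \<open>c > 0\<close> by simp
    with L have "eventually (\<lambda>x. enn_powr (f x) (1 / p) \<le> ennreal (c powr (1 / p) * \<bar>g x\<bar>)) F"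
      by blast
    then show "eventually (\<lambda>x. f x \<le> ennreal (c * \<bar>g x\<bar> powr p)) F"
      using *[OF \<open>c powr (1 / p) > 0\<close>] \<open>c > 0\<close> assms by (simp add: powr_powr)
  next
    fix c :: real
    assume L: "\<forall>c>0. eventually (\<lambda>x. f x \<le> ennreal (c * \<bar>g x\<bar> powr p)) F" and "c > 0"
    have "c powr p > 0" using \<open>c > 0\<close> by simp
    with L have "eventually (\<lambda>x. f x \<le> ennreal (c powr p * \<bar>g x\<bar> powr p)) F" by blast
    then show "eventually (\<lambda>x. enn_powr (f x) (1 / p) \<le> ennreal (c * \<bar>g x\<bar>)) F"
      by (simp add: *[OF \<open>c > 0\<close>])
  qed
qed

text \<open>The convex function \<open>x powr p\<close> lies above its tangent at \<open>c\<close>.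
  The negative part of the tangent is moved to the other side, so that the inequality carries over
  to extended nonnegative reals without subtraction.\<close>

lemma powr_tangent_le:
  fixes x c p :: real
  assumes "1 < p" "0 < c" "0 \<le> x"
  shows "p * c powr (p - 1) * x \<le> x powr p + (p - 1) * c powr p"
proof -
  define f where "f = (\<lambda>x::real. x powr p - p * c powr (p - 1) * x)"
  have "f c \<le> f x"
  proof (cases "x = 0")
    case True
    have "f c = (1 - p) * c powr p" using assms powr_add[of c "p - 1" 1]
      by (simp add: f_def algebra_simps)
    also have "\<dots> \<le> 0" using assms by (simp add: mult_nonpos_nonneg)
    finally show ?thesis using True by (simp add: f_def)
  next
    case False
    then have "x > 0" using assms by simp
    have der: "(f has_real_derivative (p * t powr (p - 1) - p * c powr (p - 1))) (at t)"
      if "t > 0" for t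
      unfolding f_def using that by (auto intro!: derivative_eq_intros)
    show ?thesis
    proof (cases "x \<le> c")
      case True
      show ?thesis
      proof (rule DERIV_nonpos_imp_nonincreasing[of x c f, OF True])
        fix t assume "x \<le> t" "t \<le> c"
        then have "t powr (p - 1) \<le> c powr (p - 1)" "t > 0"
          using \<open>x > 0\<close> assms by (auto intro!: powr_mono2)
        then show "\<exists>y. (f has_real_derivative y) (at t) \<and> y \<le> 0"
          using der[of t] assms
            by (intro exI[of _ "p * t powr (p - 1) - p * c powr (p - 1)"] conjI) auto
      qed
    next
      case False
      show ?thesis
      proof (rule DERIV_nonneg_imp_nondecreasing[of c x f])
        show "c \<le> x" using False by simp
      next
        fix t assume "c \<le> t" "t \<le> x"
        then have "c powr (p - 1) \<le> t powr (p - 1)" "t > 0"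
          using assms by (auto intro!: powr_mono2)
        then show "\<exists>y. (f has_real_derivative y) (at t) \<and> y \<ge> 0"
          using der[of t] assms
            by (intro exI[of _ "p * t powr (p - 1) - p * c powr (p - 1)"] conjI) auto
      qed
    qed
  qed
  moreover have "p * c powr (p - 1) * c = p * c powr p"
    using assms powr_add[of c "p - 1" 1] by simp
  ultimately show ?thesis unfolding f_def left_diff_distrib mult_1 by linarith
qed

lemma enn_powr_tangent_le:
  assumes "1 < p" "0 < c"
  shows "ennreal (p * c powr (p - 1)) * x \<le> enn_powr x p + ennreal ((p - 1) * c powr p)"
proof (cases x)
  case (real r)
  then have "ennreal (p * c powr (p - 1)) * x = ennreal (p * c powr (p - 1) * r)"
    using assms by (simp add: ennreal_mult)
  also have "\<dots> \<le> ennreal (r powr p + (p - 1) * c powr p)"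
    using powr_tangent_le[of p c r] assms real by (intro ennreal_leI) simp
  also have "\<dots> = enn_powr x p + ennreal ((p - 1) * c powr p)"
    using assms real by (simp add: enn_powr_ennreal)
  finally show ?thesis .
qed simp

text \<open>The tangent inequality is integrated and the point of tangency chosen afterwards. The
  measure is not normalized, which produces the power \<open>p - 1\<close> of the total
  mass.\<close>

lemma Jensen_enn_powr:
  fixes p :: real
  assumes "finite_measure M" and p: "1 < p" and f [measurable]: "f \<in> borel_measurable M"
  shows "enn_powr (\<integral>\<^sup>+x. f x \<partial>M) p \<le>
    enn_powr (emeasure M (space M)) (p - 1) * (\<integral>\<^sup>+x. enn_powr (f x) p \<partial>M)"
proof -
  interpret finite_measure M by fact
  define A where "A = measure M (space M)"
  have A: "emeasure M (space M) = ennreal A" by (simp add: A_def emeasure_eq_measure)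
  have A0: "A \<ge> 0" by (simp add: A_def)
  let ?J = "\<integral>\<^sup>+x. enn_powr (f x) p \<partial>M"
  have key: "ennreal (p * c powr (p - 1)) * (\<integral>\<^sup>+x. f x \<partial>M) \<le> ?J + ennreal ((p - 1) * c powr p * A)"
    if "c > 0" for c
  proof -
    have "ennreal (p * c powr (p - 1)) * (\<integral>\<^sup>+x. f x \<partial>M) =
        (\<integral>\<^sup>+x. ennreal (p * c powr (p - 1)) * f x \<partial>M)"
      by (simp add: nn_integral_cmult)
    also have "\<dots> \<le> (\<integral>\<^sup>+x. enn_powr (f x) p + ennreal ((p - 1) * c powr p) \<partial>M)"
      using p that by (intro nn_integral_mono enn_powr_tangent_le) auto
    also have "\<dots> = ?J + ennreal ((p - 1) * c powr p) * emeasure M (space M)"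
      by (simp add: nn_integral_add)
    finally show ?thesis using p A0 by (simp add: A flip: ennreal_mult)
  qed
  show ?thesis
  proof (cases "A = 0")
    case True
    have "(\<integral>\<^sup>+x. f x \<partial>M) = 0"
      using A True by (intro nn_integral_null_measure[THEN trans[rotated]])
        (auto intro!: nn_integral_0_iff_AE[THEN iffD2] AE_I[of _ _ "space M"])
    then show ?thesis by simp
  next
    case False
    with A0 have "A > 0" by simp
    show ?thesis
    proof (cases "\<integral>\<^sup>+x. f x \<partial>M")
      \<comment> \<open>Any tangent, here the one at 1, has positive slope and thus forces the
        integral of the p-th power to be infinite as well.\<close>
      case top
      have "?J = top"
        using key[of 1] p by (auto simp: top ennreal_mult_top ennreal_add_eq_top top_unique)
      then show ?thesis using \<open>A > 0\<close> by (simp add: A enn_powr_ennreal ennreal_mult_top)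
    next
      case (real i)
      show ?thesis
      proof (cases "i = 0")
        case False
        with real have "i > 0" by simp
        \<comment> \<open>The mean value of \<open>f\<close>, which is the point of tangency giving
          the sharp inequality.\<close>
        define c where "c = i / A"
        have "c > 0" using \<open>i > 0\<close> \<open>A > 0\<close> by (simp add: c_def)
        show ?thesis
        proof (cases ?J)
          case top
          then show ?thesis using \<open>A > 0\<close> by (simp add: A enn_powr_ennreal ennreal_mult_top)
        next
          case (real j)
          have "p * c powr (p - 1) * i \<le> j + (p - 1) * c powr p * A"
            using key[OF \<open>c > 0\<close>] p A0 \<open>i > 0\<close> real unfolding \<open>(\<integral>\<^sup>+x. f x \<partial>M) = ennreal i\<close>
            by (simp flip: ennreal_mult ennreal_plus)
          moreover
          have "c powr p * A = c powr (p - 1) * i"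
            using powr_add[of c "p - 1" 1] \<open>c > 0\<close> \<open>A > 0\<close> \<open>i > 0\<close> by (simp add: c_def)
          then have "(p - 1) * c powr p * A = (p - 1) * (c powr (p - 1) * i)"
            by (simp only: mult.assoc)
          ultimately have "c powr (p - 1) * i \<le> j"
            by (simp add: algebra_simps)
          then have "A powr (p - 1) * (c powr (p - 1) * i) \<le> A powr (p - 1) * j"
            by (rule mult_left_mono) simp
          moreover have "A powr (p - 1) * (c powr (p - 1) * i) = i powr p"
            using \<open>i > 0\<close> \<open>A > 0\<close> powr_add[of i "p - 1" 1]
            by (simp add: c_def powr_divide)
          ultimately show ?thesis
            using real \<open>i > 0\<close> \<open>A > 0\<close> unfolding \<open>(\<integral>\<^sup>+x. f x \<partial>M) = ennreal i\<close>
            by (simp add: A enn_powr_ennreal flip: ennreal_mult)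
        qed
      qed (use real in simp)
    qed
  qed
qed

section \<open>The Hermitian product\<close>

lemma hprod_add_left: "hprod (x + y) z = hprod x z + hprod y z"
  by (simp add: hprod_def algebra_simps sum.distrib)

lemma hprod_diff_left: "hprod (x - y) z = hprod x z - hprod y z"
  by (simp add: hprod_def algebra_simps sum_subtractf)

lemma hprod_diff_right: "hprod z (x - y) = hprod z x - hprod z y"
  by (simp add: hprod_def algebra_simps sum_subtractf)

lemma hprod_mult_left: "hprod (c *s x) z = c * hprod x z"
  by (simp add: hprod_def sum_distrib_left mult.assoc)

lemma hprod_mult_right: "hprod z (c *s x) = cnj c * hprod z x"
  by (simp add: hprod_def sum_distrib_left mult_ac)

lemma hprod_scaleR_left: "hprod (c *\<^sub>R x) z = of_real c * hprod x z"
  unfolding hprod_def sum_distrib_left vector_scaleR_component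
  by (simp add: scaleR_conv_of_real mult_ac)

lemma hprod_scaleR_right: "hprod z (c *\<^sub>R x) = of_real c * hprod z x"
  unfolding hprod_def sum_distrib_left vector_scaleR_component
  by (simp add: scaleR_conv_of_real mult_ac)

lemma cnj_hprod: "cnj (hprod x y) = hprod y x"
  by (simp add: hprod_def mult.commute)

lemma norm_hprod_commute: "cmod (1 - hprod x y) = cmod (1 - hprod y x)"
  using complex_mod_cnj[of "1 - hprod x y"] by (simp add: cnj_hprod)

lemma norm_hprod_le: "cmod (hprod x y) \<le> norm x * norm y"
proof -
  have "cmod (hprod x y) \<le> (\<Sum>j\<in>UNIV. \<bar>cmod (x $ j)\<bar> * \<bar>cmod (y $ j)\<bar>)"
    unfolding hprod_def by (rule order_trans[OF norm_sum]) (simp add: norm_mult)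
  also have "\<dots> \<le> norm x * norm y"
    unfolding norm_vec_def by (rule L2_set_mult_ineq)
  finally show ?thesis .
qed

lemma hprod_axis: "hprod x (axis j c) = x $ j * cnj c"
proof -
  have "hprod x (axis j c) = (\<Sum>i\<in>UNIV. if i = j then x $ j * cnj c else 0)"
    unfolding hprod_def by (intro sum.cong) (auto simp: axis_def)
  then show ?thesis by simp
qed

lemma norm_power2_sum: "(norm (x :: complex ^ 'n))\<^sup>2 = (\<Sum>j\<in>UNIV. (cmod (x $ j))\<^sup>2)"
  by (simp add: norm_vec_def L2_set_def sum_nonneg)

lemma norm_mult_vec: "norm (c *s x) = cmod c * norm (x :: complex ^ 'n)"
  by (simp add: norm_vec_def L2_set_def norm_mult power_mult_distrib real_sqrt_mult
      flip: sum_distrib_left)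

lemma norm_diff_power2:
  "(norm (x - y :: complex ^ 'n))\<^sup>2 = (norm x)\<^sup>2 - 2 * Re (hprod x y) + (norm y)\<^sup>2"
proof -
  have "complex_of_real ((norm (x - y))\<^sup>2) = hprod (x - y) (x - y)"
    by (simp only: hprod_self)
  also have "\<dots> = hprod x x - (hprod x y + cnj (hprod x y)) + hprod y y"
    by (simp add: hprod_diff_left hprod_diff_right cnj_hprod)
  also have "\<dots> = complex_of_real ((norm x)\<^sup>2 - 2 * Re (hprod x y) + (norm y)\<^sup>2)"
    by (simp add: hprod_self complex_add_cnj del: of_real_power)
  finally show ?thesis by (simp only: of_real_eq_iff)
qed

text \<open>A Householder reflection: \<open>R\<close> reflects in the complex hyperplane orthogonal
  to \<open>\<eta> - b\<close>, where \<open>b\<close> is a unit multiple of the \<open>j\<close>-th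
  basis vector, and so exchanges \<open>\<eta>\<close> and \<open>b\<close>. Being self-adjoint, it
  satisfies \<langle>R x,b\<rangle> = \<langle>x,\<eta>\<rangle>; the factor
  \<open>cnj \<theta>\<close> turns the left side into a coordinate. If \<open>\<eta> = b\<close>,
  division by zero makes \<open>R\<close> the identity, as it should.\<close>

lemma unitary_to_coordinate:
  fixes \<eta> :: "complex ^ 'n" and j :: 'n
  assumes "norm \<eta> = 1"
  obtains f where "bij f" "linear f" "\<And>x. norm (f x) = norm x" "\<And>x. f x $ j = hprod x \<eta>"
proof -
  \<comment> \<open>The phase makes \<langle>\<eta>,b\<rangle> real. Over the complex numbers this
    is what a reflection needs to carry \<open>\<eta>\<close> to \<open>b\<close>: it gives
    \<langle>v,b\<rangle> = -|v|^2/2.\<close>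
  define \<theta> where "\<theta> = (if \<eta> $ j = 0 then 1 else \<eta> $ j / cmod (\<eta> $ j))"
  have th: "\<theta> * cnj \<theta> = 1" "cmod \<theta> = 1"
    by (auto simp: \<theta>_def complex_norm_square[symmetric] norm_divide
        simp del: of_real_power simp flip: complex_norm_square)
  define b where "b = axis j \<theta>"
  have eb: "hprod \<eta> b = complex_of_real (cmod (\<eta> $ j))"
    by (auto simp: b_def hprod_axis \<theta>_def complex_norm_square[symmetric] power2_eq_square)
  have "complex_of_real ((norm b)\<^sup>2) = hprod b b" by (simp only: hprod_self)
  also have "\<dots> = 1" unfolding b_def hprod_axis by (simp add: axis_def th)
  finally have "(norm b)\<^sup>2 = 1" by (simp only: of_real_eq_1_iff)
  then have nb: "norm b = 1" using power_eq_iff_eq_base[of 2 "norm b" 1] by simp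
  define v where "v = \<eta> - b"
  have vv: "complex_of_real ((norm v)\<^sup>2) = 2 - 2 * hprod \<eta> b"
    unfolding v_def norm_diff_power2 using assms nb eb by simp
  define R where "R = (\<lambda>x :: complex ^ 'n. x - (2 * hprod x v / of_real ((norm v)\<^sup>2)) *s v)"
  define f where "f = (\<lambda>x. cnj \<theta> *s R x)"
  have normR: "norm (R x) = norm x" for x
  proof (cases "v = 0")
    case False
    define a where "a = 2 * hprod x v / of_real ((norm v)\<^sup>2)"
    have "Re (hprod x (a *s v)) = 2 * (cmod (hprod x v))\<^sup>2 / (norm v)\<^sup>2"
    proof -
      have "hprod x (a *s v) = complex_of_real (2 * (cmod (hprod x v))\<^sup>2 / (norm v)\<^sup>2)"
        unfolding hprod_mult_right a_def by (simp add: complex_norm_square del: of_real_power)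
      then show ?thesis by (simp only: Re_complex_of_real)
    qed
    moreover have "(norm (a *s v))\<^sup>2 = 4 * (cmod (hprod x v))\<^sup>2 / (norm v)\<^sup>2"
      using False by (simp add: norm_mult_vec a_def norm_divide norm_mult power2_eq_square field_simps)
    ultimately have "(norm (R x))\<^sup>2 = (norm x)\<^sup>2"
      unfolding R_def a_def[symmetric] norm_diff_power2 by simp
    then show ?thesis by simp
  qed (simp add: R_def)
  have nf: "norm (f x) = norm x" for x by (simp add: f_def norm_mult_vec normR th)
  have lin: "linear f"
  proof (rule linearI)
    show "f (x + y) = f x + f y" for x y
      by (simp add: f_def R_def hprod_add_left vec_eq_iff algebra_simps add_divide_distrib)
    show "f (c *\<^sub>R x) = c *\<^sub>R f x" for c x
      by (simp add: f_def R_def hprod_scaleR_left vec_eq_iff scaleR_conv_of_real[where 'a = complex] algebra_simps)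
  qed
  have "inj f"
    using nf by (simp add: linear_injective_0[OF lin]) (metis norm_eq_zero)
  then have "bij f"
    using linear_injective_imp_surjective[OF lin] by (simp add: bij_def)
  moreover have "f x $ j = hprod x \<eta>" for x
  proof -
    have "f x $ j = hprod (R x) b"
      by (simp add: f_def b_def hprod_axis mult.commute)
    also have "\<dots> = hprod x b - 2 * hprod x v / of_real ((norm v)\<^sup>2) * hprod v b"
      by (simp add: R_def hprod_diff_left hprod_mult_left)
    also have "hprod v b = - complex_of_real ((norm v)\<^sup>2) / 2"
      unfolding vv using nb by (simp add: v_def hprod_diff_left hprod_self)
    also have "hprod x b - 2 * hprod x v / of_real ((norm v)\<^sup>2) * (- complex_of_real ((norm v)\<^sup>2) / 2)
        = hprod x b + hprod x v"
      by (cases "v = 0") (simp_all add: hprod_def)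
    also have "\<dots> = hprod x \<eta>" by (simp add: v_def hprod_diff_right)
    finally show ?thesis .
  qed
  ultimately show thesis using that lin nf by blast
qed

section \<open>Caps and slabs on the sphere\<close>

text \<open>The library proves invariance of Lebesgue measure under isometries only for index types that
  are well-ordered. Since an isometry maps balls to balls, it also follows from the Vitali covering
  theorem.\<close>

lemma emeasure_le_vimage_isometry:
  fixes f :: "'a::euclidean_space \<Rightarrow> 'a"
  assumes f: "bij f" "linear f" "\<And>x. norm (f x) = norm x" and U: "open U"
  shows "emeasure lborel U \<le> emeasure lborel (f -` U)"
proof -
  have dist: "dist (f x) (f y) = dist x y" for x y
    using f(3)[of "x - y"] linear_diff[OF f(2)] by (simp add: dist_norm)
  have ball: "f -` ball c r = ball (inv f c) r" for c r
    using dist[of "inv f c"] f(1) by (auto simp: bij_is_surj surj_f_inv_f)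
  have cont: "continuous_on UNIV f" using f(2) by (simp add: linear_continuous_on linear_conv_bounded_linear)
  define K where "K = {i :: 'a \<times> real. ball (fst i) (snd i) \<subseteq> U}"
  obtain C where C: "countable C" "C \<subseteq> K"
     "pairwise (\<lambda>i j. disjnt (ball (fst i) (snd i)) (ball (fst j) (snd j))) C"
     "negligible (U - (\<Union>i\<in>C. ball (fst i) (snd i)))"
  proof (rule Vitali_covering_theorem_balls[of U K fst snd])
    fix x and d :: real assume "x \<in> U" "d > 0"
    with U obtain e where "e > 0" "ball x e \<subseteq> U" by (meson openE)
    then show "\<exists>i. i \<in> K \<and> x \<in> ball (fst i) (snd i) \<and> snd i < d"
      using \<open>d > 0\<close> by (intro exI[of _ "(x, min e (d / 2))"]) (auto simp: K_def)
  qed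
  define B where "B = (\<lambda>i :: 'a \<times> real. ball (fst i) (snd i))"
  have disj: "disjoint_family_on B C" "disjoint_family_on (\<lambda>i. f -` B i) C"
    using C(3) unfolding disjoint_family_on_def pairwise_def disjnt_def B_def by blast+
  have sub: "(\<Union>i\<in>C. B i) \<subseteq> U" using C(2) by (auto simp: K_def B_def)
  have op: "open (\<Union>i\<in>C. B i)" by (auto simp: B_def)
  have "U - (\<Union>i\<in>C. B i) \<in> null_sets lebesgue"
    using C(4) by (simp add: B_def negligible_iff_null_sets)
  then have "U - (\<Union>i\<in>C. B i) \<in> null_sets lborel"
    using U op by (subst (asm) null_sets_completion_iff) auto
  then have "emeasure lborel (U - (U - (\<Union>i\<in>C. B i))) = emeasure lborel U"
    using U by (intro emeasure_Diff_null_set) auto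
  moreover have "U - (U - (\<Union>i\<in>C. B i)) = (\<Union>i\<in>C. B i)" using sub by auto
  ultimately have "emeasure lborel U = emeasure lborel (\<Union>i\<in>C. B i)" by simp
  also have "\<dots> = (\<integral>\<^sup>+i. emeasure lborel (B i) \<partial>count_space C)"
    using C(1) disj by (intro emeasure_UN_countable) (auto simp: B_def)
  also have "\<dots> = (\<integral>\<^sup>+i. emeasure lborel (f -` B i) \<partial>count_space C)"
  proof (intro nn_integral_cong)
    fix i show "emeasure lborel (B i) = emeasure lborel (f -` B i)"
      unfolding B_def ball
      by (cases "snd i \<ge> 0") (simp_all add: emeasure_ball ball_empty)
  qed
  also have "\<dots> = emeasure lborel (\<Union>i\<in>C. f -` B i)"
    using C(1) disj by (intro emeasure_UN_countable[symmetric]) (auto simp: B_def ball)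
  also have "\<dots> \<le> emeasure lborel (f -` U)"
    using sub open_vimage[OF U cont] by (intro emeasure_mono) auto
  finally show ?thesis .
qed

text \<open>The inequality is applied to \<open>f\<close> and to its inverse, which is again a
  linear isometry.\<close>

lemma emeasure_vimage_isometry:
  fixes f :: "'a::euclidean_space \<Rightarrow> 'a"
  assumes f: "bij f" "linear f" "\<And>x. norm (f x) = norm x" and U: "open U"
  shows "emeasure lborel (f -` U) = emeasure lborel U"
proof (rule antisym)
  have lin: "linear (inv f)"
    using f(1,2) by (simp add: bij_def inj_linear_imp_inv_linear)
  have "norm (inv f x) = norm x" for x
    using f(3)[of "inv f x"] f(1) by (simp add: bij_is_surj surj_f_inv_f)
  moreover have "open (f -` U)"
    using f(2) U by (intro open_vimage) (simp_all add: linear_continuous_on linear_conv_bounded_linear)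
  ultimately have "emeasure lborel (f -` U) \<le> emeasure lborel (inv f -` (f -` U))"
    using f(1) lin by (intro emeasure_le_vimage_isometry) (auto simp: bij_imp_bij_inv)
  also have "inv f -` (f -` U) = U" using f(1) by (auto simp: bij_is_surj surj_f_inv_f)
  finally show "emeasure lborel (f -` U) \<le> emeasure lborel U" .
qed (rule emeasure_le_vimage_isometry[OF assms])

section \<open>Boxes in real coordinates and the sets on the sphere compared with them\<close>

lemma Basis_complex_vec:
  "(Basis :: (complex ^ 'n) set) = (\<lambda>(i, b). axis i b) ` (UNIV \<times> {1, \<i>})"
  by (auto simp: Basis_vec_def Basis_complex_def)

lemma mem_box_complex_vec:
  fixes x l u :: "complex ^ 'n"
  shows "x \<in> box l u \<longleftrightarrow> (\<forall>i. Re (l $ i) < Re (x $ i) \<and> Re (x $ i) < Re (u $ i) \<and>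
     Im (l $ i) < Im (x $ i) \<and> Im (x $ i) < Im (u $ i))"
  by (auto simp: mem_box Basis_complex_vec inner_axis inner_complex_def)

lemma emeasure_box_complex_vec:
  fixes l u :: "complex ^ 'n"
  assumes "\<And>i. Re (l $ i) \<le> Re (u $ i)" "\<And>i. Im (l $ i) \<le> Im (u $ i)"
  shows "emeasure lborel (box l u) =
    ennreal (\<Prod>i\<in>UNIV. (Re (u $ i) - Re (l $ i)) * (Im (u $ i) - Im (l $ i)))"
proof -
  have inj: "inj_on (\<lambda>(i, b). axis i b :: complex ^ 'n) (UNIV \<times> {1, \<i>})"
    by (auto simp: inj_on_def axis_eq_axis)
  have "emeasure lborel (box l u) = (\<Prod>b\<in>Basis. (u - l) \<bullet> b)"
    using assms by (intro emeasure_lborel_box)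
      (auto simp: Basis_complex_vec inner_axis inner_complex_def)
  also have "(\<Prod>b\<in>Basis. (u - l) \<bullet> b) = (\<Prod>(i, b)\<in>UNIV \<times> {1, \<i>}. (u - l) \<bullet> axis i b)"
    unfolding Basis_complex_vec by (subst prod.reindex[OF inj]) (auto simp: case_prod_unfold o_def)
  also have "\<dots> = (\<Prod>i\<in>UNIV. \<Prod>b\<in>{1, \<i>}. (u - l) \<bullet> axis i b)"
    by (simp only: prod.cartesian_product)
  also have "\<dots> = (\<Prod>i\<in>UNIV. (Re (u $ i) - Re (l $ i)) * (Im (u $ i) - Im (l $ i)))"
    by (intro prod.cong) (auto simp: inner_axis inner_complex_def)
  finally show ?thesis .
qed

lemma emeasure_sphere_measure:
  assumes "A \<in> sets borel" "A \<subseteq> sphere 0 1"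
  shows "emeasure (sphere_measure :: (complex ^ 'n) measure) A =
    emeasure lborel (ball 0 1 \<inter> sgn -` A) / emeasure lborel (ball 0 1 :: (complex ^ 'n) set)"
proof -
  let ?U = "uniform_measure lborel (ball 0 1) :: (complex ^ 'n) measure"
  have sgn_meas: "sgn \<in> borel_measurable ?U"
    unfolding sgn_div_norm by measurable
  have "sgn -` A \<in> sets lborel"
    using measurable_sets[OF sgn_meas assms(1)] by simp
  then show ?thesis
    using assms by (simp add: sphere_measure_def emeasure_restrict_space emeasure_distr sgn_meas)
qed

lemma unit_ball_volume:
  obtains V where "V > 0" "emeasure lborel (ball 0 1 :: (complex ^ 'n) set) = ennreal V"
  using unit_ball_vol_pos[of "real CARD('n) * 2"]
  by (intro that[of "unit_ball_vol (real CARD('n) * 2)"]) (auto simp: emeasure_ball)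

lemma prod_card_except:
  fixes a b :: real
  shows "(\<Prod>i\<in>UNIV. if i = (j :: 'n :: finite) then a else b) = a * b ^ (CARD('n) - 1)"
  by (subst prod.remove[of _ j]) (auto simp: card_Diff_singleton)

lemma closed_slab: "closed {\<xi> \<in> sphere 0 1. \<bar>Im (hprod \<xi> \<eta>)\<bar> \<le> a \<and> 1 - (cmod (hprod \<xi> \<eta>))\<^sup>2 \<le> b}"
proof -
  have "continuous_on UNIV (\<lambda>\<xi>. hprod \<xi> \<eta>)"
    unfolding hprod_def by (intro continuous_intros)
  then have "closed {\<xi>. \<bar>Im (hprod \<xi> \<eta>)\<bar> \<le> a \<and> 1 - (cmod (hprod \<xi> \<eta>))\<^sup>2 \<le> b}"
    by (intro closed_Collect_conj closed_Collect_le continuous_intros) auto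
  moreover have "{\<xi> \<in> sphere 0 1. \<bar>Im (hprod \<xi> \<eta>)\<bar> \<le> a \<and> 1 - (cmod (hprod \<xi> \<eta>))\<^sup>2 \<le> b} =
      sphere 0 1 \<inter> {\<xi>. \<bar>Im (hprod \<xi> \<eta>)\<bar> \<le> a \<and> 1 - (cmod (hprod \<xi> \<eta>))\<^sup>2 \<le> b}"
    by auto
  ultimately show ?thesis by (simp add: closed_Int)
qed

text \<open>After a unitary change of coordinates \<langle>x,\<eta>\<rangle> is the
  \<open>j\<close>-th coordinate, and the cone over the slab fits into a box: the imaginary part of
  that coordinate is at most a, its real part at most 1, and every other coordinate has modulus at
  most b^(1/2) since the squares sum to |x|^2. With a of order s\<delta> and b of order s^2 \<delta>
  the bound becomes s^(2n-1) \<delta>^n.\<close>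

lemma sphere_measure_slab_le:
  obtains C where "C > 0"
    "\<And>\<eta> a b. norm (\<eta> :: complex ^ 'n) = 1 \<Longrightarrow> a > 0 \<Longrightarrow> b > 0 \<Longrightarrow>
      emeasure sphere_measure {\<xi> \<in> sphere 0 1. \<bar>Im (hprod \<xi> \<eta>)\<bar> \<le> a \<and> 1 - (cmod (hprod \<xi> \<eta>))\<^sup>2 \<le> b}
      \<le> ennreal (C * (a * b ^ (CARD('n) - 1)))"
proof -
  obtain V where V: "V > 0" "emeasure lborel (ball 0 1 :: (complex ^ 'n) set) = ennreal V"
    by (rule unit_ball_volume)
  show thesis
  proof (rule that[of "16 * 16 ^ (CARD('n) - 1) / V"])
    show "16 * 16 ^ (CARD('n) - 1) / V > 0" using V by simp
    fix \<eta> :: "complex ^ 'n" and a b :: real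
    assume \<eta>: "norm \<eta> = 1" and ab: "a > 0" "b > 0"
    define A where "A = {\<xi> \<in> sphere 0 1. \<bar>Im (hprod \<xi> \<eta>)\<bar> \<le> a \<and> 1 - (cmod (hprod \<xi> \<eta>))\<^sup>2 \<le> b}"
    have A: "A \<in> sets borel" unfolding A_def by (intro borel_closed closed_slab)
    obtain j :: 'n where True by simp
    obtain f where f: "bij f" "linear f" "\<And>x. norm (f x) = norm x" "\<And>x. f x $ j = hprod x \<eta>"
      using unitary_to_coordinate[OF \<eta>] by blast
    \<comment> \<open>The side lengths are doubled because the box is open while the bounds are not
      strict. Its volume is 16a (16b)^(n-1).\<close>
    define u :: "complex ^ 'n" where
      "u = (\<chi> i. if i = j then Complex 2 (2 * a) else Complex (2 * sqrt b) (2 * sqrt b))"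
    have "ball 0 1 \<inter> sgn -` A \<subseteq> f -` box (- u) u"
    proof
      fix x assume x: "x \<in> ball 0 1 \<inter> sgn -` A"
      then have "x \<noteq> 0" "norm x < 1" by (auto simp: A_def)
      define h where "h = hprod (sgn x) \<eta>"
      have h: "\<bar>Im h\<bar> \<le> a" "1 - (cmod h)\<^sup>2 \<le> b" using x by (auto simp: A_def h_def)
      have fj: "f x $ j = of_real (norm x) * h"
        using \<open>x \<noteq> 0\<close> by (simp add: f(4) h_def sgn_div_norm hprod_scaleR_left)
      have "norm x * \<bar>Im h\<bar> \<le> 1 * a"
        using h \<open>norm x < 1\<close> by (intro mult_mono) auto
      then have "\<bar>Im (f x $ j)\<bar> \<le> a" unfolding fj by (simp add: abs_mult)
      moreover have "\<bar>Re (f x $ j)\<bar> \<le> norm x"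
        using abs_Re_le_cmod[of "f x $ j"] Finite_Cartesian_Product.norm_nth_le[of "f x" j] f(3)[of x]
        by simp
      moreover have le: "cmod (f x $ k) \<le> sqrt b" if "k \<noteq> j" for k
      proof (rule real_le_rsqrt)
        have "(cmod (f x $ j))\<^sup>2 + (cmod (f x $ k))\<^sup>2 \<le> (norm (f x))\<^sup>2"
          unfolding norm_power2_sum using that
          by (intro order_trans[OF _ sum_mono2[of UNIV "{j, k}"]]) auto
        also have "(cmod (f x $ j))\<^sup>2 = (norm x)\<^sup>2 * (cmod h)\<^sup>2"
          by (simp add: fj norm_mult power_mult_distrib)
        finally have "(cmod (f x $ k))\<^sup>2 \<le> (norm x)\<^sup>2 * (1 - (cmod h)\<^sup>2)"
          by (simp add: f(3) algebra_simps)
        also have "\<dots> \<le> (norm x)\<^sup>2 * b" using h by (intro mult_left_mono) auto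
        also have "\<dots> \<le> 1 * b" using \<open>norm x < 1\<close> ab
          by (intro mult_right_mono power_le_one) auto
        finally show "(cmod (f x $ k))\<^sup>2 \<le> b" by simp
      qed
      have "\<bar>Re (f x $ k)\<bar> < 2 * sqrt b \<and> \<bar>Im (f x $ k)\<bar> < 2 * sqrt b" if "k \<noteq> j" for k
        using le[OF that] ab abs_Re_le_cmod[of "f x $ k"] abs_Im_le_cmod[of "f x $ k"]
          real_sqrt_gt_zero[of b] by linarith
      ultimately show "x \<in> f -` box (- u) u"
        using ab \<open>norm x < 1\<close> by (simp add: mem_box_complex_vec u_def abs_less_iff) force
    qed
    moreover have "open (f -` box (- u) u)"
      using f(2) by (intro open_vimage open_box) (simp add: linear_continuous_on linear_conv_bounded_linear)
    ultimately have "emeasure lborel (ball 0 1 \<inter> sgn -` A) \<le> emeasure lborel (f -` box (- u) u)"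
      by (intro emeasure_mono) auto
    also have "\<dots> = emeasure lborel (box (- u) u)"
      using f by (intro emeasure_vimage_isometry) auto
    also have "\<dots> = ennreal (\<Prod>i\<in>UNIV. if i = j then 16 * a else 16 * b)"
      using ab by (subst emeasure_box_complex_vec)
        (auto simp: u_def intro!: arg_cong[where f = ennreal] prod.cong)
    also have "\<dots> = ennreal (16 * 16 ^ (CARD('n) - 1) * (a * b ^ (CARD('n) - 1)))"
      by (subst prod_card_except) (simp add: power_mult_distrib mult_ac)
    finally have "emeasure sphere_measure A \<le>
        ennreal (16 * 16 ^ (CARD('n) - 1) * (a * b ^ (CARD('n) - 1))) / ennreal V"
      using A by (subst emeasure_sphere_measure) (auto simp: A_def V(2) intro!: divide_right_mono_ennreal)
    also have "\<dots> = ennreal (16 * 16 ^ (CARD('n) - 1) / V * (a * b ^ (CARD('n) - 1)))"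
      using V ab by (subst divide_ennreal) auto
    finally show "emeasure sphere_measure {\<xi> \<in> sphere 0 1. \<bar>Im (hprod \<xi> \<eta>)\<bar> \<le> a \<and> 1 - (cmod (hprod \<xi> \<eta>))\<^sup>2 \<le> b}
      \<le> ennreal (16 * 16 ^ (CARD('n) - 1) / V * (a * b ^ (CARD('n) - 1)))"
      by (simp only: A_def)
  qed
qed

lemma open_Collect_hprod: "open {\<xi>. cmod (1 - hprod \<xi> \<eta>) < t}"
proof -
  have "continuous_on UNIV (\<lambda>\<xi>. hprod \<xi> \<eta>)"
    unfolding hprod_def by (intro continuous_intros)
  then show ?thesis by (intro open_Collect_less continuous_intros)
qed

text \<open>The cone over the cap contains a preimage of a box: the real part of
  \<langle>x,\<eta>\<rangle>, essentially the radial direction, runs through an interval of fixed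
  length, the imaginary part through one of order t, and each of the other 2n-2 real coordinates
  through one of order t^(1/2). The volume is therefore of order t^n.\<close>

lemma sphere_measure_cap_ge:
  obtains c where "c > 0"
    "\<And>\<eta> t. norm (\<eta> :: complex ^ 'n) = 1 \<Longrightarrow> 0 < t \<Longrightarrow> t < 1 \<Longrightarrow>
      ennreal (c * t ^ CARD('n)) \<le> emeasure sphere_measure {\<xi> \<in> sphere 0 1. cmod (1 - hprod \<xi> \<eta>) < t}"
proof -
  obtain V where V: "V > 0" "emeasure lborel (ball 0 1 :: (complex ^ 'n) set) = ennreal V"
    by (rule unit_ball_volume)
  let ?N = "real CARD('n)"
  have N: "?N \<ge> 1" by (simp add: Suc_leI)
  show thesis
  proof (rule that[of "(1 / 16) * (1 / (4 * ?N)) ^ (CARD('n) - 1) / V"])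
    show "(1 / 16) * (1 / (4 * ?N)) ^ (CARD('n) - 1) / V > 0" using V N by simp
    fix \<eta> :: "complex ^ 'n" and t :: real
    assume \<eta>: "norm \<eta> = 1" and t: "0 < t" "t < 1"
    define A where "A = {\<xi> \<in> sphere 0 1. cmod (1 - hprod \<xi> \<eta>) < t}"
    have "A = {\<xi>. cmod (1 - hprod \<xi> \<eta>) < t} \<inter> sphere 0 1" by (auto simp: A_def)
    then have A: "A \<in> sets borel" using open_Collect_hprod[of \<eta> t]
      by (auto intro!: sets.Int borel_open borel_closed)
    obtain j :: 'n where True by simp
    obtain f where f: "bij f" "linear f" "\<And>x. norm (f x) = norm x" "\<And>x. f x $ j = hprod x \<eta>"
      using unitary_to_coordinate[OF \<eta>] by blast
    \<comment> \<open>With this choice each coordinate other than the \<open>j\<close>-th has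
      squared modulus at most 2s^2 = t/(8n), so together they contribute at most t/8 to
      |x|^2.\<close>
    define s where "s = sqrt (t / (16 * ?N))"
    have s: "s \<ge> 0" "s\<^sup>2 = t / (16 * ?N)" using t by (auto simp: s_def)
    define l u :: "complex ^ 'n" where
      "l = (\<chi> i. if i = j then Complex (1/2) (- t / 8) else Complex (- s) (- s))" and
      "u = (\<chi> i. if i = j then Complex (3/4) (t / 8) else Complex s s)"
    have "f -` box l u \<subseteq> ball 0 1 \<inter> sgn -` A"
    proof
      fix x assume "x \<in> f -` box l u"
      then have *: "Re (l $ i) < Re (f x $ i)" "Re (f x $ i) < Re (u $ i)"
        "Im (l $ i) < Im (f x $ i)" "Im (f x $ i) < Im (u $ i)" for i
        by (auto simp: mem_box_complex_vec)
      define h where "h = hprod x \<eta>"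
      define R where "R = norm x"
      have h: "1/2 < Re h" "Re h < 3/4" "\<bar>Im h\<bar> \<le> t / 8"
        using *[of j] by (auto simp: l_def u_def h_def f(4))
      have k: "(cmod (f x $ k))\<^sup>2 \<le> t / (8 * ?N)" if "k \<noteq> j" for k
      proof -
        have "\<bar>Re (f x $ k)\<bar> \<le> s" "\<bar>Im (f x $ k)\<bar> \<le> s"
          using *[of k] that by (auto simp: l_def u_def)
        then have "(Re (f x $ k))\<^sup>2 \<le> s\<^sup>2" "(Im (f x $ k))\<^sup>2 \<le> s\<^sup>2"
          using s by (metis power2_abs power_mono abs_ge_zero)+
        then show ?thesis by (simp add: cmod_power2 s field_simps)
      qed
      have "R\<^sup>2 = (cmod h)\<^sup>2 + (\<Sum>k\<in>UNIV - {j}. (cmod (f x $ k))\<^sup>2)"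
        unfolding R_def f(3)[of x, symmetric] norm_power2_sum h_def f(4)[symmetric]
        by (rule sum.remove) auto
      also have "(\<Sum>k\<in>UNIV - {j}. (cmod (f x $ k))\<^sup>2) \<le> (\<Sum>k\<in>UNIV - {j}. t / (8 * ?N))"
        by (intro sum_mono k) auto
      also have "\<dots> \<le> (\<Sum>k\<in>(UNIV :: 'n set). t / (8 * ?N))"
        using t by (intro sum_mono2) auto
      also have "\<dots> = t / 8" by simp
      finally have R2: "R\<^sup>2 \<le> (Re h)\<^sup>2 + (Im h)\<^sup>2 + t / 8" by (simp add: cmod_power2)
      have Im2: "(Im h)\<^sup>2 \<le> t / 64"
      proof -
        have "(Im h)\<^sup>2 \<le> (t / 8)\<^sup>2" using h by (metis power2_abs power_mono abs_ge_zero)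
        also have "\<dots> \<le> t / 64" using t by (simp add: power2_eq_square)
        finally show ?thesis .
      qed
      have Re2: "(Re h)\<^sup>2 \<le> (3/4)\<^sup>2" using h by (intro power_mono) auto
      have "R\<^sup>2 < 1\<^sup>2" using R2 Im2 Re2 t by (simp add: power2_eq_square)
      then have R1: "R < 1" by (rule power2_less_imp_less) simp
      have "Re h \<le> R"
        using complex_Re_le_cmod[of h] norm_hprod_le[of x \<eta>] \<eta> by (simp add: h_def R_def)
      then have Rh: "R > 1/2" using h by simp
      \<comment> \<open>\<open>R\<close> and \<open>Re h\<close> both exceed 1/2, so their sum is at
        least 1; the difference is thereby controlled by the difference of squares.\<close>
      have "R - Re h \<le> (R - Re h) * (R + Re h)"
        using \<open>Re h \<le> R\<close> Rh h by (simp add: mult_le_cancel_left1)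
      also have "\<dots> = R\<^sup>2 - (Re h)\<^sup>2" by (simp add: power2_eq_square algebra_simps)
      also have "\<dots> \<le> t / 64 + t / 8" using R2 Im2 by simp
      finally have ReR: "R - Re h \<le> t / 64 + t / 8" .
      have "cmod (of_real R - h) \<le> \<bar>R - Re h\<bar> + \<bar>Im h\<bar>"
        using cmod_le[of "of_real R - h"] by simp
      also have "\<dots> < t / 2" using ReR h \<open>Re h \<le> R\<close> t by simp
      also have "\<dots> < t * R" using Rh t by simp
      finally have "cmod (of_real R - h) / R < t" using Rh by (simp add: field_simps)
      moreover have "1 - hprod (sgn x) \<eta> = (of_real R - h) / of_real R"
        using Rh by (auto simp: sgn_div_norm hprod_scaleR_left h_def R_def divide_simps)
      ultimately have "cmod (1 - hprod (sgn x) \<eta>) < t"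
        using Rh by (simp add: norm_divide)
      moreover have "x \<noteq> 0" using Rh by (auto simp: R_def)
      ultimately show "x \<in> ball 0 1 \<inter> sgn -` A"
        using R1 by (simp add: A_def R_def norm_sgn)
    qed
    moreover have "ball 0 1 \<inter> sgn -` A \<in> sets lborel"
    proof -
      have "(sgn :: complex ^ 'n \<Rightarrow> _) \<in> borel_measurable borel" unfolding sgn_div_norm by measurable
      from measurable_sets[OF this A] show ?thesis by auto
    qed
    ultimately have le: "emeasure lborel (f -` box l u) \<le> emeasure lborel (ball 0 1 \<inter> sgn -` A)"
      by (intro emeasure_mono) auto
    have "ennreal ((1 / 16) * (1 / (4 * ?N)) ^ (CARD('n) - 1) * t ^ CARD('n)) =
        ennreal (t / 16 * (t / (4 * ?N)) ^ (CARD('n) - 1))"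
      by (cases "CARD('n)") (auto simp: power_divide)
    also have "\<dots> = ennreal (\<Prod>i\<in>UNIV. if i = j then t / 16 else t / (4 * ?N))"
      by (subst prod_card_except) simp
    also have "\<dots> = emeasure lborel (box l u)"
      using t s by (subst emeasure_box_complex_vec)
        (auto simp: l_def u_def power2_eq_square intro!: arg_cong[where f = ennreal] prod.cong)
    also have "\<dots> = emeasure lborel (f -` box l u)"
      using f by (intro emeasure_vimage_isometry[symmetric]) auto
    also note le
    finally have "ennreal ((1 / 16) * (1 / (4 * ?N)) ^ (CARD('n) - 1) * t ^ CARD('n)) / ennreal V
       \<le> emeasure sphere_measure A"
      using A by (subst emeasure_sphere_measure) (auto simp: A_def V(2) intro!: divide_right_mono_ennreal)
    moreover have "ennreal ((1 / 16) * (1 / (4 * ?N)) ^ (CARD('n) - 1) * t ^ CARD('n)) / ennreal V =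
       ennreal ((1 / 16) * (1 / (4 * ?N)) ^ (CARD('n) - 1) / V * t ^ CARD('n))"
      using V t N by (subst divide_ennreal) (auto simp: field_simps)
    ultimately show "ennreal ((1 / 16) * (1 / (4 * ?N)) ^ (CARD('n) - 1) / V * t ^ CARD('n)) \<le>
        emeasure sphere_measure {\<xi> \<in> sphere 0 1. cmod (1 - hprod \<xi> \<eta>) < t}"
      by (simp only: A_def)
  qed
qed

section \<open>The automorphisms and the Green function\<close>

text \<open>The closed form of |\<phi>_w(z)|^2 for z and w in the ball. All kernel estimates are
  made on this expression, where the projections no longer occur.\<close>

definition aut_norm2 :: "complex ^ 'n \<Rightarrow> complex ^ 'n \<Rightarrow> real" where
  "aut_norm2 z w = 1 - (1 - (norm z)\<^sup>2) * (1 - (norm w)\<^sup>2) / (cmod (1 - hprod z w))\<^sup>2"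

lemma one_minus_le_norm_hprod: "1 - norm z * norm w \<le> cmod (1 - hprod z w)"
  using norm_triangle_ineq2[of 1 "hprod z w"] norm_hprod_le[of z w] by simp

text \<open>The numerator of the automorphism is a combination c w - s z, so its norm depends only
  on |z|, |w| and \<langle>z,w\<rangle>. In the real and imaginary parts of \<alpha> the claim is a
  polynomial identity modulo s^2 = 1 - |w|^2.\<close>

lemma norm_ball_aut_power2:
  fixes z w :: "complex ^ 'n"
  assumes "norm z < 1" "norm w < 1"
  shows "(norm (ball_aut w z))\<^sup>2 = aut_norm2 z w"
proof (cases "w = 0")
  case True
  then show ?thesis by (simp add: ball_aut_def cproj_def aut_norm2_def hprod_def)
next
  case False
  define W where "W = (norm w)\<^sup>2"
  define s where "s = sqrt (1 - W)"
  define \<alpha> where "\<alpha> = hprod z w / of_real W"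
  have W: "0 < W" "W < 1"
    using False assms by (auto simp: W_def power_less_one_iff)
  have s2: "s\<^sup>2 = 1 - W" using W by (simp add: s_def)
  have u: "hprod z w = of_real W * \<alpha>" using W by (simp add: \<alpha>_def)
  define c where "c = 1 - \<alpha> + of_real s * \<alpha>"
  define v where "v = c *s w - of_real s *s z"
  have "norm z * norm w < 1"
    using mult_strict_mono'[OF assms] by simp
  then have D: "cmod (1 - hprod z w) > 0" using one_minus_le_norm_hprod[of z w] by linarith
  have "ball_aut w z = inverse (1 - hprod z w) *s v"
    using False
    by (simp add: ball_aut_def cproj_def v_def c_def \<alpha>_def W_def s_def vec_eq_iff algebra_simps)
  then have "(norm (ball_aut w z))\<^sup>2 * (cmod (1 - hprod z w))\<^sup>2 = (norm v)\<^sup>2"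
    using D by (simp add: norm_mult_vec norm_inverse power_mult_distrib power_inverse)
  also have "(norm v)\<^sup>2 = (cmod c)\<^sup>2 * W - 2 * s * Re (c * cnj (hprod z w)) + s\<^sup>2 * (norm z)\<^sup>2"
    unfolding v_def norm_diff_power2
    by (simp add: norm_mult_vec power_mult_distrib W_def hprod_mult_left hprod_mult_right cnj_hprod
       algebra_simps)
  also have "\<dots> = (cmod (1 - hprod z w))\<^sup>2 - (1 - (norm z)\<^sup>2) * (1 - W)"
  proof -
    obtain a b where ab: "\<alpha> = Complex a b" by (cases \<alpha>)
    have e1: "(cmod c)\<^sup>2 = (1 - a + s * a)\<^sup>2 + (s * b - b)\<^sup>2"
      by (simp add: c_def ab cmod_power2)
    have e2: "Re (c * cnj (hprod z w)) = W * ((1 - a + s * a) * a + (s * b - b) * b)"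
      by (simp add: c_def ab u algebra_simps)
    have e3: "(cmod (1 - hprod z w))\<^sup>2 = (1 - W * a)\<^sup>2 + (W * b)\<^sup>2"
      by (simp add: u ab cmod_power2)
    have "(cmod c)\<^sup>2 * W - 2 * s * Re (c * cnj (hprod z w)) =
        W * (1 - 2 * a + (1 - s\<^sup>2) * (a\<^sup>2 + b\<^sup>2))"
      unfolding e1 e2 by (simp add: power2_eq_square algebra_simps)
    also have "\<dots> = (1 - W * a)\<^sup>2 + (W * b)\<^sup>2 - (1 - W)"
      unfolding s2 by (simp add: power2_eq_square algebra_simps)
    finally show ?thesis unfolding e3 s2 by (simp add: algebra_simps)
  qed
  finally show ?thesis
    using D unfolding aut_norm2_def W_def by (simp add: field_simps)
qed

text \<open>On (0,1] one has t \<le> 1/t^(2n-1), and (1-t^2)^(n-1) t has the antiderivative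
  -(1-t^2)^n/(2n). At t = 0 the smaller integrand vanishes.\<close>

lemma green_radial_ge:
  fixes z :: "complex ^ 'n"
  assumes "norm z \<le> 1"
  shows "ennreal ((real CARD('n) + 1) / (2 * real CARD('n)) * ((1 - (norm z)\<^sup>2) ^ CARD('n) / (2 * real CARD('n))))
    \<le> green_radial z"
proof -
  define m where "m = CARD('n) - 1"
  have m: "CARD('n) = Suc m" by (simp add: m_def)
  define F where "F t = - ((1 - t\<^sup>2) ^ CARD('n) / (2 * real CARD('n)))" for t :: real
  have "ennreal ((1 - (norm z)\<^sup>2) ^ CARD('n) / (2 * real CARD('n))) = ennreal (F 1 - F (norm z))"
    by (simp add: F_def m)
  also have "\<dots> = (\<integral>\<^sup>+ t\<in>{norm z..1}. ennreal ((1 - t\<^sup>2) ^ (CARD('n) - 1) * t) \<partial>lborel)"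
  proof (rule nn_integral_FTC_Icc[symmetric])
    fix t assume "t \<in> {norm z..1}"
    then have t: "0 \<le> t" "t \<le> 1" by (auto intro: order_trans[OF norm_ge_zero])
    show "DERIV F t :> (1 - t\<^sup>2) ^ (CARD('n) - 1) * t"
      unfolding F_def m by (auto intro!: derivative_eq_intros simp del: power_Suc simp: divide_simps)
    show "0 \<le> (1 - t\<^sup>2) ^ (CARD('n) - 1) * t"
      using t by (simp add: power_le_one)
  qed (use assms in auto)
  also have "\<dots> \<le> (\<integral>\<^sup>+ t\<in>{norm z..1}. ennreal ((1 - t\<^sup>2) ^ (CARD('n) - 1) / t ^ (2 * CARD('n) - 1)) \<partial>lborel)"
  proof (intro nn_integral_mono)
    fix t :: real
    show "ennreal ((1 - t\<^sup>2) ^ (CARD('n) - 1) * t) * indicator {norm z..1} t \<le>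
      ennreal ((1 - t\<^sup>2) ^ (CARD('n) - 1) / t ^ (2 * CARD('n) - 1)) * indicator {norm z..1} t"
    proof (cases "t \<in> {norm z..1} \<and> t \<noteq> 0")
      case True
      then have t: "0 < t" "t \<le> 1" using order_trans[OF norm_ge_zero, of z t] by auto
      have "t * t ^ (2 * CARD('n) - 1) \<le> 1 * 1"
        using t by (intro mult_mono power_le_one) auto
      then have "t \<le> 1 / t ^ (2 * CARD('n) - 1)" using t by (simp add: field_simps)
      then have "(1 - t\<^sup>2) ^ (CARD('n) - 1) * t \<le> (1 - t\<^sup>2) ^ (CARD('n) - 1) * (1 / t ^ (2 * CARD('n) - 1))"
        using t by (intro mult_left_mono) (auto simp: power_le_one)
      then show ?thesis using True by (simp add: ennreal_leI)
    qed auto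
  qed
  finally show ?thesis
    unfolding green_radial_def
    by (subst ennreal_mult) (auto intro!: mult_left_mono divide_nonneg_nonneg zero_le_power
       simp: power_le_one assms)
qed

text \<open>Away from the origin the comparison with the same antiderivative can be reversed: t^2
  \<ge> 1/4 gives 1 \<le> (4t^2)^n, that is 1/t^(2n-1) \<le> 4^n t.\<close>

lemma green_radial_le_outer:
  fixes z :: "complex ^ 'n"
  assumes "norm z \<le> 1" "1 / 4 \<le> (norm z)\<^sup>2"
  shows "green_radial z \<le> ennreal ((real CARD('n) + 1) / (2 * real CARD('n)) *
     (4 ^ CARD('n) * (1 - (norm z)\<^sup>2) ^ CARD('n) / (2 * real CARD('n))))"
proof -
  define m where "m = CARD('n) - 1"
  have m: "CARD('n) = Suc m" by (simp add: m_def)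
  define F where "F t = - (4 ^ CARD('n) * (1 - t\<^sup>2) ^ CARD('n) / (2 * real CARD('n)))" for t :: real
  have nz: "norm z > 0" using assms(2) by (cases "norm z = 0") auto
  have "(\<integral>\<^sup>+ t\<in>{norm z..1}. ennreal ((1 - t\<^sup>2) ^ (CARD('n) - 1) / t ^ (2 * CARD('n) - 1)) \<partial>lborel)
     \<le> (\<integral>\<^sup>+ t\<in>{norm z..1}. ennreal (4 ^ CARD('n) * ((1 - t\<^sup>2) ^ (CARD('n) - 1) * t)) \<partial>lborel)"
  proof (intro nn_integral_mono)
    fix t :: real
    show "ennreal ((1 - t\<^sup>2) ^ (CARD('n) - 1) / t ^ (2 * CARD('n) - 1)) * indicator {norm z..1} t \<le>
      ennreal (4 ^ CARD('n) * ((1 - t\<^sup>2) ^ (CARD('n) - 1) * t)) * indicator {norm z..1} t"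
    proof (cases "t \<in> {norm z..1}")
      case True
      then have t: "0 < t" "t \<le> 1" using less_le_trans[OF nz] by auto
      have "(norm z)\<^sup>2 \<le> t\<^sup>2" using True by (intro power_mono) auto
      then have "1 \<le> (4 * t\<^sup>2) ^ CARD('n)" using assms(2) by (intro one_le_power) auto
      also have "\<dots> = 4 ^ CARD('n) * (t * t ^ (2 * CARD('n) - 1))"
        by (simp add: m power_mult_distrib flip: power_mult power_Suc)
      finally have "1 / t ^ (2 * CARD('n) - 1) \<le> 4 ^ CARD('n) * t" using t by (simp add: field_simps)
      then have "(1 - t\<^sup>2) ^ (CARD('n) - 1) * (1 / t ^ (2 * CARD('n) - 1)) \<le> (1 - t\<^sup>2) ^ (CARD('n) - 1) * (4 ^ CARD('n) * t)"
        using t by (intro mult_left_mono) (auto simp: power_le_one)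
      then show ?thesis using True by (simp add: ennreal_leI mult_ac)
    qed auto
  qed
  also have "\<dots> = ennreal (F 1 - F (norm z))"
  proof (rule nn_integral_FTC_Icc)
    fix t assume "t \<in> {norm z..1}"
    then have t: "0 \<le> t" "t \<le> 1" by (auto intro: order_trans[OF norm_ge_zero])
    show "DERIV F t :> 4 ^ CARD('n) * ((1 - t\<^sup>2) ^ (CARD('n) - 1) * t)"
      unfolding F_def m by (auto intro!: derivative_eq_intros simp del: power_Suc simp: divide_simps)
    show "0 \<le> 4 ^ CARD('n) * ((1 - t\<^sup>2) ^ (CARD('n) - 1) * t)"
      using t by (simp add: power_le_one)
  qed (use assms in auto)
  also have "F 1 - F (norm z) = 4 ^ CARD('n) * (1 - (norm z)\<^sup>2) ^ CARD('n) / (2 * real CARD('n))"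
    by (simp add: F_def)
  finally show ?thesis
    unfolding green_radial_def
    by (subst ennreal_mult) (auto intro!: mult_left_mono divide_nonneg_nonneg zero_le_power mult_nonneg_nonneg
       simp: power_le_one assms)
qed

lemma DERIV_inverse_power:
  fixes t :: real
  assumes "t \<noteq> 0"
  shows "DERIV (\<lambda>t. - (inverse t ^ Suc l / real (Suc l))) t :> inverse t ^ Suc (Suc l)"
  using assms by (auto intro!: derivative_eq_intros simp del: power_Suc of_nat_Suc)
    (simp add: power2_eq_square)

text \<open>The factor (1-t^2)^(n-1) is dropped and t^(-(2n-1)) integrated exactly; for n = 1 this
  would give a logarithm. At the origin the right side is infinite, since \<open>inverse 0\<close>
  is \<open>top\<close> in \<open>ennreal\<close>.\<close>

lemma green_radial_le_inner:
  fixes z :: "complex ^ 'n"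
  assumes "norm z \<le> 1" "CARD('n) > 1"
  shows "green_radial z \<le> ennreal ((real CARD('n) + 1) / (2 * real CARD('n))) *
     inverse (ennreal (((norm z)\<^sup>2) ^ (CARD('n) - 1)))"
proof (cases "z = 0")
  case True
  then have *: "inverse (ennreal (((norm z)\<^sup>2) ^ (CARD('n) - 1))) = top"
    using assms(2) by (simp add: zero_power)
  show ?thesis unfolding * by (simp add: ennreal_mult_top)
next
  case False
  then have nz: "norm z > 0" by simp
  define m where "m = CARD('n) - 2"
  have m: "CARD('n) = Suc (Suc m)" using assms(2) by (simp add: m_def)
  define F where "F t = - (inverse t ^ Suc (2 * m + 1) / real (Suc (2 * m + 1)))" for t :: real
  have "(\<integral>\<^sup>+ t\<in>{norm z..1}. ennreal ((1 - t\<^sup>2) ^ (CARD('n) - 1) / t ^ (2 * CARD('n) - 1)) \<partial>lborel)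
     \<le> (\<integral>\<^sup>+ t\<in>{norm z..1}. ennreal (1 / t ^ (2 * CARD('n) - 1)) \<partial>lborel)"
  proof (intro nn_integral_mono)
    fix t :: real
    show "ennreal ((1 - t\<^sup>2) ^ (CARD('n) - 1) / t ^ (2 * CARD('n) - 1)) * indicator {norm z..1} t \<le>
      ennreal (1 / t ^ (2 * CARD('n) - 1)) * indicator {norm z..1} t"
    proof (cases "t \<in> {norm z..1}")
      case True
      then have t: "0 < t" "t \<le> 1" using less_le_trans[OF nz] by auto
      have "(1 - t\<^sup>2) ^ (CARD('n) - 1) \<le> 1" using t by (intro power_le_one) (auto simp: power_le_one)
      then show ?thesis using True t by (simp add: ennreal_leI divide_right_mono)
    qed auto
  qed
  also have "\<dots> = ennreal (F 1 - F (norm z))"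
  proof (rule nn_integral_FTC_Icc)
    fix t assume "t \<in> {norm z..1}"
    then have t: "0 < t" "t \<le> 1" using less_le_trans[OF nz] by auto
    show "DERIV F t :> 1 / t ^ (2 * CARD('n) - 1)"
      using DERIV_inverse_power[of t "2 * m + 1"] t unfolding F_def
      by (simp add: m inverse_eq_divide power_divide)
    show "0 \<le> 1 / t ^ (2 * CARD('n) - 1)" using t by simp
  qed (use assms in auto)
  also have "F 1 - F (norm z) \<le> inverse (norm z) ^ Suc (2 * m + 1) / real (Suc (2 * m + 1))"
    by (simp add: F_def)
  also have "\<dots> \<le> inverse (norm z) ^ Suc (2 * m + 1) / 1"
    using nz by (intro divide_left_mono) auto
  also have "Suc (2 * m + 1) = 2 * (CARD('n) - 1)" by (simp add: m)
  also have "inverse (norm z) ^ (2 * (CARD('n) - 1)) / 1 = inverse (((norm z)\<^sup>2) ^ (CARD('n) - 1))"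
    by (simp add: power_mult power_inverse)
  also have "ennreal \<dots> = inverse (ennreal (((norm z)\<^sup>2) ^ (CARD('n) - 1)))"
    using nz by (intro inverse_ennreal[symmetric]) simp
  finally show ?thesis
    unfolding green_radial_def by (intro mult_left_mono) (auto simp: ennreal_leI)
qed

section \<open>Radial comparisons and the quasi-triangle inequality for |1 -
  \<langle>a,b\<rangle>|\<close>

lemma norm_one_minus_le_scaled:
  fixes u :: complex
  assumes "cmod u \<le> 1" "0 \<le> r" "r \<le> 1"
  shows "cmod (1 - u) \<le> 2 * cmod (1 - of_real r * u)"
proof -
  have "cmod (1 - u) = cmod ((1 - of_real r * u) - of_real (1 - r) * u)"
    by (simp add: algebra_simps)
  also have "\<dots> \<le> cmod (1 - of_real r * u) + (1 - r) * cmod u"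
    using norm_triangle_ineq4[of "1 - of_real r * u" "of_real (1 - r) * u"] assms
    by (simp only: norm_mult norm_of_real)
  also have "(1 - r) * cmod u \<le> 1 - r * cmod u"
    using assms by (simp add: algebra_simps)
  also have "\<dots> \<le> cmod (1 - of_real r * u)"
    using norm_triangle_ineq2[of 1 "of_real r * u"] assms by (simp add: norm_mult)
  finally show ?thesis by simp
qed

lemma norm_one_minus_scaled_le:
  fixes u :: complex
  assumes "cmod u \<le> 1" "0 \<le> r" "r \<le> 1"
  shows "cmod (1 - of_real r * u) \<le> cmod (1 - u) + (1 - r)"
proof -
  have "cmod (1 - of_real r * u) = cmod ((1 - u) + of_real (1 - r) * u)"
    by (simp add: algebra_simps)
  also have "\<dots> \<le> cmod (1 - u) + (1 - r) * cmod u"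
    using norm_triangle_ineq[of "1 - u" "of_real (1 - r) * u"] assms
    by (simp only: norm_mult norm_of_real)
  also have "(1 - r) * cmod u \<le> (1 - r) * 1" using assms by (intro mult_left_mono) auto
  finally show ?thesis by simp
qed

text \<open>Splitting a and b along the unit vector c gives 1 - \<langle>a,b\<rangle> = (1 - s) +
  s(1 - cnj t) - \<langle>a',b'\<rangle>. The orthogonal parts satisfy |a'|^2 \<le> 1 - |s|^2 \<le>
  2|1 - s| and likewise for b', so the arithmetic-geometric mean inequality bounds the last term by
  the other two.\<close>

lemma quasi_triangle:
  fixes a b c :: "complex ^ 'n"
  assumes "norm a \<le> 1" "norm b \<le> 1" "norm c = 1"
  shows "cmod (1 - hprod a b) \<le> 2 * (cmod (1 - hprod a c) + cmod (1 - hprod c b))"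
proof -
  define s where "s = hprod a c"
  define t where "t = hprod b c"
  define a' where "a' = a - s *s c"
  define b' where "b' = b - t *s c"
  have cc: "hprod c c = 1" using assms(3) by (simp add: hprod_self)
  have ort: "(norm (x - hprod x c *s c))\<^sup>2 \<le> 2 * cmod (1 - hprod x c)" if "norm x \<le> 1" for x
  proof -
    have "(norm (x - hprod x c *s c))\<^sup>2 = (norm x)\<^sup>2 - (cmod (hprod x c))\<^sup>2"
    proof -
      have "Re (cnj (hprod x c) * hprod x c) = (cmod (hprod x c))\<^sup>2"
        unfolding cmod_power2 by (simp add: power2_eq_square)
      then show ?thesis
        unfolding norm_diff_power2 by (simp add: hprod_mult_right norm_mult_vec assms(3))
    qed
    also have "\<dots> \<le> 1 - (cmod (hprod x c))\<^sup>2" using that by (simp add: power_le_one)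
    also have "\<dots> = (1 - cmod (hprod x c)) * (1 + cmod (hprod x c))"
      by (simp add: power2_eq_square algebra_simps)
    also have "\<dots> \<le> cmod (1 - hprod x c) * 2"
    proof (intro mult_mono)
      show "1 - cmod (hprod x c) \<le> cmod (1 - hprod x c)"
        using norm_triangle_ineq2[of 1 "hprod x c"] by simp
      show "1 + cmod (hprod x c) \<le> 2"
        using norm_hprod_le[of x c] that assms(3) by simp
    qed auto
    finally show ?thesis by (simp add: mult.commute)
  qed
  have y: "cmod (1 - t) = cmod (1 - hprod c b)" unfolding t_def by (rule norm_hprod_commute)
  have s1: "cmod s \<le> 1"
    using norm_hprod_le[of a c] assms by (simp add: s_def)
  have "hprod a' b' = hprod a b - s * cnj t"
    unfolding a'_def b'_def
    by (simp add: hprod_diff_left hprod_diff_right hprod_mult_left hprod_mult_right cc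
        flip: s_def) (simp add: t_def cnj_hprod algebra_simps)
  then have "1 - hprod a b = (1 - s) + s * (1 - cnj t) - hprod a' b'"
    by (simp add: algebra_simps)
  also have "cmod \<dots> \<le> cmod (1 - s) + cmod s * cmod (1 - cnj t) + cmod (hprod a' b')"
    using norm_triangle_ineq4[of "(1 - s) + s * (1 - cnj t)" "hprod a' b'"]
      norm_triangle_ineq[of "1 - s" "s * (1 - cnj t)"] by (simp only: norm_mult)
  also have "cmod (1 - cnj t) = cmod (1 - t)"
    using complex_mod_cnj[of "1 - t"] by simp
  also have "cmod s * cmod (1 - t) \<le> 1 * cmod (1 - t)" using s1 by (intro mult_right_mono) auto
  also have "cmod (hprod a' b') \<le> norm a' * norm b'" by (rule norm_hprod_le)
  also have "norm a' * norm b' \<le> ((norm a')\<^sup>2 + (norm b')\<^sup>2) / 2"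
    using sum_squares_bound[of "norm a'" "norm b'"] by simp
  also have "(norm a')\<^sup>2 \<le> 2 * cmod (1 - s)" unfolding a'_def s_def by (intro ort assms)
  also have "(norm b')\<^sup>2 \<le> 2 * cmod (1 - t)" unfolding b'_def t_def by (intro ort assms)
  finally show ?thesis by (simp add: s_def y add_divide_distrib)
qed

lemma koranyi_region_iff: "w \<in> koranyi_region \<xi> d \<longleftrightarrow> norm w < 1 \<and> cmod (1 - hprod w \<xi>) < d"
  by (simp add: koranyi_region_def koranyi_dist_def)

section \<open>Kernel estimates\<close>

lemma aut_norm2_bounds:
  assumes "norm z < 1" "norm w < 1"
  shows "0 \<le> aut_norm2 z w" "aut_norm2 z w < 1"
proof -
  show "0 \<le> aut_norm2 z w"
    using zero_le_power2 unfolding norm_ball_aut_power2[OF assms, symmetric] .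
  have "norm z * norm w < 1"
    using mult_strict_mono'[OF assms] by simp
  then have "cmod (1 - hprod z w) > 0" using one_minus_le_norm_hprod[of z w] by linarith
  moreover have "(norm z)\<^sup>2 < 1" "(norm w)\<^sup>2 < 1" using assms by (simp_all add: power_less_one_iff)
  ultimately show "aut_norm2 z w < 1" by (simp add: aut_norm2_def)
qed

text \<open>The singular part |\<phi>_w(z)|^(-(2n-2)), cut off at |\<phi>_w(z)| < 1/2. As
  \<open>aut_norm2\<close> is a square, the exponent is n-1 and the threshold 1/4. The inverse is
  taken in \<open>ennreal\<close>, so that the kernel is infinite where \<open>aut_norm2\<close>
  vanishes.\<close>

definition local_kernel :: "complex ^ 'n \<Rightarrow> complex ^ 'n \<Rightarrow> ennreal" where
  "local_kernel z w = (if aut_norm2 z w < 1 / 4 then inverse (ennreal (aut_norm2 z w ^ (CARD('n) - 1))) else 0)"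

lemma green_ge:
  fixes z w :: "complex ^ 'n"
  assumes "norm z < 1" "norm w < 1"
  shows "ennreal ((real CARD('n) + 1) / (2 * real CARD('n)) * ((1 - aut_norm2 z w) ^ CARD('n) / (2 * real CARD('n))))
    \<le> green z w"
proof -
  have "(norm (ball_aut w z))\<^sup>2 \<le> 1"
    using aut_norm2_bounds[OF assms] by (simp add: norm_ball_aut_power2[OF assms])
  then have "norm (ball_aut w z) \<le> 1" by (simp add: power_le_one_iff)
  from green_radial_ge[OF this] show ?thesis
    unfolding norm_ball_aut_power2[OF assms] green_def .
qed

lemma green_le:
  fixes z w :: "complex ^ 'n"
  assumes "norm z < 1" "norm w < 1" and n: "CARD('n) > 1"
  shows "green z w \<le> ennreal ((real CARD('n) + 1) / (2 * real CARD('n)) * 4 ^ CARD('n)) *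
    (ennreal ((1 - aut_norm2 z w) ^ CARD('n)) + local_kernel z w)"
proof -
  let ?q = "aut_norm2 z w" and ?c = "(real CARD('n) + 1) / (2 * real CARD('n))"
  have q: "0 \<le> ?q" "?q < 1" by (rule aut_norm2_bounds[OF assms(1,2)])+
  have "(norm (ball_aut w z))\<^sup>2 \<le> 1"
    using q by (simp add: norm_ball_aut_power2[OF assms(1,2)])
  then have le1: "norm (ball_aut w z) \<le> 1" by (simp add: power_le_one_iff)
  have c: "?c \<ge> 0" by simp
  show ?thesis
  proof (cases "?q < 1 / 4")
    case True
    have "green z w \<le> ennreal ?c * inverse (ennreal (?q ^ (CARD('n) - 1)))"
      using green_radial_le_inner[OF le1 n] by (simp add: green_def norm_ball_aut_power2[OF assms(1,2)])
    also have "\<dots> = ennreal ?c * local_kernel z w" using True by (simp add: local_kernel_def)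
    also have "\<dots> \<le> ennreal (?c * 4 ^ CARD('n)) * (ennreal ((1 - ?q) ^ CARD('n)) + local_kernel z w)"
    proof (rule mult_mono)
      have "?c * 1 \<le> ?c * 4 ^ CARD('n)" using c by (intro mult_left_mono) auto
      then show "ennreal ?c \<le> ennreal (?c * 4 ^ CARD('n))" by (intro ennreal_leI) simp
    qed (auto intro: add_increasing)
    finally show ?thesis .
  next
    case False
    then have "1 / 4 \<le> (norm (ball_aut w z))\<^sup>2" by (simp add: norm_ball_aut_power2[OF assms(1,2)])
    from green_radial_le_outer[OF le1 this]
    have "green z w \<le> ennreal (?c * (4 ^ CARD('n) * (1 - ?q) ^ CARD('n) / (2 * real CARD('n))))"
      by (simp add: green_def norm_ball_aut_power2[OF assms(1,2)])
    also have "\<dots> \<le> ennreal (?c * (4 ^ CARD('n) * (1 - ?q) ^ CARD('n) / 1))"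
    proof (intro ennreal_leI mult_left_mono divide_left_mono)
      show "1 \<le> 2 * real CARD('n)" using n by simp
    qed (use c q in auto)
    also have "\<dots> = ennreal (?c * 4 ^ CARD('n)) * ennreal ((1 - ?q) ^ CARD('n))"
      using c q by (simp add: mult.assoc flip: ennreal_mult)
    also have "\<dots> \<le> ennreal (?c * 4 ^ CARD('n)) * (ennreal ((1 - ?q) ^ CARD('n)) + local_kernel z w)"
      by (intro mult_left_mono add_increasing2) auto
    finally show ?thesis .
  qed
qed

lemma norm_hprod_unit_le: "norm \<xi> = 1 \<Longrightarrow> norm w \<le> 1 \<Longrightarrow> cmod (hprod \<xi> w) \<le> 1"
  using norm_hprod_le[of \<xi> w] by simp

text \<open>In the formula for 1 - |\<phi>_w|^2 the numerator is at least \<delta>(1 - |w|), while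
  the denominator is at most (2\<delta>)^2 on the region.\<close>

lemma one_minus_aut_norm2_ge:
  assumes \<xi>: "norm \<xi> = 1" and \<delta>: "0 < \<delta>" "\<delta> < 1" and w: "w \<in> koranyi_region \<xi> \<delta>"
  shows "(1 - norm w) / (4 * \<delta>) \<le> 1 - aut_norm2 ((1 - \<delta>) *\<^sub>R \<xi>) w"
proof -
  define D where "D = cmod (1 - hprod ((1 - \<delta>) *\<^sub>R \<xi>) w)"
  have w1: "norm w < 1" "cmod (1 - hprod w \<xi>) < \<delta>" using w by (auto simp: koranyi_region_iff)
  have "D \<le> cmod (1 - hprod \<xi> w) + (1 - (1 - \<delta>))"
    unfolding D_def hprod_scaleR_left using \<delta> norm_hprod_unit_le[OF \<xi>, of w] w1
    by (intro norm_one_minus_scaled_le) auto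
  then have D: "D \<le> 2 * \<delta>" using w1 by (simp add: norm_hprod_commute[of \<xi> w])
  have "1 - norm ((1 - \<delta>) *\<^sub>R \<xi>) * norm w \<le> D"
    unfolding D_def by (rule one_minus_le_norm_hprod)
  moreover have "norm ((1 - \<delta>) *\<^sub>R \<xi>) * norm w < 1 * 1"
    using \<delta> \<xi> w1 by (intro mult_strict_mono') auto
  ultimately have D0: "D > 0" by simp
  have "(norm w)\<^sup>2 \<le> norm w" using w1 by (simp add: power2_eq_square mult_left_le)
  then have "\<delta> * (1 - norm w) \<le> (1 - (1 - \<delta>)\<^sup>2) * (1 - (norm w)\<^sup>2)"
    using \<delta> w1 by (intro mult_mono) (auto simp: power2_eq_square algebra_simps mult_left_le)
  moreover have "D\<^sup>2 \<le> (2 * \<delta>)\<^sup>2" using D D0 by (intro power_mono) auto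
  ultimately have "\<delta> * (1 - norm w) / (2 * \<delta>)\<^sup>2 \<le> (1 - (1 - \<delta>)\<^sup>2) * (1 - (norm w)\<^sup>2) / D\<^sup>2"
    using \<delta> w1 D0 by (intro frac_le) (auto simp: power_le_one)
  then show ?thesis
    using \<delta> \<xi> by (simp add: aut_norm2_def D_def power2_eq_square)
qed

lemma aut_norm2_eq:
  assumes "norm \<xi> = 1" "0 < \<delta>" "\<delta> < 1"
  shows "aut_norm2 ((1 - \<delta>) *\<^sub>R \<xi>) w =
    1 - (1 - (1 - \<delta>)\<^sup>2) * (1 - (norm w)\<^sup>2) / (cmod (1 - hprod ((1 - \<delta>) *\<^sub>R \<xi>) w))\<^sup>2"
  using assms by (simp add: aut_norm2_def)

lemma dist_lower_bounds:
  assumes \<xi>: "norm \<xi> = 1" and \<delta>: "0 < \<delta>" "\<delta> < 1" and w: "norm w < 1"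
  shows "\<delta> \<le> cmod (1 - hprod ((1 - \<delta>) *\<^sub>R \<xi>) w)"
    "1 - norm w \<le> cmod (1 - hprod ((1 - \<delta>) *\<^sub>R \<xi>) w)"
    "cmod (1 - hprod w \<xi>) \<le> 2 * cmod (1 - hprod ((1 - \<delta>) *\<^sub>R \<xi>) w)"
proof -
  have "1 - (1 - \<delta>) * norm w \<le> cmod (1 - hprod ((1 - \<delta>) *\<^sub>R \<xi>) w)"
    using one_minus_le_norm_hprod[of "(1 - \<delta>) *\<^sub>R \<xi>" w] \<delta> \<xi> by simp
  moreover have "(1 - \<delta>) * norm w \<le> 1 - \<delta>" "(1 - \<delta>) * norm w \<le> norm w"
    using \<delta> w by (auto simp: mult_left_le mult_left_le_one_le)
  ultimately show "\<delta> \<le> cmod (1 - hprod ((1 - \<delta>) *\<^sub>R \<xi>) w)"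
    "1 - norm w \<le> cmod (1 - hprod ((1 - \<delta>) *\<^sub>R \<xi>) w)" by linarith+
  show "cmod (1 - hprod w \<xi>) \<le> 2 * cmod (1 - hprod ((1 - \<delta>) *\<^sub>R \<xi>) w)"
    unfolding norm_hprod_commute[of w] hprod_scaleR_left using \<delta> norm_hprod_unit_le[OF \<xi>, of w] w
    by (intro norm_one_minus_le_scaled) auto
qed

lemma weights_le:
  assumes \<delta>: "0 < \<delta>" "\<delta> < 1" and w: "norm w < 1"
  shows "(1 - (1 - \<delta>)\<^sup>2) * (1 - (norm w)\<^sup>2) \<le> 4 * \<delta> * (1 - norm w)"
proof -
  have "(1 - (1 - \<delta>)\<^sup>2) * (1 - (norm w)\<^sup>2) \<le> (2 * \<delta>) * (2 * (1 - norm w))"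
  proof (intro mult_mono)
    have "0 \<le> (1 - norm w)\<^sup>2" by simp
    then show "1 - (norm w)\<^sup>2 \<le> 2 * (1 - norm w)" by (simp add: power2_eq_square algebra_simps)
    show "1 - (1 - \<delta>)\<^sup>2 \<le> 2 * \<delta>" by (simp add: power2_eq_square algebra_simps)
    show "0 \<le> 1 - (norm w)\<^sup>2" using w by (simp add: power_le_one)
  qed (use \<delta> in auto)
  then show ?thesis by (simp add: algebra_simps)
qed

lemma le_suminf_ennreal: "f k \<le> (\<Sum>i. f i :: ennreal)"
  using sum_le_suminf[of f "{k}"] by simp

text \<open>One term of the sum already suffices, the one for the least k with w in C(\<xi>,2^k
  \<delta>). The whole series is kept because that k depends on w, whereas the right side has to be
  integrated in w.\<close>

lemma one_minus_aut_norm2_le_dyadic: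
  fixes w :: "complex ^ 'n"
  assumes \<xi>: "norm \<xi> = 1" and \<delta>: "0 < \<delta>" "\<delta> < 1" and w: "norm w < 1"
  shows "ennreal ((1 - aut_norm2 ((1 - \<delta>) *\<^sub>R \<xi>) w) ^ CARD('n)) \<le>
    ennreal ((1 - norm w) ^ CARD('n)) * (ennreal ((64 / \<delta>) ^ CARD('n)) *
     (\<Sum>k. ennreal ((1 / 4 ^ CARD('n)) ^ k) * indicator (koranyi_region \<xi> (2 ^ k * \<delta>)) w))"
proof -
  define D where "D = cmod (1 - hprod ((1 - \<delta>) *\<^sub>R \<xi>) w)"
  define q where "q = aut_norm2 ((1 - \<delta>) *\<^sub>R \<xi>) w"
  have D: "\<delta> \<le> D" "cmod (1 - hprod w \<xi>) \<le> 2 * D"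
    unfolding D_def using dist_lower_bounds[OF assms] by auto
  have ex: "\<exists>k. cmod (1 - hprod w \<xi>) < 2 ^ k * \<delta>"
    using real_arch_pow[of 2 "cmod (1 - hprod w \<xi>) / \<delta>"] \<delta> by (auto simp: field_simps)
  define k where "k = (LEAST k. cmod (1 - hprod w \<xi>) < 2 ^ k * \<delta>)"
  have k: "cmod (1 - hprod w \<xi>) < 2 ^ k * \<delta>" unfolding k_def by (rule LeastI_ex[OF ex])
  \<comment> \<open>For k = 0 this is D \<ge> \<delta>. Otherwise minimality of k excludes w from
    the previous region, and |1 - \<langle>w,\<xi>\<rangle>| is at most 2D. Squaring the 1/4 and
    using the factor 4 of \<open>weights_le\<close> produces 64.\<close>
  have Dk: "2 ^ k * \<delta> / 4 \<le> D"
  proof (cases k)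
    case 0
    then show ?thesis using D \<delta> by simp
  next
    case (Suc l)
    have "\<not> cmod (1 - hprod w \<xi>) < 2 ^ l * \<delta>"
      using Suc not_less_Least[of l "\<lambda>k. cmod (1 - hprod w \<xi>) < 2 ^ k * \<delta>"] by (simp add: k_def)
    then have "2 ^ l * \<delta> \<le> 2 * D" using D by linarith
    then show ?thesis using Suc by (simp add: mult.commute)
  qed
  have q1: "q < 1" unfolding q_def using \<delta> \<xi> w by (intro aut_norm2_bounds) auto
  have "1 - q = (1 - (1 - \<delta>)\<^sup>2) * (1 - (norm w)\<^sup>2) / D\<^sup>2"
    unfolding q_def D_def aut_norm2_eq[OF \<xi> \<delta>] by simp
  also have "\<dots> \<le> 4 * \<delta> * (1 - norm w) / D\<^sup>2"
    by (intro divide_right_mono weights_le \<delta> w) simp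
  also have "\<dots> \<le> 4 * \<delta> * (1 - norm w) / (2 ^ k * \<delta> / 4)\<^sup>2"
    using \<delta> w Dk D by (intro divide_left_mono power_mono mult_pos_pos zero_less_power) auto
  also have "\<dots> = (1 - norm w) * (64 / \<delta>) * (1 / 4) ^ k"
    using \<delta> by (simp add: power2_eq_square power_divide field_simps flip: power_mult_distrib)
  finally have "(1 - q) ^ CARD('n) \<le> ((1 - norm w) * (64 / \<delta>) * (1 / 4) ^ k) ^ CARD('n)"
    using q1 by (intro power_mono) auto
  also have "\<dots> = (1 - norm w) ^ CARD('n) * ((64 / \<delta>) ^ CARD('n) * (1 / 4 ^ CARD('n)) ^ k)"
  proof -
    have "((1 / 4 :: real) ^ k) ^ CARD('n) = (1 / 4 ^ CARD('n)) ^ k"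
      by (simp add: power_divide mult.commute flip: power_mult)
    then show ?thesis by (simp only: power_mult_distrib mult.assoc)
  qed
  finally have "ennreal ((1 - q) ^ CARD('n)) \<le>
     ennreal ((1 - norm w) ^ CARD('n) * ((64 / \<delta>) ^ CARD('n) * (1 / 4 ^ CARD('n)) ^ k))"
    by (rule ennreal_leI)
  also have "\<dots> = ennreal ((1 - norm w) ^ CARD('n)) * (ennreal ((64 / \<delta>) ^ CARD('n)) *
     (ennreal ((1 / 4 ^ CARD('n)) ^ k) * indicator (koranyi_region \<xi> (2 ^ k * \<delta>)) w))"
    using \<delta> w k by (simp add: koranyi_region_iff ennreal_mult)
  also have "\<dots> \<le> ennreal ((1 - norm w) ^ CARD('n)) * (ennreal ((64 / \<delta>) ^ CARD('n)) *
     (\<Sum>k. ennreal ((1 / 4 ^ CARD('n)) ^ k) * indicator (koranyi_region \<xi> (2 ^ k * \<delta>)) w))"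
    by (intro mult_left_mono le_suminf_ennreal) auto
  finally show ?thesis unfolding q_def .
qed

text \<open>The assumption says 3/4 D^2 < N \<le> 4\<delta>(1 - |w|). Together with D \<ge> 1 - |w|
  it bounds D by 16/3 \<delta>, and together with D \<ge> \<delta> it bounds 1 - |w| from below:
  close to the singularity D, \<delta> and 1 - |w| are all comparable. The radius 12\<delta> comes
  from |1 - \<langle>w,\<xi>\<rangle>| \<le> 2D and D < 6\<delta>.\<close>

lemma near_estimates:
  assumes \<xi>: "norm \<xi> = 1" and \<delta>: "0 < \<delta>" "\<delta> < 1" and w: "norm w < 1"
    and q: "aut_norm2 ((1 - \<delta>) *\<^sub>R \<xi>) w < 1 / 4"
  shows "cmod (1 - hprod ((1 - \<delta>) *\<^sub>R \<xi>) w) < 6 * \<delta>"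
    "3 * \<delta> / 16 < 1 - norm w" "1 - norm w < 6 * \<delta>"
    "(cmod (1 - hprod ((1 - \<delta>) *\<^sub>R \<xi>) w))\<^sup>2 \<le> 4 / 3 * ((1 - (1 - \<delta>)\<^sup>2) * (1 - (norm w)\<^sup>2))"
    "w \<in> koranyi_region \<xi> (12 * \<delta>)"
proof -
  define D where "D = cmod (1 - hprod ((1 - \<delta>) *\<^sub>R \<xi>) w)"
  define N where "N = (1 - (1 - \<delta>)\<^sup>2) * (1 - (norm w)\<^sup>2)"
  have D: "\<delta> \<le> D" "1 - norm w \<le> D" "cmod (1 - hprod w \<xi>) \<le> 2 * D"
    unfolding D_def using dist_lower_bounds[OF assms(1-4)] by auto
  have D0: "D > 0" using D \<delta> by simp
  have "3 / 4 < N / D\<^sup>2" using q unfolding aut_norm2_eq[OF \<xi> \<delta>] D_def N_def by simp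
  then have DN: "3 / 4 * D\<^sup>2 < N" using D0 by (simp add: field_simps)
  have N: "N \<le> 4 * \<delta> * (1 - norm w)" unfolding N_def by (intro weights_le \<delta> w)
  have "D * (1 - norm w) \<le> D\<^sup>2" using D D0 by (simp add: power2_eq_square)
  then have "D * (1 - norm w) < (16 / 3 * \<delta>) * (1 - norm w)" using DN N by simp
  then have D1: "D < 16 / 3 * \<delta>" using w by (simp add: mult_less_cancel_right)
  have "\<delta> * \<delta> \<le> D\<^sup>2" unfolding power2_eq_square using D \<delta> by (intro mult_mono) auto
  then have "\<delta> * (3 * \<delta> / 16) < \<delta> * (1 - norm w)" using DN N by (simp add: algebra_simps)
  then have w1: "3 * \<delta> / 16 < 1 - norm w" using \<delta> by (simp add: mult_less_cancel_left)
  show "D < 6 * \<delta>" "3 * \<delta> / 16 < 1 - norm w" "1 - norm w < 6 * \<delta>"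
    "w \<in> koranyi_region \<xi> (12 * \<delta>)"
    using D D1 w1 \<delta> w by (auto simp: koranyi_region_iff)
  show "D\<^sup>2 \<le> 4 / 3 * N" using DN by simp
qed

text \<open>Where the kernel does not vanish, 1 - |w| exceeds 3\<delta>/16, so the inserted factor
  ((1 - |w|) 64/\<delta>)^n is at least 1. It supplies the density of \<lambda> and the same
  prefactor as in the dyadic part.\<close>

lemma local_kernel_le_weight:
  fixes w :: "complex ^ 'n"
  assumes \<xi>: "norm \<xi> = 1" and \<delta>: "0 < \<delta>" "\<delta> < 1" and w: "norm w < 1"
  shows "local_kernel ((1 - \<delta>) *\<^sub>R \<xi>) w \<le>
    ennreal ((1 - norm w) ^ CARD('n)) * (ennreal ((64 / \<delta>) ^ CARD('n)) * local_kernel ((1 - \<delta>) *\<^sub>R \<xi>) w)"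
proof (cases "aut_norm2 ((1 - \<delta>) *\<^sub>R \<xi>) w < 1 / 4")
  case True
  have "3 * \<delta> / 16 < 1 - norm w" by (rule near_estimates[OF assms True])
  then have "1 \<le> (1 - norm w) * (64 / \<delta>)" using \<delta> by (simp add: field_simps)
  then have "1 \<le> ((1 - norm w) * (64 / \<delta>)) ^ CARD('n)" by (rule one_le_power)
  then have "1 \<le> (1 - norm w) ^ CARD('n) * (64 / \<delta>) ^ CARD('n)" by (simp only: power_mult_distrib)
  then have "ennreal 1 \<le> ennreal ((1 - norm w) ^ CARD('n) * (64 / \<delta>) ^ CARD('n))" by (rule ennreal_leI)
  also have "\<dots> = ennreal ((1 - norm w) ^ CARD('n)) * ennreal ((64 / \<delta>) ^ CARD('n))"
    using \<delta> w by (intro ennreal_mult) auto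
  finally have "1 \<le> ennreal ((1 - norm w) ^ CARD('n)) * ennreal ((64 / \<delta>) ^ CARD('n))" by simp
  then have "1 * local_kernel ((1 - \<delta>) *\<^sub>R \<xi>) w \<le>
     (ennreal ((1 - norm w) ^ CARD('n)) * ennreal ((64 / \<delta>) ^ CARD('n))) * local_kernel ((1 - \<delta>) *\<^sub>R \<xi>) w"
    by (intro mult_right_mono) auto
  then show ?thesis by (simp add: mult.assoc)
qed (simp add: local_kernel_def)

lemma green_le_weighted:
  fixes w :: "complex ^ 'n"
  assumes \<xi>: "norm \<xi> = 1" and \<delta>: "0 < \<delta>" "\<delta> < 1" and w: "norm w < 1" and n: "CARD('n) > 1"
  shows "green ((1 - \<delta>) *\<^sub>R \<xi>) w \<le> ennreal ((1 - norm w) ^ CARD('n)) *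
    (ennreal ((real CARD('n) + 1) / (2 * real CARD('n)) * 4 ^ CARD('n) * (64 / \<delta>) ^ CARD('n)) *
      ((\<Sum>k. ennreal ((1 / 4 ^ CARD('n)) ^ k) * indicator (koranyi_region \<xi> (2 ^ k * \<delta>)) w)
       + local_kernel ((1 - \<delta>) *\<^sub>R \<xi>) w))" (is "_ \<le> ?W * (ennreal (?c * ?d) * (?S + ?L))")
proof -
  have "norm ((1 - \<delta>) *\<^sub>R \<xi>) < 1" using \<xi> \<delta> by simp
  then have "green ((1 - \<delta>) *\<^sub>R \<xi>) w \<le> ennreal ?c *
    (ennreal ((1 - aut_norm2 ((1 - \<delta>) *\<^sub>R \<xi>) w) ^ CARD('n)) + ?L)"
    by (intro green_le w n)
  also have "\<dots> \<le> ennreal ?c * (?W * (ennreal ?d * ?S) + ?W * (ennreal ?d * ?L))"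
    by (intro mult_left_mono add_mono one_minus_aut_norm2_le_dyadic local_kernel_le_weight assms) auto
  also have "\<dots> = ?W * (ennreal (?c * ?d) * (?S + ?L))"
  proof -
    have cd: "ennreal (?c * ?d) = ennreal ?c * ennreal ?d" using \<delta> by (intro ennreal_mult) auto
    show ?thesis unfolding cd by (simp only: distrib_left mult_ac)
  qed
  finally show ?thesis .
qed

text \<open>With t = |w| and \<zeta> = \<langle>\<xi>,w/|w|\<rangle>, the quantity D^2 -
  (1-r^2)(1-t^2) is a sum of three nonnegative terms, and the assumption makes it less than s^2 D^2.
  The term with Im \<zeta> and the term with 1 - |\<zeta>|^2 give the two bounds. The remaining one
  measures the radial deviation, which does not restrict \<xi> further.\<close>

lemma slab_estimates:
  fixes w :: "complex ^ 'n"
  assumes \<xi>: "norm \<xi> = 1" and \<delta>: "0 < \<delta>" "\<delta> < 1 / 10" and w: "norm w < 1" "w \<noteq> 0"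
    and s: "0 < s" "s \<le> 1 / 2" and q: "aut_norm2 ((1 - \<delta>) *\<^sub>R \<xi>) w < s\<^sup>2"
  shows "\<bar>Im (hprod \<xi> (sgn w))\<bar> \<le> 12 * s * \<delta>"
    "1 - (cmod (hprod \<xi> (sgn w)))\<^sup>2 \<le> 11 * s\<^sup>2 * \<delta>"
proof -
  define D where "D = cmod (1 - hprod ((1 - \<delta>) *\<^sub>R \<xi>) w)"
  define \<zeta> where "\<zeta> = hprod \<xi> (sgn w)"
  define t where "t = norm w"
  define r where "r = 1 - \<delta>"
  have t: "0 < t" "t < 1" using w by (auto simp: t_def)
  have t2: "t\<^sup>2 < 1" using t by (simp add: power_less_one_iff)
  have r: "9 / 10 < r" "r < 1" using \<delta> by (auto simp: r_def)
  have "s\<^sup>2 \<le> (1 / 2)\<^sup>2" using s by (intro power_mono) auto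
  then have "aut_norm2 ((1 - \<delta>) *\<^sub>R \<xi>) w < 1 / 4" using q by (simp add: power2_eq_square)
  note near = near_estimates[OF \<xi> _ _ w(1) this]
  have D6: "D < 6 * \<delta>" unfolding D_def using \<delta> by (intro near) auto
  have D43: "D\<^sup>2 \<le> 4 / 3 * ((1 - r\<^sup>2) * (1 - t\<^sup>2))" unfolding D_def r_def t_def using \<delta> by (intro near) auto
  have D0: "D > 0" 
    using dist_lower_bounds(1)[OF \<xi> _ _ w(1), of \<delta>] \<delta> unfolding D_def by linarith
  have "hprod ((1 - \<delta>) *\<^sub>R \<xi>) w = of_real (r * t) * \<zeta>"
    using t by (simp add: hprod_scaleR_left hprod_scaleR_right sgn_div_norm r_def t_def \<zeta>_def)
  then have Deq: "D\<^sup>2 = (cmod (1 - of_real (r * t) * \<zeta>))\<^sup>2" by (simp add: D_def)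
  have \<zeta>: "cmod \<zeta> \<le> 1" unfolding \<zeta>_def using \<xi> by (intro norm_hprod_unit_le) (simp_all add: norm_sgn)
  have "1 - (1 - r\<^sup>2) * (1 - t\<^sup>2) / D\<^sup>2 < s\<^sup>2"
    using q \<delta> unfolding D_def r_def t_def by (subst (asm) aut_norm2_eq[OF \<xi>]) auto
  then have "D\<^sup>2 - (1 - r\<^sup>2) * (1 - t\<^sup>2) < s\<^sup>2 * D\<^sup>2" using D0 by (simp add: field_simps)
  moreover have "D\<^sup>2 - (1 - r\<^sup>2) * (1 - t\<^sup>2) =
     (t - r * Re \<zeta>)\<^sup>2 + (r * Im \<zeta>)\<^sup>2 + r\<^sup>2 * (1 - (cmod \<zeta>)\<^sup>2) * (1 - t\<^sup>2)"
    unfolding Deq cmod_power2 by (simp add: power2_eq_square algebra_simps)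
  moreover have "0 \<le> r\<^sup>2 * (1 - (cmod \<zeta>)\<^sup>2) * (1 - t\<^sup>2)"
    using t2 \<zeta> by (simp add: power_le_one)
  moreover have "0 \<le> (t - r * Re \<zeta>)\<^sup>2" "0 \<le> (r * Im \<zeta>)\<^sup>2" by simp_all
  ultimately have i1: "(r * Im \<zeta>)\<^sup>2 \<le> s\<^sup>2 * D\<^sup>2"
    and i2: "r\<^sup>2 * (1 - (cmod \<zeta>)\<^sup>2) * (1 - t\<^sup>2) \<le> s\<^sup>2 * D\<^sup>2"
    by linarith+
  have "(r * Im \<zeta>)\<^sup>2 \<le> (s * D)\<^sup>2" unfolding power_mult_distrib[of s D] by (rule i1)
  then have "\<bar>r * Im \<zeta>\<bar> \<le> \<bar>s * D\<bar>" by (simp only: abs_le_square_iff)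
  also have "\<dots> = s * D" using s D0 by simp
  also have "\<dots> \<le> s * (6 * \<delta>)" using D6 s by (intro mult_left_mono) auto
  finally have "r * \<bar>Im \<zeta>\<bar> \<le> s * (6 * \<delta>)" using r by (simp add: abs_mult)
  moreover have "1 / 2 * \<bar>Im \<zeta>\<bar> \<le> r * \<bar>Im \<zeta>\<bar>" using r by (intro mult_right_mono) auto
  ultimately show "\<bar>Im \<zeta>\<bar> \<le> 12 * s * \<delta>" by linarith
  \<comment> \<open>Bounding D^2 by a multiple of (1-r^2)(1-t^2), and not by \<delta>^2, allows 1 -
    t^2 to be cancelled on both sides.\<close>
  have "r\<^sup>2 * (1 - (cmod \<zeta>)\<^sup>2) * (1 - t\<^sup>2) \<le> s\<^sup>2 * (4 / 3 * ((1 - r\<^sup>2) * (1 - t\<^sup>2)))"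
    using i2 mult_left_mono[OF D43, of "s\<^sup>2"] by simp
  then have "(r\<^sup>2 * (1 - (cmod \<zeta>)\<^sup>2)) * (1 - t\<^sup>2) \<le> (s\<^sup>2 * (4 / 3 * (1 - r\<^sup>2))) * (1 - t\<^sup>2)"
    by (simp only: mult.assoc)
  then have "r\<^sup>2 * (1 - (cmod \<zeta>)\<^sup>2) \<le> s\<^sup>2 * (4 / 3 * (1 - r\<^sup>2))"
    by (rule mult_right_le_imp_le) (use t2 in simp)
  also have "\<dots> \<le> s\<^sup>2 * (4 / 3 * (2 * \<delta>))"
    by (intro mult_left_mono) (auto simp: r_def power2_eq_square algebra_simps)
  finally have "r\<^sup>2 * (1 - (cmod \<zeta>)\<^sup>2) \<le> 8 / 3 * (s\<^sup>2 * \<delta>)" by simp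
  moreover have "1 / 2 * (1 - (cmod \<zeta>)\<^sup>2) \<le> r\<^sup>2 * (1 - (cmod \<zeta>)\<^sup>2)"
  proof (intro mult_right_mono)
    have "(9 / 10)\<^sup>2 \<le> r\<^sup>2" using r by (intro power_mono) auto
    then show "1 / 2 \<le> r\<^sup>2" by (simp add: power2_eq_square)
    show "0 \<le> 1 - (cmod \<zeta>)\<^sup>2" using \<zeta> by (simp add: power_le_one)
  qed
  moreover have "0 \<le> s\<^sup>2 * \<delta>" using \<delta> by simp
  ultimately show "1 - (cmod \<zeta>)\<^sup>2 \<le> 11 * s\<^sup>2 * \<delta>" by simp
qed

section \<open>Integral means of the local part\<close>

lemma borel_measurable_hprod [measurable]:
  fixes f g :: "'a \<Rightarrow> complex ^ 'n"
  assumes "f \<in> borel_measurable M" "g \<in> borel_measurable M"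
  shows "(\<lambda>x. hprod (f x) (g x)) \<in> borel_measurable M"
proof -
  have nth: "(\<lambda>x :: complex ^ 'n. x $ j) \<in> borel_measurable borel"
    and cnj_nth: "(\<lambda>x :: complex ^ 'n. cnj (x $ j)) \<in> borel_measurable borel" for j
    by (intro borel_measurable_continuous_onI continuous_intros)+
  have [measurable]: "(\<lambda>x. f x $ j) \<in> borel_measurable M"
      "(\<lambda>x. cnj (g x $ j)) \<in> borel_measurable M" for j
    using measurable_compose[OF assms(1) nth] measurable_compose[OF assms(2) cnj_nth] by simp_all
  show ?thesis unfolding hprod_def by measurable
qed

lemma borel_measurable_local_kernel [measurable]:
  fixes f g :: "'a \<Rightarrow> complex ^ 'n"
  assumes [measurable]: "f \<in> borel_measurable M" "g \<in> borel_measurable M"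
  shows "(\<lambda>x. local_kernel (f x) (g x)) \<in> borel_measurable M"
  unfolding local_kernel_def aut_norm2_def by measurable

lemma indicator_koranyi_region:
  "indicator (koranyi_region \<xi> d) w = (if norm w < 1 \<and> cmod (1 - hprod w \<xi>) < d then 1 else 0 :: ennreal)"
  by (simp add: indicator_def koranyi_region_iff)

lemma borel_measurable_indicator_koranyi [measurable]:
  fixes f g :: "'a \<Rightarrow> complex ^ 'n"
  assumes [measurable]: "f \<in> borel_measurable M" "g \<in> borel_measurable M"
  shows "(\<lambda>x. indicator (koranyi_region (f x) d) (g x) :: ennreal) \<in> borel_measurable M"
  unfolding indicator_koranyi_region by measurable

text \<open>Surface measure and \<open>\<mu>\<close> carry restricted sigma-algebras on sphere and
  ball. This passes from measurability into such a space, for instance of the projections of a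
  product, to Borel measurability in the ambient space.\<close>

lemma borel_measurable_restrict_space:
  assumes "sets N = sets (restrict_space borel A)" "f \<in> measurable M N"
  shows "f \<in> borel_measurable M"
proof -
  have "(\<lambda>x. x) \<in> measurable N borel"
    unfolding measurable_cong_sets[OF assms(1) refl] by (intro measurable_restrict_space1) simp
  from measurable_compose[OF assms(2) this] show ?thesis by simp
qed

lemma finite_sphere_measure: "finite_measure (sphere_measure :: (complex ^ 'n) measure)"
  by (rule finite_measureI) (simp add: space_sphere_measure emeasure_sphere_measure_sphere)

lemma borel_measurable_sphere_measure:
  "f \<in> measurable M sphere_measure \<Longrightarrow> f \<in> borel_measurable M"
  by (rule borel_measurable_restrict_space[OF sets_sphere_measure])

lemma sets_sphere_measure_iff:
  "A \<in> sets (sphere_measure :: (complex ^ 'n) measure) \<longleftrightarrow> A \<subseteq> sphere 0 1 \<and> A \<in> sets borel"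
  unfolding sets_sphere_measure by (rule sets_restrict_space_iff) simp

lemma koranyi_region_measurable:
  assumes "sets M = sets (restrict_space borel (ball 0 1))"
  shows "koranyi_region \<xi> d \<in> sets M"
proof -
  have "koranyi_region \<xi> d = {w. cmod (1 - hprod w \<xi>) < d} \<inter> ball 0 1"
    by (auto simp: koranyi_region_iff)
  then show ?thesis
    unfolding assms by (subst sets_restrict_space_iff) (auto intro!: sets.Int borel_open open_Collect_hprod)
qed

text \<open>The value is the integral over w of a jointly measurable indicator, so the measurability
  part of Fubini's theorem applies.\<close>

lemma borel_measurable_emeasure_koranyi:
  assumes M: "finite_measure M" "sets M = sets (restrict_space borel (ball 0 1))"
  shows "(\<lambda>\<xi>. emeasure M (koranyi_region \<xi> d)) \<in> borel_measurable sphere_measure"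
proof -
  interpret finite_measure M by fact
  have [measurable]: "fst \<in> borel_measurable (sphere_measure \<Otimes>\<^sub>M M)" "snd \<in> borel_measurable (sphere_measure \<Otimes>\<^sub>M M)"
    by (rule borel_measurable_sphere_measure borel_measurable_restrict_space[OF M(2)], simp)+
  have "(\<lambda>x. indicator (koranyi_region (fst x) d) (snd x) :: ennreal) \<in> borel_measurable (sphere_measure \<Otimes>\<^sub>M M)"
    by measurable
  from borel_measurable_nn_integral_fst[OF this] show ?thesis
    by (simp add: koranyi_region_measurable[OF M(2)])
qed

lemma suminf_ennreal_eq_top:
  assumes "\<And>k. f k \<ge> (1 :: ennreal)"
  shows "(\<Sum>k. f k) = top"
proof (rule ccontr)
  assume "(\<Sum>k. f k) \<noteq> top"
  then obtain r where r: "(\<Sum>k. f k) = ennreal r" "r \<ge> 0" by (cases "\<Sum>k. f k") auto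
  obtain N :: nat where N: "r < real N" using reals_Archimedean2 by blast
  have "ennreal (real N) = (\<Sum>k<N. 1)" by (simp add: ennreal_of_nat_eq_real_of_nat)
  also have "\<dots> \<le> (\<Sum>k<N. f k)" by (intro sum_mono assms)
  also have "\<dots> \<le> (\<Sum>k. f k)" by (intro sum_le_suminf) auto
  finally show False using N r by simp
qed

text \<open>The kernel is summed over the layers 4^(-(j+2)) \<le> |\<phi>|^2 < 4^(-(j+1)). On layer
  j its p-th power is at most \<kappa>^(j+2), and the layer lies in a slab \<open>E j\<close> of
  measure O(2^(-(2n-1)(j+1)) \<delta>^n), so the series is geometric.\<close>

lemma local_kernel_integral_le:
  fixes p :: real
  assumes n: "CARD('n) > 1" and p: "1 < p" "p < (2 * real CARD('n) - 1) / (2 * (real CARD('n) - 1))"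
  obtains C where "C > 0"
    "\<And>\<delta> (w :: complex ^ 'n). 0 < \<delta> \<Longrightarrow> \<delta> < 1 / 10 \<Longrightarrow> norm w < 1 \<Longrightarrow>
      (\<integral>\<^sup>+\<xi>. enn_powr (local_kernel ((1 - \<delta>) *\<^sub>R \<xi>) w) p \<partial>sphere_measure) \<le> ennreal (C * \<delta> ^ CARD('n))"
proof -
  obtain C0 where C0: "C0 > 0"
    "\<And>\<eta> a b. norm (\<eta> :: complex ^ 'n) = 1 \<Longrightarrow> a > 0 \<Longrightarrow> b > 0 \<Longrightarrow>
      emeasure sphere_measure {\<xi> \<in> sphere 0 1. \<bar>Im (hprod \<xi> \<eta>)\<bar> \<le> a \<and> 1 - (cmod (hprod \<xi> \<eta>))\<^sup>2 \<le> b}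
      \<le> ennreal (C0 * (a * b ^ (CARD('n) - 1)))"
    using sphere_measure_slab_le[where 'n = 'n] by blast
  define m where "m = CARD('n) - 1"
  have m: "CARD('n) = Suc m" "m > 0" using n by (auto simp: m_def)
  define \<kappa> :: real where "\<kappa> = 4 powr (real m * p)"
  \<comment> \<open>The ratio of the geometric series. It is below 1 precisely because p(2n-2) <
    2n-1.\<close>
  define \<rho> where "\<rho> = \<kappa> * (1 / 2) ^ (2 * m + 1)"
  have \<kappa>: "\<kappa> \<ge> 1" using p m by (auto simp: \<kappa>_def intro!: ge_one_powr_ge_zero)
  have "\<rho> = 2 powr (2 * real m * p - (2 * real m + 1))"
  proof -
    have "\<kappa> = (2 powr 2) powr (real m * p)" by (simp add: \<kappa>_def)
    also have "\<dots> = 2 powr (2 * real m * p)" by (simp only: powr_powr mult.assoc)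
    finally have k: "\<kappa> = 2 powr (2 * real m * p)" .
    have "(1 / 2 :: real) ^ (2 * m + 1) = 1 / 2 powr (real (2 * m + 1))"
      by (subst powr_realpow) (simp_all add: power_divide)
    then show ?thesis unfolding \<rho>_def k by (simp add: powr_diff add.commute)
  qed
  also have "\<dots> < 2 powr 0"
    using p m by (intro powr_less_mono) (auto simp: field_simps)
  finally have \<rho>: "0 < \<rho>" "\<rho> < 1" using \<kappa> by (auto simp: \<rho>_def)
  define C where "C = C0 * 12 * 11 ^ m * \<kappa> * (\<rho> / (1 - \<rho>))"
  show thesis
  proof (rule that[of C])
    show "C > 0" using C0 \<kappa> \<rho> by (simp add: C_def)
    fix \<delta> :: real and w :: "complex ^ 'n"
    assume \<delta>: "0 < \<delta>" "\<delta> < 1 / 10" and w: "norm w < 1"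
    let ?K = "\<lambda>\<xi>. enn_powr (local_kernel ((1 - \<delta>) *\<^sub>R \<xi>) w) p"
    define s :: "nat \<Rightarrow> real" where "s j = (1 / 2) ^ Suc j" for j
    have s: "0 < s j" "s j \<le> 1 / 2" "(s j)\<^sup>2 = (1 / 4) ^ Suc j" for j
      by (auto simp: s_def power_le_one mult_left_le power2_eq_square simp flip: power_mult_distrib)
    define E where "E j = {\<xi> \<in> sphere 0 1. \<bar>Im (hprod \<xi> (sgn w))\<bar> \<le> 12 * s j * \<delta> \<and>
       1 - (cmod (hprod \<xi> (sgn w)))\<^sup>2 \<le> 11 * (s j)\<^sup>2 * \<delta>}" for j
    have E: "E j \<in> sets sphere_measure" for j
      unfolding sets_sphere_measure_iff E_def using borel_closed[OF closed_slab] by auto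
    show "(\<integral>\<^sup>+\<xi>. ?K \<xi> \<partial>sphere_measure) \<le> ennreal (C * \<delta> ^ CARD('n))"
    proof (cases "w = 0")
      \<comment> \<open>At the origin \<open>sgn w\<close> is not a unit vector and gives no slab;
        but there 1 - |w| = 1 is not below 6\<delta>, so the kernel vanishes for every
        \<xi>.\<close>
      case True
      have "?K \<xi> = 0" if "\<xi> \<in> sphere 0 1" for \<xi>
        using near_estimates(3)[of \<xi> \<delta> w] that \<delta> True by (auto simp: local_kernel_def)
      then have "(\<integral>\<^sup>+\<xi>. ?K \<xi> \<partial>sphere_measure) = (\<integral>\<^sup>+(\<xi>::complex^'n). 0 \<partial>sphere_measure)"
        by (intro nn_integral_cong) (simp add: space_sphere_measure)
      then show ?thesis by simp
    next
      case False
      have pointwise: "?K \<xi> \<le> (\<Sum>j. ennreal (\<kappa> ^ (j + 2)) * indicator (E j) \<xi>)" if \<xi>: "\<xi> \<in> sphere 0 1" for \<xi>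
      proof -
        define q where "q = aut_norm2 ((1 - \<delta>) *\<^sub>R \<xi>) w"
        have n\<xi>: "norm \<xi> = 1" using \<xi> by simp
        have q0: "q \<ge> 0" unfolding q_def using \<delta> w n\<xi> by (intro aut_norm2_bounds) auto
        have inE: "\<xi> \<in> E j" if "q < (1 / 4) ^ Suc j" for j
          using slab_estimates[OF n\<xi> \<delta> w False s(1,2)[of j]] that \<xi> unfolding q_def s(3)[symmetric]
          by (simp add: E_def)
        show ?thesis
        proof (cases "q < 1 / 4")
          case False
          then show ?thesis by (simp add: local_kernel_def q_def)
        next
          case q14: True
          show ?thesis
          proof (cases "q = 0")
            \<comment> \<open>At the singularity the kernel is infinite. The point lies in all slabs
              and \<kappa> \<ge> 1, so the majorant diverges too.\<close>
            case True
            have "ennreal (\<kappa> ^ (j + 2)) * indicator (E j) \<xi> \<ge> 1" for j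
            proof -
              have "1 \<le> \<kappa> ^ (j + 2)" using \<kappa> by (rule one_le_power)
              then have "ennreal 1 \<le> ennreal (\<kappa> ^ (j + 2))" by (rule ennreal_leI)
              then show ?thesis using inE[of j] True by simp
            qed
            then have "(\<Sum>j. ennreal (\<kappa> ^ (j + 2)) * indicator (E j) \<xi>) = top"
              by (rule suminf_ennreal_eq_top)
            then show ?thesis by simp
          next
            case False
            then have q: "q > 0" using q0 by simp
            have ex: "\<exists>j. (1 / 4) ^ (j + 2) \<le> q"
            proof -
              obtain j where "(1 / 4 :: real) ^ j < q" using real_arch_pow_inv[OF q, of "1 / 4"] by auto
              moreover have "(1 / 4 :: real) ^ (j + 2) \<le> (1 / 4) ^ j" by (intro power_decreasing) auto
              ultimately show ?thesis by (intro exI[of _ j]) linarith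
            qed
            \<comment> \<open>The layer containing q: minimality gives the upper bound 4^(-(j+1)),
              which for j = 0 is the cut-off q < 1/4.\<close>
            define j where "j = (LEAST j. (1 / 4) ^ (j + 2) \<le> q)"
            have j: "(1 / 4) ^ (j + 2) \<le> q" unfolding j_def by (rule LeastI_ex[OF ex])
            have "q < (1 / 4) ^ Suc j"
            proof (cases j)
              case 0
              then show ?thesis using q14 by simp
            next
              case (Suc l)
              then have "\<not> (1 / 4) ^ (l + 2) \<le> q"
                using not_less_Least[of l "\<lambda>j. (1 / 4) ^ (j + 2) \<le> q"] by (simp add: j_def)
              then show ?thesis using Suc by simp
            qed
            then have jE: "\<xi> \<in> E j" by (rule inE)
            have "?K \<xi> = enn_powr (inverse (ennreal (q ^ m))) p"
              using q14 by (simp add: local_kernel_def q_def m)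
            also have "\<dots> = ennreal (inverse (q ^ m) powr p)"
              using q by (simp add: inverse_ennreal enn_powr_ennreal)
            also have "inverse (q ^ m) powr p \<le> ((4 ^ (j + 2)) ^ m) powr p"
            proof (intro powr_mono2)
              have "inverse q \<le> inverse ((1 / 4) ^ (j + 2))" using j q by (intro le_imp_inverse_le) auto
              also have "\<dots> = 4 ^ (j + 2)" by (simp add: power_divide)
              finally show "inverse (q ^ m) \<le> (4 ^ (j + 2)) ^ m"
                using q unfolding power_inverse[symmetric] by (intro power_mono) auto
            qed (use q p in auto)
            also have "((4 ^ (j + 2)) ^ m) powr p = \<kappa> ^ (j + 2)"
            proof -
              have "((4 ^ (j + 2)) ^ m :: real) = 4 powr real ((j + 2) * m)"
                unfolding power_mult[symmetric] by (rule powr_realpow[symmetric]) simp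
              moreover have "\<kappa> ^ (j + 2) = \<kappa> powr real (j + 2)"
                using \<kappa> by (intro powr_realpow[symmetric]) simp
              ultimately show ?thesis by (simp add: \<kappa>_def powr_powr algebra_simps)
            qed
            finally have "?K \<xi> \<le> ennreal (\<kappa> ^ (j + 2)) * indicator (E j) \<xi>"
              using jE by (simp add: ennreal_leI)
            also note le_suminf_ennreal[of _ j]
            finally show ?thesis by simp
          qed
        qed
      qed
      have "(\<integral>\<^sup>+\<xi>. ?K \<xi> \<partial>sphere_measure) \<le>
          (\<integral>\<^sup>+\<xi>. (\<Sum>j. ennreal (\<kappa> ^ (j + 2)) * indicator (E j) \<xi>) \<partial>sphere_measure)"
        by (intro nn_integral_mono pointwise) (simp add: space_sphere_measure)
      also have "\<dots> = (\<Sum>j. ennreal (\<kappa> ^ (j + 2)) * emeasure sphere_measure (E j))"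
        using E by (subst nn_integral_suminf) (auto simp: nn_integral_cmult_indicator)
      also have "\<dots> \<le> (\<Sum>j. ennreal (C0 * 12 * 11 ^ m * \<kappa> * \<delta> ^ CARD('n) * \<rho> ^ Suc j))"
      proof (intro suminf_le summableI)
        fix j
        have "ennreal (\<kappa> ^ (j + 2)) * emeasure sphere_measure (E j) \<le>
            ennreal (\<kappa> ^ (j + 2)) * ennreal (C0 * ((12 * s j * \<delta>) * (11 * (s j)\<^sup>2 * \<delta>) ^ (CARD('n) - 1)))"
          unfolding E_def using s(1)[of j] \<delta> False
          by (intro mult_left_mono C0(2)) (auto simp: norm_sgn)
        also have "\<dots> = ennreal (\<kappa> ^ (j + 2) * (C0 * ((12 * s j * \<delta>) * (11 * (s j)\<^sup>2 * \<delta>) ^ (CARD('n) - 1))))"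
          using \<kappa> s[of j] \<delta> C0 by (intro ennreal_mult[symmetric]) auto
        also have "\<kappa> ^ (j + 2) * (C0 * ((12 * s j * \<delta>) * (11 * (s j)\<^sup>2 * \<delta>) ^ (CARD('n) - 1))) =
            C0 * 12 * 11 ^ m * \<kappa> * \<delta> ^ CARD('n) * (\<kappa> ^ Suc j * (s j * (s j)\<^sup>2 ^ m))"
          by (simp add: m power_mult_distrib)
        also have "s j * (s j)\<^sup>2 ^ m = ((1 / 2) ^ (2 * m + 1)) ^ Suc j"
        proof -
          have "s j * (s j)\<^sup>2 ^ m = s j ^ (2 * m + 1)" by (simp add: power_mult)
          also have "\<dots> = (1 / 2) ^ (Suc j * (2 * m + 1))" unfolding s_def by (rule power_mult[symmetric])
          also have "\<dots> = ((1 / 2) ^ (2 * m + 1)) ^ Suc j" by (subst mult.commute) (rule power_mult)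
          finally show ?thesis .
        qed
        also have "\<kappa> ^ Suc j * ((1 / 2) ^ (2 * m + 1)) ^ Suc j = \<rho> ^ Suc j"
          unfolding \<rho>_def by (rule power_mult_distrib[symmetric])
        finally show "ennreal (\<kappa> ^ (j + 2)) * emeasure sphere_measure (E j) \<le>
            ennreal (C0 * 12 * 11 ^ m * \<kappa> * \<delta> ^ CARD('n) * \<rho> ^ Suc j)" .
      qed
      also have "\<dots> = ennreal (C * \<delta> ^ CARD('n))"
      proof -
        have "(\<lambda>j. C0 * 12 * 11 ^ m * \<kappa> * \<delta> ^ CARD('n) * (\<rho> * \<rho> ^ j)) sums
            (C0 * 12 * 11 ^ m * \<kappa> * \<delta> ^ CARD('n) * (\<rho> * (1 / (1 - \<rho>))))"
          using \<rho> by (intro sums_mult geometric_sums) auto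
        then have "(\<lambda>j. C0 * 12 * 11 ^ m * \<kappa> * \<delta> ^ CARD('n) * \<rho> ^ Suc j) sums (C * \<delta> ^ CARD('n))"
          by (simp add: C_def mult_ac)
        then show ?thesis
          using C0 \<kappa> \<delta> \<rho> by (subst suminf_ennreal2) (auto simp: sums_iff)
      qed
      finally show ?thesis .
    qed
  qed
qed

text \<open>Engulfing. The quasi-triangle inequality needs an intermediate point on the sphere, so w
  is replaced by w/|w|, whose distance to each centre is below 2d. Two applications give 2(d + 2d) =
  6d and then 2(6d + 2d) = 16d.\<close>

lemma koranyi_region_subset:
  fixes w :: "complex ^ 'n"
  assumes \<xi>: "norm \<xi> = 1" "norm \<xi>' = 1" and w: "w \<in> koranyi_region \<xi> d" "w \<in> koranyi_region \<xi>' d"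
    and "w \<noteq> 0"
  shows "koranyi_region \<xi> d \<subseteq> koranyi_region \<xi>' (16 * d)"
proof
  fix v assume v: "v \<in> koranyi_region \<xi> d"
  have ns: "norm (sgn w) = 1" using \<open>w \<noteq> 0\<close> by (simp add: norm_sgn)
  have proj: "cmod (1 - hprod (sgn w) \<zeta>) < 2 * d" if "norm \<zeta> = 1" "w \<in> koranyi_region \<zeta> d" for \<zeta>
  proof -
    have "cmod (1 - hprod (sgn w) \<zeta>) \<le> 2 * cmod (1 - of_real (norm w) * hprod (sgn w) \<zeta>)"
      using that ns by (intro norm_one_minus_le_scaled norm_hprod_unit_le) (auto simp: koranyi_region_iff)
    also have "of_real (norm w) * hprod (sgn w) \<zeta> = hprod w \<zeta>"
      using \<open>w \<noteq> 0\<close> by (simp add: sgn_div_norm hprod_scaleR_left)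
    finally show ?thesis using that by (simp add: koranyi_region_iff)
  qed
  have v1: "norm v < 1" "cmod (1 - hprod v \<xi>) < d" using v by (auto simp: koranyi_region_iff)
  have "cmod (1 - hprod v (sgn w)) \<le> 2 * (cmod (1 - hprod v \<xi>) + cmod (1 - hprod \<xi> (sgn w)))"
    using v1 ns \<xi> by (intro quasi_triangle) auto
  also have "\<dots> < 6 * d"
    using v1 proj[OF \<xi>(1) w(1)] by (simp add: norm_hprod_commute[of \<xi>])
  finally have 1: "cmod (1 - hprod v (sgn w)) < 6 * d" .
  have "cmod (1 - hprod v \<xi>') \<le> 2 * (cmod (1 - hprod v (sgn w)) + cmod (1 - hprod (sgn w) \<xi>'))"
    using v1 ns \<xi> by (intro quasi_triangle) auto
  also have "\<dots> < 16 * d" using 1 proj[OF \<xi>(2) w(2)] by simp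
  finally show "v \<in> koranyi_region \<xi>' (16 * d)" using v1 by (simp add: koranyi_region_iff)
qed

text \<open>Jensen's inequality for the restriction of \<open>M\<close> to \<open>A\<close>. The
  total mass is thereby replaced by the mass of the set on which \<open>f\<close> lives, which is
  essential for the local part.\<close>

lemma Jensen_enn_powr_supported:
  fixes p :: real
  assumes "finite_measure M" and p: "1 < p" and f [measurable]: "f \<in> borel_measurable M"
    and A [measurable]: "A \<in> sets M" and 0: "\<And>x. x \<in> space M \<Longrightarrow> x \<notin> A \<Longrightarrow> f x = 0"
  shows "enn_powr (\<integral>\<^sup>+x. f x \<partial>M) p \<le> enn_powr (emeasure M A) (p - 1) * (\<integral>\<^sup>+x. enn_powr (f x) p \<partial>M)"
proof -
  interpret finite_measure M by fact
  let ?M = "density M (indicator A)"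
  have "(\<integral>\<^sup>+x. f x \<partial>?M) = (\<integral>\<^sup>+x. indicator A x * f x \<partial>M)"
    by (subst nn_integral_density) auto
  also have "\<dots> = (\<integral>\<^sup>+x. f x \<partial>M)"
    by (intro nn_integral_cong) (auto simp: indicator_def 0)
  finally have 1: "(\<integral>\<^sup>+x. f x \<partial>?M) = (\<integral>\<^sup>+x. f x \<partial>M)" .
  have "(\<integral>\<^sup>+x. enn_powr (f x) p \<partial>?M) = (\<integral>\<^sup>+x. indicator A x * enn_powr (f x) p \<partial>M)"
    by (subst nn_integral_density) auto
  also have "\<dots> = (\<integral>\<^sup>+x. enn_powr (f x) p \<partial>M)"
    by (intro nn_integral_cong) (auto simp: indicator_def 0)
  finally have 2: "(\<integral>\<^sup>+x. enn_powr (f x) p \<partial>?M) = (\<integral>\<^sup>+x. enn_powr (f x) p \<partial>M)" .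
  have 3: "emeasure ?M (space ?M) = emeasure M A"
  proof -
    have "emeasure ?M (space ?M) = (\<integral>\<^sup>+x. indicator A x * indicator (space M) x \<partial>M)"
      by (simp add: emeasure_density)
    also have "\<dots> = (\<integral>\<^sup>+x. indicator A x \<partial>M)"
      by (intro nn_integral_cong) auto
    finally show ?thesis by simp
  qed
  have fin: "finite_measure ?M" by (rule finite_measureI) (unfold 3, simp)
  show ?thesis
    using Jensen_enn_powr[OF fin p, of f] unfolding 1 2 3 by simp
qed

text \<open>Jensen's inequality for the measure on the natural numbers with point masses
  \<open>a k\<close>.\<close>

lemma Jensen_suminf_enn_powr:
  fixes p :: real and a :: "nat \<Rightarrow> real"
  assumes p: "1 < p" and a: "\<And>k. 0 \<le> a k" "summable a"
  shows "enn_powr (\<Sum>k. ennreal (a k) * x k) p \<le>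
    enn_powr (ennreal (suminf a)) (p - 1) * (\<Sum>k. ennreal (a k) * enn_powr (x k) p)"
proof -
  let ?M = "density (count_space UNIV) (\<lambda>k. ennreal (a k)) :: nat measure"
  have int: "(\<integral>\<^sup>+k. f k \<partial>?M) = (\<Sum>k. ennreal (a k) * f k)" for f
    by (subst nn_integral_density) (auto simp: nn_integral_count_space_nat)
  have sp: "emeasure ?M (space ?M) = ennreal (suminf a)"
    using int[of "\<lambda>k. 1"] a by (simp add: suminf_ennreal2)
  have "finite_measure ?M" by (intro finite_measureI) (simp only: sp, simp)
  from Jensen_enn_powr[OF this p, of x] show ?thesis by (simp add: int sp del: space_density)
qed

text \<open>Jensen's inequality on C(\<xi>,12\<delta>) leaves \<open>h \<xi>\<close> times the
  integral of the p-th power of the kernel. After Fubini, for fixed w, the supremum of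
  \<open>h\<close> over the relevant directions is at most the infimum of \<open>H\<close> over the
  directions whose region contains w. The kernel integral is at most C1/c times the measure of a cap
  of such directions, so a second use of Fubini leads back to an integral over \<xi> of
  \<open>H \<xi>\<close> times \<lambda>(C(\<xi>,12\<delta>)).\<close>

lemma local_part_le:
  fixes p :: real
  assumes n: "CARD('n) > 1" and p: "1 < p" "p < (2 * real CARD('n) - 1) / (2 * (real CARD('n) - 1))"
  obtains C where "C > 0"
    "\<And>\<delta> (M :: (complex ^ 'n) measure). 0 < \<delta> \<Longrightarrow> \<delta> < 1 / 10 \<Longrightarrow> finite_measure M \<Longrightarrow>
      sets M = sets (restrict_space borel (ball 0 1)) \<Longrightarrow>
      (\<integral>\<^sup>+\<xi>. enn_powr (\<integral>\<^sup>+w. local_kernel ((1 - \<delta>) *\<^sub>R \<xi>) w \<partial>M) p \<partial>sphere_measure) \<le>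
      ennreal C * (\<integral>\<^sup>+\<xi>. enn_powr (emeasure M (koranyi_region \<xi> (192 * \<delta>))) p \<partial>sphere_measure)"
proof -
  obtain C1 where C1: "C1 > 0"
    "\<And>\<delta> (w :: complex ^ 'n). 0 < \<delta> \<Longrightarrow> \<delta> < 1 / 10 \<Longrightarrow> norm w < 1 \<Longrightarrow>
      (\<integral>\<^sup>+\<xi>. enn_powr (local_kernel ((1 - \<delta>) *\<^sub>R \<xi>) w) p \<partial>sphere_measure) \<le> ennreal (C1 * \<delta> ^ CARD('n))"
    using local_kernel_integral_le[OF n p] by blast
  obtain c where c: "c > 0"
    "\<And>\<eta> t. norm (\<eta> :: complex ^ 'n) = 1 \<Longrightarrow> 0 < t \<Longrightarrow> t < 1 \<Longrightarrow>
      ennreal (c * t ^ CARD('n)) \<le> emeasure sphere_measure {\<xi> \<in> sphere 0 1. cmod (1 - hprod \<xi> \<eta>) < t}"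
    using sphere_measure_cap_ge[where 'n = 'n] by blast
  show thesis
  proof (rule that[of "C1 / c"])
    show "C1 / c > 0" using C1 c by simp
    fix \<delta> :: real and M :: "(complex ^ 'n) measure"
    assume \<delta>: "0 < \<delta>" "\<delta> < 1 / 10" and M: "finite_measure M" "sets M = sets (restrict_space borel (ball 0 1))"
    interpret M: finite_measure M by fact
    interpret S: finite_measure "sphere_measure :: (complex ^ 'n) measure" by (rule finite_sphere_measure)
    interpret P: pair_sigma_finite M "sphere_measure :: (complex ^ 'n) measure" ..
    let ?\<sigma> = "sphere_measure :: (complex ^ 'n) measure"
    have spM: "space M = ball 0 1"
      using sets_eq_imp_space_eq[OF M(2)] by (simp add: space_restrict_space)
    have [measurable]: "fst \<in> borel_measurable (M \<Otimes>\<^sub>M ?\<sigma>)" "snd \<in> borel_measurable (M \<Otimes>\<^sub>M ?\<sigma>)"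
       "(\<lambda>x. x) \<in> borel_measurable ?\<sigma>" "(\<lambda>x. x) \<in> borel_measurable M"
      by (rule borel_measurable_sphere_measure borel_measurable_restrict_space[OF M(2)], simp)+
    note [measurable] = koranyi_region_measurable[OF M(2)]
    define K where "K \<xi> w = enn_powr (local_kernel ((1 - \<delta>) *\<^sub>R \<xi>) w) p" for \<xi> w :: "complex ^ 'n"
    define h where "h \<xi> = enn_powr (emeasure M (koranyi_region \<xi> (12 * \<delta>))) (p - 1)" for \<xi>
    define H where "H \<xi> = enn_powr (emeasure M (koranyi_region \<xi> (192 * \<delta>))) (p - 1)" for \<xi>
    have hH [measurable]: "h \<in> borel_measurable ?\<sigma>" "H \<in> borel_measurable ?\<sigma>"
      unfolding h_def H_def by (intro measurable_enn_powr borel_measurable_emeasure_koranyi M)+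
    have near: "w \<in> koranyi_region \<xi> (12 * \<delta>)" "1 - norm w < 6 * \<delta>" 
      if "local_kernel ((1 - \<delta>) *\<^sub>R \<xi>) w \<noteq> 0" "norm \<xi> = 1" "norm w < 1" for \<xi> w :: "complex ^ 'n"
    proof -
      have "aut_norm2 ((1 - \<delta>) *\<^sub>R \<xi>) w < 1 / 4" using that(1) by (auto simp: local_kernel_def split: if_splits)
      from near_estimates[OF that(2) \<delta>(1) _ that(3) this] \<delta>
      show "w \<in> koranyi_region \<xi> (12 * \<delta>)" "1 - norm w < 6 * \<delta>" by auto
    qed
    have "(\<integral>\<^sup>+\<xi>. enn_powr (\<integral>\<^sup>+w. local_kernel ((1 - \<delta>) *\<^sub>R \<xi>) w \<partial>M) p \<partial>?\<sigma>) \<le>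
        (\<integral>\<^sup>+\<xi>. h \<xi> * (\<integral>\<^sup>+w. K \<xi> w \<partial>M) \<partial>?\<sigma>)"
    proof (intro nn_integral_mono)
      fix \<xi> :: "complex ^ 'n" assume "\<xi> \<in> space ?\<sigma>"
      then have \<xi>: "norm \<xi> = 1" by (simp add: space_sphere_measure)
      show "enn_powr (\<integral>\<^sup>+w. local_kernel ((1 - \<delta>) *\<^sub>R \<xi>) w \<partial>M) p \<le> h \<xi> * (\<integral>\<^sup>+w. K \<xi> w \<partial>M)"
        unfolding h_def K_def
      proof (rule Jensen_enn_powr_supported[OF M(1) p(1)])
        fix w assume "w \<in> space M" "w \<notin> koranyi_region \<xi> (12 * \<delta>)"
        then show "local_kernel ((1 - \<delta>) *\<^sub>R \<xi>) w = 0"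
          using near(1)[of \<xi> w] \<xi> by (auto simp: spM)
      qed measurable
    qed
    also have "\<dots> = (\<integral>\<^sup>+\<xi>. (\<integral>\<^sup>+w. h \<xi> * K \<xi> w \<partial>M) \<partial>?\<sigma>)"
      unfolding K_def by (intro nn_integral_cong nn_integral_cmult[symmetric]) measurable
    also have "\<dots> = (\<integral>\<^sup>+w. (\<integral>\<^sup>+\<xi>. h \<xi> * K \<xi> w \<partial>?\<sigma>) \<partial>M)"
    proof -
      have "(\<lambda>x. h (snd x) * K (snd x) (fst x)) \<in> borel_measurable (M \<Otimes>\<^sub>M ?\<sigma>)"
        unfolding K_def by measurable
      from P.Fubini[OF this] show ?thesis by simp
    qed
    also have "\<dots> \<le> (\<integral>\<^sup>+w. ennreal (C1 / c) * (\<integral>\<^sup>+\<xi>. indicator (koranyi_region \<xi> (12 * \<delta>)) w * H \<xi> \<partial>?\<sigma>) \<partial>M)"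
    proof (intro nn_integral_mono)
      fix w assume "w \<in> space M"
      then have w: "norm w < 1" by (simp add: spM)
      show "(\<integral>\<^sup>+\<xi>. h \<xi> * K \<xi> w \<partial>?\<sigma>) \<le> ennreal (C1 / c) * (\<integral>\<^sup>+\<xi>. indicator (koranyi_region \<xi> (12 * \<delta>)) w * H \<xi> \<partial>?\<sigma>)"
      proof (cases "\<exists>\<xi>\<in>sphere 0 1. K \<xi> w \<noteq> 0")
        case False
        then have "(\<integral>\<^sup>+\<xi>. h \<xi> * K \<xi> w \<partial>?\<sigma>) = (\<integral>\<^sup>+(\<xi>::complex ^ 'n). 0 \<partial>?\<sigma>)"
          by (intro nn_integral_cong) (auto simp: space_sphere_measure)
        then show ?thesis by simp
      next
        case True
        \<comment> \<open>A single direction with nonzero kernel already gives 1 - |w| < 6\<delta> <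
          1; hence w is nonzero and w/|w| can serve as the centre of the cap.\<close>
        then obtain \<xi>0 where \<xi>0: "norm \<xi>0 = 1" "K \<xi>0 w \<noteq> 0" by auto
        have "local_kernel ((1 - \<delta>) *\<^sub>R \<xi>0) w \<noteq> 0" using \<xi>0(2) by (auto simp: K_def)
        then have w6: "1 - norm w < 6 * \<delta>" using near(2)[OF _ \<xi>0(1) w] by simp
        then have w0: "w \<noteq> 0" using \<delta> by auto
        have nsgn: "norm (sgn w) = 1" using w0 by (simp add: norm_sgn)
        define cap where "cap = {\<xi> \<in> sphere 0 1. cmod (1 - hprod \<xi> (sgn w)) < \<delta>}"
        have "cap = {\<xi>. cmod (1 - hprod \<xi> (sgn w)) < \<delta>} \<inter> sphere 0 1" by (auto simp: cap_def)
        then have cap [measurable]: "cap \<in> sets ?\<sigma>"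
          unfolding sets_sphere_measure_iff by (auto intro!: borel_open open_Collect_hprod)
        \<comment> \<open>The caps through \<open>w\<close> are comparable, so \<open>h\<close> may be replaced by the constant \<open>I\<close>; the factor
          \<open>\<delta>\<^bsup>n\<^esup>\<close> left by the kernel is then the measure of a cap on which \<open>I \<le> H\<close>.\<close>
        define I where "I = (INF \<xi>'\<in>{\<xi>' \<in> sphere 0 1. w \<in> koranyi_region \<xi>' (12 * \<delta>)}. H \<xi>')"
        \<comment> \<open>Moving from w/|w| down to w costs 1 - |w|, so the distance stays below
          \<delta> + 6\<delta>.\<close>
        have capI: "w \<in> koranyi_region \<xi>' (12 * \<delta>)" if "\<xi>' \<in> cap" for \<xi>'
        proof -
          have "of_real (norm w) * hprod (sgn w) \<xi>' = hprod w \<xi>'"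
            using w0 by (simp add: sgn_div_norm hprod_scaleR_left)
          then have "cmod (1 - hprod w \<xi>') = cmod (1 - of_real (norm w) * hprod (sgn w) \<xi>')" by simp
          also have "\<dots> \<le> cmod (1 - hprod (sgn w) \<xi>') + (1 - norm w)"
            using w nsgn that by (intro norm_one_minus_scaled_le norm_hprod_unit_le) (auto simp: cap_def)
          also have "\<dots> < 12 * \<delta>"
            using that w6 \<delta> by (simp add: cap_def norm_hprod_commute[of "sgn w"])
          finally show ?thesis using w by (simp add: koranyi_region_iff)
        qed
        have "(\<integral>\<^sup>+\<xi>. h \<xi> * K \<xi> w \<partial>?\<sigma>) \<le> (\<integral>\<^sup>+\<xi>. I * K \<xi> w \<partial>?\<sigma>)"
        proof (intro nn_integral_mono)
          fix \<xi> :: "complex ^ 'n" assume "\<xi> \<in> space ?\<sigma>"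
          then have \<xi>: "norm \<xi> = 1" by (simp add: space_sphere_measure)
          show "h \<xi> * K \<xi> w \<le> I * K \<xi> w"
          proof (cases "K \<xi> w = 0")
            case False
            then have "local_kernel ((1 - \<delta>) *\<^sub>R \<xi>) w \<noteq> 0" by (auto simp: K_def)
            then have w\<xi>: "w \<in> koranyi_region \<xi> (12 * \<delta>)" by (rule near(1)[OF _ \<xi> w])
            have "h \<xi> \<le> I" unfolding I_def
            proof (rule INF_greatest)
              fix \<xi>' assume "\<xi>' \<in> {\<xi>' \<in> sphere 0 1. w \<in> koranyi_region \<xi>' (12 * \<delta>)}"
              then have "koranyi_region \<xi> (12 * \<delta>) \<subseteq> koranyi_region \<xi>' (16 * (12 * \<delta>))"
                using \<xi> w\<xi> w0 by (intro koranyi_region_subset) auto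
              then show "h \<xi> \<le> H \<xi>'"
                unfolding h_def H_def using p by (intro enn_powr_mono emeasure_mono) auto
            qed
            then show ?thesis by (intro mult_right_mono) auto
          qed simp
        qed
        also have "\<dots> = I * (\<integral>\<^sup>+\<xi>. K \<xi> w \<partial>?\<sigma>)"
          unfolding K_def by (intro nn_integral_cmult) measurable
        also have "\<dots> \<le> I * ennreal (C1 * \<delta> ^ CARD('n))"
          unfolding K_def by (intro mult_left_mono C1(2) \<delta> w) auto
        also have "\<dots> = ennreal (C1 / c) * (I * ennreal (c * \<delta> ^ CARD('n)))"
        proof -
          have "ennreal (C1 * \<delta> ^ CARD('n)) = ennreal (C1 / c * (c * \<delta> ^ CARD('n)))" using c by simp
          also have "\<dots> = ennreal (C1 / c) * ennreal (c * \<delta> ^ CARD('n))"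
            using C1 c \<delta> by (intro ennreal_mult) auto
          finally show ?thesis by (simp only: mult_ac)
        qed
        also have "\<dots> \<le> ennreal (C1 / c) * (I * emeasure ?\<sigma> cap)"
          unfolding cap_def using \<delta> by (intro mult_left_mono c(2) nsgn) auto
        also have "I * emeasure ?\<sigma> cap = (\<integral>\<^sup>+\<xi>. I * indicator cap \<xi> \<partial>?\<sigma>)"
          by (simp add: nn_integral_cmult_indicator)
        also have "\<dots> \<le> (\<integral>\<^sup>+\<xi>. indicator (koranyi_region \<xi> (12 * \<delta>)) w * H \<xi> \<partial>?\<sigma>)"
        proof (intro nn_integral_mono)
          fix \<xi> :: "complex ^ 'n"
          show "I * indicator cap \<xi> \<le> indicator (koranyi_region \<xi> (12 * \<delta>)) w * H \<xi>"
          proof (cases "\<xi> \<in> cap")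
            case True
            then have "I \<le> H \<xi>" unfolding I_def using capI by (intro INF_lower) (auto simp: cap_def)
            then show ?thesis using True capI[OF True] by simp
          qed simp
        qed
        finally show ?thesis by (simp add: mult_left_mono)
      qed
    qed
    also have "\<dots> = ennreal (C1 / c) * (\<integral>\<^sup>+w. (\<integral>\<^sup>+\<xi>. indicator (koranyi_region \<xi> (12 * \<delta>)) w * H \<xi> \<partial>?\<sigma>) \<partial>M)"
    proof -
      have "(\<lambda>x. indicator (koranyi_region (snd x) (12 * \<delta>)) (fst x) * H (snd x)) \<in> borel_measurable (M \<Otimes>\<^sub>M ?\<sigma>)"
        by measurable
      from S.borel_measurable_nn_integral_fst[OF this] show ?thesis by (intro nn_integral_cmult) simp
    qed
    also have "(\<integral>\<^sup>+w. (\<integral>\<^sup>+\<xi>. indicator (koranyi_region \<xi> (12 * \<delta>)) w * H \<xi> \<partial>?\<sigma>) \<partial>M) =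
        (\<integral>\<^sup>+\<xi>. (\<integral>\<^sup>+w. indicator (koranyi_region \<xi> (12 * \<delta>)) w * H \<xi> \<partial>M) \<partial>?\<sigma>)"
    proof -
      have "(\<lambda>x. indicator (koranyi_region (snd x) (12 * \<delta>)) (fst x) * H (snd x)) \<in> borel_measurable (M \<Otimes>\<^sub>M ?\<sigma>)"
        by measurable
      from P.Fubini[OF this] show ?thesis by simp
    qed
    also have "\<dots> = (\<integral>\<^sup>+\<xi>. H \<xi> * emeasure M (koranyi_region \<xi> (12 * \<delta>)) \<partial>?\<sigma>)"
      by (intro nn_integral_cong, subst nn_integral_multc)
        (simp_all add: mult.commute koranyi_region_measurable[OF M(2)])
    \<comment> \<open>Enlarging the radius in the second factor too makes the exponents p - 1 and 1
      add up to p.\<close>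
    also have "\<dots> \<le> (\<integral>\<^sup>+\<xi>. enn_powr (emeasure M (koranyi_region \<xi> (192 * \<delta>))) p \<partial>?\<sigma>)"
    proof (intro nn_integral_mono)
      fix \<xi> :: "complex ^ 'n"
      have "emeasure M (koranyi_region \<xi> (12 * \<delta>)) \<le> emeasure M (koranyi_region \<xi> (192 * \<delta>))"
        using \<delta> by (intro emeasure_mono) (auto simp: koranyi_region_iff)
      then have "H \<xi> * emeasure M (koranyi_region \<xi> (12 * \<delta>)) \<le> H \<xi> * emeasure M (koranyi_region \<xi> (192 * \<delta>))"
        by (intro mult_left_mono) auto
      also have "\<dots> = enn_powr (emeasure M (koranyi_region \<xi> (192 * \<delta>))) (p - 1 + 1)"
        unfolding H_def using p by (subst enn_powr_add) auto
      finally show "H \<xi> * emeasure M (koranyi_region \<xi> (12 * \<delta>)) \<le> enn_powr (emeasure M (koranyi_region \<xi> (192 * \<delta>))) p"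
        by simp
    qed
    finally show "(\<integral>\<^sup>+\<xi>. enn_powr (\<integral>\<^sup>+w. local_kernel ((1 - \<delta>) *\<^sub>R \<xi>) w \<partial>M) p \<partial>?\<sigma>) \<le>
      ennreal (C1 / c) * (\<integral>\<^sup>+\<xi>. enn_powr (emeasure M (koranyi_region \<xi> (192 * \<delta>))) p \<partial>?\<sigma>)"
      by (simp add: mult_left_mono)
  qed
qed

section \<open>The two implications\<close>

lemma eventually_at_left_1_iff:
  "eventually P (at_left (1::real)) \<longleftrightarrow> eventually (\<lambda>\<delta>. P (1 - \<delta>)) (at_right 0)"
proof
  assume "eventually P (at_left 1)"
  then obtain b where b: "b < 1" "\<And>y. b < y \<Longrightarrow> y < 1 \<Longrightarrow> P y"
    by (auto simp: eventually_at_left_field)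
  then show "eventually (\<lambda>\<delta>. P (1 - \<delta>)) (at_right 0)"
    unfolding eventually_at_right_field by (intro exI[of _ "1 - b"]) auto
next
  assume "eventually (\<lambda>\<delta>. P (1 - \<delta>)) (at_right 0)"
  then obtain b where b: "b > 0" "\<And>y. 0 < y \<Longrightarrow> y < b \<Longrightarrow> P (1 - y)"
    by (auto simp: eventually_at_right_field)
  then have "P y" if "1 - b < y" "y < 1" for y
    using b(2)[of "1 - y"] that by simp
  then show "eventually P (at_left 1)"
    unfolding eventually_at_left_field using b(1) by (intro exI[of _ "1 - b"]) auto
qed

text \<open>The coefficient 4^(-nk) is split as \<rho>^k b^k. The summable part \<rho>^k, with
  \<rho> = 2^(\<beta>-2n) < 1, is the weight in Jensen's inequality; the part b^k = 2^(-\<beta>k)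
  stays inside the p-th power and compensates the growth of the bound from \<delta> to 2^k \<delta>.
  After that every term has the same bound, and the weights contribute A^(p-1) A = A^p.\<close>

lemma global_part_le:
  fixes M :: "(complex ^ 'n) measure" and p \<gamma> \<beta> \<epsilon> N \<delta> :: real
  assumes M: "finite_measure M" "sets M = sets (restrict_space borel (ball 0 1))"
    and p: "1 < p" and \<gamma>\<beta>: "\<gamma> \<le> \<beta>" "\<beta> < 2 * real CARD('n)" and \<epsilon>: "0 \<le> \<epsilon>" "0 \<le> N" and \<delta>: "0 < \<delta>"
    and bound: "\<And>t. 0 < t \<Longrightarrow> (\<integral>\<^sup>+\<xi>. enn_powr (emeasure M (koranyi_region \<xi> t)) p \<partial>sphere_measure) \<le>
      ennreal (\<epsilon> * t powr (\<gamma> * p) + N * t powr (\<beta> * p))"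
  shows "(\<integral>\<^sup>+\<xi>. enn_powr (\<Sum>k. ennreal ((1 / 4 ^ CARD('n)) ^ k) * emeasure M (koranyi_region \<xi> (2 ^ k * \<delta>))) p \<partial>sphere_measure)
    \<le> ennreal ((1 / (1 - 2 powr (\<beta> - 2 * real CARD('n)))) powr p * (\<epsilon> * \<delta> powr (\<gamma> * p) + N * \<delta> powr (\<beta> * p)))"
proof -
  define \<rho> where "\<rho> = 2 powr (\<beta> - 2 * real CARD('n))"
  define b where "b = 2 powr (- \<beta>)"
  define A where "A = 1 / (1 - \<rho>)"
  define B where "B = \<epsilon> * \<delta> powr (\<gamma> * p) + N * \<delta> powr (\<beta> * p)"
  have "\<rho> < 2 powr 0" unfolding \<rho>_def using \<gamma>\<beta> by (intro powr_less_mono) auto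
  then have \<rho>: "0 < \<rho>" "\<rho> < 1" by (auto simp: \<rho>_def)
  have A: "A > 0" using \<rho> by (simp add: A_def)
  have b: "b > 0" by (simp add: b_def)
  have B: "B \<ge> 0" using \<epsilon> by (simp add: B_def)
  have "\<rho> * b = 2 powr (- (2 * real CARD('n)))" by (simp add: \<rho>_def b_def flip: powr_add)
  also have "\<dots> = 1 / 2 powr real (2 * CARD('n))" by (simp add: powr_minus_divide)
  also have "\<dots> = 1 / 4 ^ CARD('n)" by (subst powr_realpow) (simp_all add: power_mult)
  finally have \<rho>b: "1 / 4 ^ CARD('n) = \<rho> * b" ..
  let ?\<Lambda> = "\<lambda>\<xi> k. emeasure M (koranyi_region \<xi> (2 ^ k * \<delta>))"
  note [measurable] = borel_measurable_emeasure_koranyi[OF M]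
  have sums: "(\<lambda>k. \<rho> ^ k) sums A" unfolding A_def using \<rho> by (intro geometric_sums) auto
  have "(\<integral>\<^sup>+\<xi>. enn_powr (\<Sum>k. ennreal ((1 / 4 ^ CARD('n)) ^ k) * ?\<Lambda> \<xi> k) p \<partial>sphere_measure) \<le>
     (\<integral>\<^sup>+\<xi>. ennreal (A powr (p - 1)) * (\<Sum>k. ennreal (\<rho> ^ k) * (ennreal ((b ^ k) powr p) * enn_powr (?\<Lambda> \<xi> k) p)) \<partial>sphere_measure)"
  proof (intro nn_integral_mono)
    fix \<xi> :: "complex ^ 'n"
    have "(\<Sum>k. ennreal ((1 / 4 ^ CARD('n)) ^ k) * ?\<Lambda> \<xi> k) = (\<Sum>k. ennreal (\<rho> ^ k) * (ennreal (b ^ k) * ?\<Lambda> \<xi> k))"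
    proof (intro suminf_cong)
      fix k
      have "ennreal ((\<rho> * b) ^ k) = ennreal (\<rho> ^ k) * ennreal (b ^ k)"
        unfolding power_mult_distrib using \<rho> b by (intro ennreal_mult) auto
      then show "ennreal ((1 / 4 ^ CARD('n)) ^ k) * ?\<Lambda> \<xi> k = ennreal (\<rho> ^ k) * (ennreal (b ^ k) * ?\<Lambda> \<xi> k)"
        unfolding \<rho>b by (simp only: mult.assoc)
    qed
    also have "enn_powr \<dots> p \<le> enn_powr (ennreal (\<Sum>k. \<rho> ^ k)) (p - 1) *
        (\<Sum>k. ennreal (\<rho> ^ k) * enn_powr (ennreal (b ^ k) * ?\<Lambda> \<xi> k) p)"
      using \<rho> sums by (intro Jensen_suminf_enn_powr p) (auto simp: sums_iff)
    also have "enn_powr (ennreal (\<Sum>k. \<rho> ^ k)) (p - 1) = ennreal (A powr (p - 1))"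
      using sums A by (simp add: sums_iff enn_powr_ennreal)
    also have "(\<lambda>k. enn_powr (ennreal (b ^ k) * ?\<Lambda> \<xi> k) p) = (\<lambda>k. ennreal ((b ^ k) powr p) * enn_powr (?\<Lambda> \<xi> k) p)"
    proof
      fix k
      have "0 \<le> b ^ k" using b by simp
      from enn_powr_ennreal[OF this, of p] p
      show "enn_powr (ennreal (b ^ k) * ?\<Lambda> \<xi> k) p = ennreal ((b ^ k) powr p) * enn_powr (?\<Lambda> \<xi> k) p"
        by (subst enn_powr_mult) auto
    qed
    finally show "enn_powr (\<Sum>k. ennreal ((1 / 4 ^ CARD('n)) ^ k) * ?\<Lambda> \<xi> k) p \<le>
      ennreal (A powr (p - 1)) * (\<Sum>k. ennreal (\<rho> ^ k) * (ennreal ((b ^ k) powr p) * enn_powr (?\<Lambda> \<xi> k) p))" .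
  qed
  also have "\<dots> = ennreal (A powr (p - 1)) * (\<Sum>k. ennreal (\<rho> ^ k) * (ennreal ((b ^ k) powr p) *
      (\<integral>\<^sup>+\<xi>. enn_powr (?\<Lambda> \<xi> k) p \<partial>sphere_measure)))"
    by (simp add: nn_integral_cmult nn_integral_suminf)
  also have "\<dots> \<le> ennreal (A powr (p - 1)) * (\<Sum>k. ennreal (\<rho> ^ k * B))"
  proof (intro mult_left_mono suminf_le summableI)
    fix k
    \<comment> \<open>The left side is 2^(kp(e - \<beta>)) \<delta>^(ep); this is used with e =
      \<gamma> and e = \<beta>.\<close>
    have scale: "(b ^ k) powr p * (2 ^ k * \<delta>) powr (e * p) \<le> \<delta> powr (e * p)" if "e \<le> \<beta>" for e
    proof -
      have "(b ^ k) powr p = 2 powr (- \<beta> * real k * p)"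
        by (simp add: b_def powr_powr flip: powr_realpow)
      moreover have "(2 ^ k * \<delta>) powr (e * p) = 2 powr (real k * (e * p)) * \<delta> powr (e * p)"
        using \<delta> by (simp add: powr_mult powr_powr flip: powr_realpow)
      ultimately have "(b ^ k) powr p * (2 ^ k * \<delta>) powr (e * p) =
          2 powr (- \<beta> * real k * p + real k * (e * p)) * \<delta> powr (e * p)"
        by (simp only: powr_add mult.assoc)
      also have "\<dots> \<le> 2 powr 0 * \<delta> powr (e * p)"
      proof (intro mult_right_mono powr_mono)
        have "(e - \<beta>) * (real k * p) \<le> 0" using that p by (intro mult_nonpos_nonneg) auto
        then show "- \<beta> * real k * p + real k * (e * p) \<le> 0" by (simp add: algebra_simps)
      qed auto
      finally show ?thesis by simp
    qed
    have "ennreal (\<rho> ^ k) * (ennreal ((b ^ k) powr p) * (\<integral>\<^sup>+\<xi>. enn_powr (?\<Lambda> \<xi> k) p \<partial>sphere_measure)) \<le>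
        ennreal (\<rho> ^ k) * (ennreal ((b ^ k) powr p) *
          ennreal (\<epsilon> * (2 ^ k * \<delta>) powr (\<gamma> * p) + N * (2 ^ k * \<delta>) powr (\<beta> * p)))"
      using \<delta> by (intro mult_left_mono bound) auto
    also have "\<dots> = ennreal (\<rho> ^ k * ((b ^ k) powr p * (\<epsilon> * (2 ^ k * \<delta>) powr (\<gamma> * p) + N * (2 ^ k * \<delta>) powr (\<beta> * p))))"
    proof -
      have "0 \<le> \<epsilon> * (2 ^ k * \<delta>) powr (\<gamma> * p) + N * (2 ^ k * \<delta>) powr (\<beta> * p)" using \<epsilon> by simp
      then show ?thesis using \<rho> by (simp add: ennreal_mult del: ennreal_power)
    qed
    also have "(b ^ k) powr p * (\<epsilon> * (2 ^ k * \<delta>) powr (\<gamma> * p) + N * (2 ^ k * \<delta>) powr (\<beta> * p)) =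
       \<epsilon> * ((b ^ k) powr p * (2 ^ k * \<delta>) powr (\<gamma> * p)) + N * ((b ^ k) powr p * (2 ^ k * \<delta>) powr (\<beta> * p))"
      by (simp only: distrib_left mult_ac)
    also have "ennreal (\<rho> ^ k * \<dots>) \<le> ennreal (\<rho> ^ k * B)"
      unfolding B_def using \<rho> \<epsilon> \<gamma>\<beta> by (intro ennreal_leI mult_left_mono add_mono scale) auto
    finally show "ennreal (\<rho> ^ k) * (ennreal ((b ^ k) powr p) * (\<integral>\<^sup>+\<xi>. enn_powr (?\<Lambda> \<xi> k) p \<partial>sphere_measure)) \<le> ennreal (\<rho> ^ k * B)" .
  qed auto
  also have "(\<Sum>k. ennreal (\<rho> ^ k * B)) = ennreal (A * B)"
  proof -
    have "(\<lambda>k. \<rho> ^ k * B) sums (A * B)" by (intro sums_mult2 sums)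
    then show ?thesis using \<rho> B by (subst suminf_ennreal2) (auto simp: sums_iff)
  qed
  also have "ennreal (A powr (p - 1)) * ennreal (A * B) = ennreal (A powr p * B)"
    using A B powr_add[of A "p - 1" 1] by (simp add: mult.assoc flip: ennreal_mult)
  finally show ?thesis unfolding A_def B_def \<rho>_def .
qed

section \<open>The measure \<lambda> and pointwise bounds for the potential\<close>

lemma finite_measure_weighted:
  fixes \<mu> :: "(complex ^ 'n) measure"
  assumes "sets \<mu> = sets (restrict_space borel (ball 0 1))"
    and "(\<integral>\<^sup>+ w. ennreal ((1 - (norm w)\<^sup>2) ^ CARD('n)) \<partial>\<mu>) < \<infinity>"
  shows "finite_measure (weighted \<mu>)"
proof
  have sp: "space \<mu> = ball 0 1"
    using sets_eq_imp_space_eq[OF assms(1)] by (simp add: space_restrict_space)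
  have [measurable]: "(\<lambda>x. x) \<in> borel_measurable \<mu>"
    by (rule borel_measurable_restrict_space[OF assms(1)]) simp
  have "emeasure (weighted \<mu>) (space (weighted \<mu>)) =
      (\<integral>\<^sup>+ w. ennreal ((1 - norm w) ^ CARD('n)) * indicator (space \<mu>) w \<partial>\<mu>)"
    unfolding weighted_def space_density by (subst emeasure_density) auto
  also have "\<dots> \<le> (\<integral>\<^sup>+ w. ennreal ((1 - (norm w)\<^sup>2) ^ CARD('n)) \<partial>\<mu>)"
  proof (intro nn_integral_mono)
    fix w assume "w \<in> space \<mu>"
    then have w: "norm w < 1" by (simp add: sp)
    then have "(norm w)\<^sup>2 \<le> norm w" by (simp add: power2_eq_square mult_left_le)
    then have "(1 - norm w) ^ CARD('n) \<le> (1 - (norm w)\<^sup>2) ^ CARD('n)"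
      using w by (intro power_mono) auto
    then show "ennreal ((1 - norm w) ^ CARD('n)) * indicator (space \<mu>) w \<le> ennreal ((1 - (norm w)\<^sup>2) ^ CARD('n))"
      by (auto simp: indicator_def intro!: ennreal_leI)
  qed
  finally show "emeasure (weighted \<mu>) (space (weighted \<mu>)) \<noteq> \<infinity>" using assms(2) by auto
qed

lemma sets_weighted: "sets (weighted \<mu>) = sets \<mu>"
  by (simp add: weighted_def)

text \<open>The pointwise lower bound is integrated over the region alone, the kernel being
  nonnegative elsewhere. The constant collects the normalization (n+1)/(2n), the 1/(2n) of the
  antiderivative and the 1/(4\<delta>) of the kernel estimate.\<close>

lemma green_potential_ge:
  fixes \<mu> :: "(complex ^ 'n) measure"
  assumes \<mu>: "sets \<mu> = sets (restrict_space borel (ball 0 1))"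
    and \<xi>: "norm \<xi> = 1" and \<delta>: "0 < \<delta>" "\<delta> < 1"
  shows "ennreal ((real CARD('n) + 1) / (2 * real CARD('n)) / (2 * real CARD('n)) * (1 / (4 * \<delta>)) ^ CARD('n)) *
     emeasure (weighted \<mu>) (koranyi_region \<xi> \<delta>) \<le> green_potential \<mu> ((1 - \<delta>) *\<^sub>R \<xi>)"
proof -
  let ?c = "(real CARD('n) + 1) / (2 * real CARD('n)) / (2 * real CARD('n))"
  let ?d = "(1 / (4 * \<delta>)) ^ CARD('n)"
  have c: "?c \<ge> 0" by simp
  have [measurable]: "(\<lambda>x. x) \<in> borel_measurable \<mu>"
    by (rule borel_measurable_restrict_space[OF \<mu>]) simp
  note [measurable] = koranyi_region_measurable[OF \<mu>]
  have "ennreal (?c * ?d) * emeasure (weighted \<mu>) (koranyi_region \<xi> \<delta>) =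
     (\<integral>\<^sup>+ w. ennreal (?c * ?d) * (ennreal ((1 - norm w) ^ CARD('n)) * indicator (koranyi_region \<xi> \<delta>) w) \<partial>\<mu>)"
    unfolding weighted_def by (subst emeasure_density) (auto simp: nn_integral_cmult)
  also have "\<dots> \<le> green_potential \<mu> ((1 - \<delta>) *\<^sub>R \<xi>)"
    unfolding green_potential_def
  proof (intro nn_integral_mono)
    fix w
    show "ennreal (?c * ?d) * (ennreal ((1 - norm w) ^ CARD('n)) * indicator (koranyi_region \<xi> \<delta>) w) \<le>
      green ((1 - \<delta>) *\<^sub>R \<xi>) w"
    proof (cases "w \<in> koranyi_region \<xi> \<delta>")
      case True
      then have w: "norm w < 1" by (simp add: koranyi_region_iff)
      define q where "q = aut_norm2 ((1 - \<delta>) *\<^sub>R \<xi>) w"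
      have "((1 - norm w) / (4 * \<delta>)) ^ CARD('n) \<le> (1 - q) ^ CARD('n)"
        unfolding q_def using w \<delta> by (intro power_mono one_minus_aut_norm2_ge \<xi> \<delta> True) auto
      then have "?c * ((1 - norm w) / (4 * \<delta>)) ^ CARD('n) \<le> ?c * (1 - q) ^ CARD('n)"
        using c by (intro mult_left_mono) auto
      moreover have "((1 - norm w) / (4 * \<delta>)) ^ CARD('n) = ?d * (1 - norm w) ^ CARD('n)"
        by (simp add: power_divide)
      ultimately have le: "?c * ?d * (1 - norm w) ^ CARD('n) \<le> ?c * (1 - q) ^ CARD('n)" by simp
      have "ennreal (?c * ?d) * ennreal ((1 - norm w) ^ CARD('n)) = ennreal (?c * ?d * (1 - norm w) ^ CARD('n))"
        using c \<delta> w by (intro ennreal_mult[symmetric]) auto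
      also have "\<dots> \<le> ennreal (?c * (1 - q) ^ CARD('n))" by (rule ennreal_leI[OF le])
      also have "?c * (1 - q) ^ CARD('n) = (real CARD('n) + 1) / (2 * real CARD('n)) * ((1 - q) ^ CARD('n) / (2 * real CARD('n)))"
        by simp
      also have "ennreal \<dots> \<le> green ((1 - \<delta>) *\<^sub>R \<xi>) w"
        unfolding q_def using \<xi> \<delta> w by (intro green_ge) auto
      finally show ?thesis using True by simp
    qed simp
  qed
  finally show ?thesis .
qed

text \<open>The factor (1 - |w|)^n of the pointwise bound turns integration against \<mu> into
  integration against \<lambda>, after which sum and integral are interchanged.\<close>

lemma green_potential_le:
  fixes \<mu> :: "(complex ^ 'n) measure"
  assumes \<mu>: "sets \<mu> = sets (restrict_space borel (ball 0 1))"
    and \<xi>: "norm \<xi> = 1" and \<delta>: "0 < \<delta>" "\<delta> < 1" and n: "CARD('n) > 1"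
  shows "green_potential \<mu> ((1 - \<delta>) *\<^sub>R \<xi>) \<le>
    ennreal ((real CARD('n) + 1) / (2 * real CARD('n)) * 4 ^ CARD('n) * (64 / \<delta>) ^ CARD('n)) *
    ((\<Sum>k. ennreal ((1 / 4 ^ CARD('n)) ^ k) * emeasure (weighted \<mu>) (koranyi_region \<xi> (2 ^ k * \<delta>))) +
     (\<integral>\<^sup>+w. local_kernel ((1 - \<delta>) *\<^sub>R \<xi>) w \<partial>weighted \<mu>))"
proof -
  let ?c = "(real CARD('n) + 1) / (2 * real CARD('n)) * 4 ^ CARD('n) * (64 / \<delta>) ^ CARD('n)"
  have sp: "space \<mu> = ball 0 1"
    using sets_eq_imp_space_eq[OF \<mu>] by (simp add: space_restrict_space)
  have [measurable]: "(\<lambda>x. x) \<in> borel_measurable \<mu>"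
    by (rule borel_measurable_restrict_space[OF \<mu>]) simp
  have [measurable]: "(\<lambda>x. x) \<in> borel_measurable (weighted \<mu>)"
    by (rule borel_measurable_restrict_space[of "weighted \<mu>"]) (auto simp: sets_weighted \<mu>)
  note [measurable] = koranyi_region_measurable[of "weighted \<mu>", unfolded sets_weighted, OF \<mu>]
  define F where "F w = ennreal ?c *
      ((\<Sum>k. ennreal ((1 / 4 ^ CARD('n)) ^ k) * indicator (koranyi_region \<xi> (2 ^ k * \<delta>)) w)
       + local_kernel ((1 - \<delta>) *\<^sub>R \<xi>) w)" for w
  have "green_potential \<mu> ((1 - \<delta>) *\<^sub>R \<xi>) \<le> (\<integral>\<^sup>+w. ennreal ((1 - norm w) ^ CARD('n)) * F w \<partial>\<mu>)"
    unfolding green_potential_def F_def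
    by (intro nn_integral_mono green_le_weighted \<xi> \<delta> n) (auto simp: sp)
  also have "\<dots> = (\<integral>\<^sup>+w. F w \<partial>weighted \<mu>)"
    unfolding weighted_def F_def by (subst nn_integral_density) auto
  also have "\<dots> = ennreal ?c * ((\<integral>\<^sup>+w. (\<Sum>k. ennreal ((1 / 4 ^ CARD('n)) ^ k) * indicator (koranyi_region \<xi> (2 ^ k * \<delta>)) w) \<partial>weighted \<mu>) +
      (\<integral>\<^sup>+w. local_kernel ((1 - \<delta>) *\<^sub>R \<xi>) w \<partial>weighted \<mu>))"
    unfolding F_def by (subst nn_integral_cmult) (auto simp: nn_integral_add)
  also have "(\<integral>\<^sup>+w. (\<Sum>k. ennreal ((1 / 4 ^ CARD('n)) ^ k) * indicator (koranyi_region \<xi> (2 ^ k * \<delta>)) w) \<partial>weighted \<mu>) =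
     (\<Sum>k. ennreal ((1 / 4 ^ CARD('n)) ^ k) * emeasure (weighted \<mu>) (koranyi_region \<xi> (2 ^ k * \<delta>)))"
    by (subst nn_integral_suminf)
      (auto simp: nn_integral_cmult_indicator koranyi_region_measurable sets_weighted \<mu>)
  finally show ?thesis .
qed


text \<open>The dyadic sum needs a bound at every scale, the hypothesis gives one below some b. From
  b on, the total mass L is used: N is chosen such that N b^(\<beta>p) = L^p, and t^(\<beta>p)
  increases.\<close>

lemma small_o_bound_global:
  fixes M :: "(complex ^ 'n) measure" and p \<gamma> \<beta> \<epsilon> :: real
  assumes M: "finite_measure M" and p: "1 < p" and \<epsilon>: "0 \<le> \<epsilon>"
    and ev: "eventually (\<lambda>\<delta>. (\<integral>\<^sup>+\<xi>. enn_powr (emeasure M (koranyi_region \<xi> \<delta>)) p \<partial>sphere_measure)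
       \<le> ennreal (\<epsilon> * \<delta> powr (\<gamma> * p))) (at_right 0)" and \<beta>: "0 \<le> \<beta>"
  obtains N where "N \<ge> 0" "\<And>t. 0 < t \<Longrightarrow>
    (\<integral>\<^sup>+\<xi>. enn_powr (emeasure M (koranyi_region \<xi> t)) p \<partial>sphere_measure) \<le>
      ennreal (\<epsilon> * t powr (\<gamma> * p) + N * t powr (\<beta> * p))"
proof -
  interpret finite_measure M by fact
  obtain b where b: "b > 0" "\<And>t. 0 < t \<Longrightarrow> t < b \<Longrightarrow>
    (\<integral>\<^sup>+\<xi>. enn_powr (emeasure M (koranyi_region \<xi> t)) p \<partial>sphere_measure) \<le> ennreal (\<epsilon> * t powr (\<gamma> * p))"
    using ev by (auto simp: eventually_at_right_field)
  define L where "L = measure M (space M)"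
  define N where "N = L powr p / b powr (\<beta> * p)"
  show thesis
  proof (rule that[of N])
    show "N \<ge> 0" by (simp add: N_def)
    fix t :: real assume t: "0 < t"
    show "(\<integral>\<^sup>+\<xi>. enn_powr (emeasure M (koranyi_region \<xi> t)) p \<partial>sphere_measure) \<le>
      ennreal (\<epsilon> * t powr (\<gamma> * p) + N * t powr (\<beta> * p))"
    proof (cases "t < b")
      case True
      note b(2)[OF t True]
      also have "ennreal (\<epsilon> * t powr (\<gamma> * p)) \<le> ennreal (\<epsilon> * t powr (\<gamma> * p) + N * t powr (\<beta> * p))"
        by (intro ennreal_leI) (simp add: N_def)
      finally show ?thesis .
    next
      case False
      have "(\<integral>\<^sup>+\<xi>. enn_powr (emeasure M (koranyi_region \<xi> t)) p \<partial>sphere_measure) \<le>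
          (\<integral>\<^sup>+(\<xi> :: complex ^ 'n). ennreal (L powr p) \<partial>sphere_measure)"
      proof (intro nn_integral_mono)
        fix \<xi> :: "complex ^ 'n"
        have "enn_powr (emeasure M (koranyi_region \<xi> t)) p \<le> enn_powr (emeasure M (space M)) p"
          using p by (intro enn_powr_mono emeasure_space) auto
        then show "enn_powr (emeasure M (koranyi_region \<xi> t)) p \<le> ennreal (L powr p)"
          by (simp add: emeasure_eq_measure L_def enn_powr_ennreal)
      qed
      also have "\<dots> = ennreal (L powr p)"
        by (simp add: space_sphere_measure emeasure_sphere_measure_sphere)
      also have "\<dots> \<le> ennreal (\<epsilon> * t powr (\<gamma> * p) + N * t powr (\<beta> * p))"
      proof (rule ennreal_leI)
        have "b powr (\<beta> * p) \<le> t powr (\<beta> * p)" using False b p \<beta> by (intro powr_mono2) auto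
        then have "N * b powr (\<beta> * p) \<le> N * t powr (\<beta> * p)" by (intro mult_left_mono) (simp_all add: N_def)
        moreover have "N * b powr (\<beta> * p) = L powr p" using b by (simp add: N_def)
        moreover have "0 \<le> \<epsilon> * t powr (\<gamma> * p)" using \<epsilon> by simp
        ultimately show "L powr p \<le> \<epsilon> * t powr (\<gamma> * p) + N * t powr (\<beta> * p)" by linarith
      qed
      finally show ?thesis .
    qed
  qed
qed

text \<open>The point is the order of quantifiers: K depends on neither \<epsilon>, N, \<delta> nor
  the measure, so that \<epsilon> can be chosen in terms of K and N then obtained for that
  \<epsilon>.\<close>

lemma potential_mean_le:
  fixes p \<gamma> \<beta> :: real
  assumes n: "CARD('n) > 1" and p: "1 < p" "p < (2 * real CARD('n) - 1) / (2 * (real CARD('n) - 1))"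
    and \<gamma>\<beta>: "\<gamma> \<le> \<beta>" "\<beta> < 2 * real CARD('n)"
  obtains K where "K > 0"
    "\<And>(\<mu> :: (complex ^ 'n) measure) \<epsilon> N \<delta>. sets \<mu> = sets (restrict_space borel (ball 0 1)) \<Longrightarrow>
       finite_measure (weighted \<mu>) \<Longrightarrow> 0 \<le> \<epsilon> \<Longrightarrow> 0 \<le> N \<Longrightarrow>
       (\<And>t. 0 < t \<Longrightarrow> (\<integral>\<^sup>+\<xi>. enn_powr (emeasure (weighted \<mu>) (koranyi_region \<xi> t)) p \<partial>sphere_measure) \<le>
         ennreal (\<epsilon> * t powr (\<gamma> * p) + N * t powr (\<beta> * p))) \<Longrightarrow> 0 < \<delta> \<Longrightarrow> \<delta> < 1 / 10 \<Longrightarrow>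
       (\<integral>\<^sup>+\<xi>. enn_powr (green_potential \<mu> ((1 - \<delta>) *\<^sub>R \<xi>)) p \<partial>sphere_measure) \<le>
       ennreal (K * (\<delta> powr (- real CARD('n) * p) * (\<epsilon> * \<delta> powr (\<gamma> * p) + N * \<delta> powr (\<beta> * p))))"
proof -
  obtain C where C: "C > 0"
    "\<And>\<delta> (M :: (complex ^ 'n) measure). 0 < \<delta> \<Longrightarrow> \<delta> < 1 / 10 \<Longrightarrow> finite_measure M \<Longrightarrow>
      sets M = sets (restrict_space borel (ball 0 1)) \<Longrightarrow>
      (\<integral>\<^sup>+\<xi>. enn_powr (\<integral>\<^sup>+w. local_kernel ((1 - \<delta>) *\<^sub>R \<xi>) w \<partial>M) p \<partial>sphere_measure) \<le>
      ennreal C * (\<integral>\<^sup>+\<xi>. enn_powr (emeasure M (koranyi_region \<xi> (192 * \<delta>))) p \<partial>sphere_measure)"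
    using local_part_le[OF n p] by blast
  define c where "c = (real CARD('n) + 1) / (2 * real CARD('n)) * 4 ^ CARD('n) * 64 ^ CARD('n)"
  define A where "A = (1 / (1 - 2 powr (\<beta> - 2 * real CARD('n)))) powr p"
  \<comment> \<open>The prefactor of the potential bound without its \<delta>^(-n), the constant
    from splitting a sum, and the contributions of the dyadic part and of the local part. The latter
    is evaluated at t = 192\<delta>, whence the power of 192; \<gamma> \<le> \<beta> lets the larger
    exponent serve for both terms.\<close>
  define K where "K = c powr p * 2 powr p * (A + C * 192 powr (\<beta> * p))"
  have c: "c > 0" by (simp add: c_def)
  have A: "A \<ge> 0" by (simp add: A_def)
  show thesis
  proof (rule that[of K])
    show "K > 0" unfolding K_def using c C A by (intro mult_pos_pos add_nonneg_pos) auto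
    fix \<mu> :: "(complex ^ 'n) measure" and \<epsilon> N \<delta> :: real
    assume \<mu>: "sets \<mu> = sets (restrict_space borel (ball 0 1))" and fin: "finite_measure (weighted \<mu>)"
      and \<epsilon>: "0 \<le> \<epsilon>" "0 \<le> N" and \<delta>: "0 < \<delta>" "\<delta> < 1 / 10"
      and bound: "\<And>t. 0 < t \<Longrightarrow> (\<integral>\<^sup>+\<xi>. enn_powr (emeasure (weighted \<mu>) (koranyi_region \<xi> t)) p \<partial>sphere_measure) \<le>
         ennreal (\<epsilon> * t powr (\<gamma> * p) + N * t powr (\<beta> * p))"
    have W: "sets (weighted \<mu>) = sets (restrict_space borel (ball 0 1))" by (simp add: sets_weighted \<mu>)
    define B where "B = \<epsilon> * \<delta> powr (\<gamma> * p) + N * \<delta> powr (\<beta> * p)"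
    have B: "B \<ge> 0" using \<epsilon> by (simp add: B_def)
    define X where "X \<xi> = (\<Sum>k. ennreal ((1 / 4 ^ CARD('n)) ^ k) * emeasure (weighted \<mu>) (koranyi_region \<xi> (2 ^ k * \<delta>)))" for \<xi>
    define Y where "Y \<xi> = (\<integral>\<^sup>+w. local_kernel ((1 - \<delta>) *\<^sub>R \<xi>) w \<partial>weighted \<mu>)" for \<xi>
    note [measurable] = borel_measurable_emeasure_koranyi[OF fin W]
    have X [measurable]: "X \<in> borel_measurable sphere_measure" unfolding X_def by measurable
    have Y [measurable]: "Y \<in> borel_measurable sphere_measure"
    proof -
      interpret finite_measure "weighted \<mu>" by fact
      have [measurable]: "fst \<in> borel_measurable (sphere_measure \<Otimes>\<^sub>M weighted \<mu>)"
         "snd \<in> borel_measurable (sphere_measure \<Otimes>\<^sub>M weighted \<mu>)"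
        by (rule borel_measurable_sphere_measure borel_measurable_restrict_space[OF W], simp)+
      have "(\<lambda>x. local_kernel ((1 - \<delta>) *\<^sub>R fst x) (snd x)) \<in> borel_measurable (sphere_measure \<Otimes>\<^sub>M weighted \<mu>)"
        by measurable
      from borel_measurable_nn_integral_fst[OF this] show ?thesis by (simp add: Y_def[abs_def])
    qed
    have intX: "(\<integral>\<^sup>+\<xi>. enn_powr (X \<xi>) p \<partial>sphere_measure) \<le> ennreal (A * B)"
      unfolding X_def A_def B_def by (intro global_part_le fin W p \<gamma>\<beta> \<epsilon> \<delta> bound)
    have intY: "(\<integral>\<^sup>+\<xi>. enn_powr (Y \<xi>) p \<partial>sphere_measure) \<le> ennreal (C * 192 powr (\<beta> * p) * B)"
    proof -
      have "(\<integral>\<^sup>+\<xi>. enn_powr (Y \<xi>) p \<partial>sphere_measure) \<le>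
         ennreal C * (\<integral>\<^sup>+\<xi>. enn_powr (emeasure (weighted \<mu>) (koranyi_region \<xi> (192 * \<delta>))) p \<partial>sphere_measure)"
        unfolding Y_def by (intro C(2) fin W \<delta>)
      also have "\<dots> \<le> ennreal C * ennreal (\<epsilon> * (192 * \<delta>) powr (\<gamma> * p) + N * (192 * \<delta>) powr (\<beta> * p))"
        using \<delta> by (intro mult_left_mono bound) auto
      also have "\<dots> \<le> ennreal C * ennreal (192 powr (\<beta> * p) * B)"
      proof (intro mult_left_mono ennreal_leI)
        have "192 powr (\<gamma> * p) \<le> (192 :: real) powr (\<beta> * p)"
          using \<gamma>\<beta> p by (intro powr_mono mult_right_mono) auto
        then have "\<epsilon> * (192 powr (\<gamma> * p) * \<delta> powr (\<gamma> * p)) \<le> \<epsilon> * (192 powr (\<beta> * p) * \<delta> powr (\<gamma> * p))"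
          using \<epsilon> by (intro mult_left_mono mult_right_mono) auto
        then show "\<epsilon> * (192 * \<delta>) powr (\<gamma> * p) + N * (192 * \<delta>) powr (\<beta> * p) \<le> 192 powr (\<beta> * p) * B"
          using \<delta> by (simp add: B_def powr_mult distrib_left mult.left_commute)
      qed simp
      also have "\<dots> = ennreal (C * 192 powr (\<beta> * p) * B)"
        using C B by (simp add: mult.assoc flip: ennreal_mult)
      finally show ?thesis .
    qed
    have d: "(c / \<delta> ^ CARD('n)) powr p = c powr p * \<delta> powr (- real CARD('n) * p)"
    proof -
      have "c / \<delta> ^ CARD('n) = c * \<delta> powr (- real CARD('n))"
        using \<delta> by (simp add: powr_minus_divide powr_realpow)
      then show ?thesis using c by (simp add: powr_mult powr_powr)
    qed
    have "(\<integral>\<^sup>+\<xi>. enn_powr (green_potential \<mu> ((1 - \<delta>) *\<^sub>R \<xi>)) p \<partial>sphere_measure) \<le>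
      (\<integral>\<^sup>+\<xi>. ennreal ((c / \<delta> ^ CARD('n)) powr p) * (ennreal (2 powr p) * (enn_powr (X \<xi>) p + enn_powr (Y \<xi>) p)) \<partial>sphere_measure)"
    proof (intro nn_integral_mono)
      fix \<xi> :: "complex ^ 'n" assume "\<xi> \<in> space sphere_measure"
      then have \<xi>: "norm \<xi> = 1" by (simp add: space_sphere_measure)
      have "green_potential \<mu> ((1 - \<delta>) *\<^sub>R \<xi>) \<le> ennreal (c / \<delta> ^ CARD('n)) * (X \<xi> + Y \<xi>)"
        using green_potential_le[OF \<mu> \<xi> \<delta>(1) _ n] \<delta>
        by (simp add: X_def Y_def c_def power_divide)
      then have "enn_powr (green_potential \<mu> ((1 - \<delta>) *\<^sub>R \<xi>)) p \<le> enn_powr (ennreal (c / \<delta> ^ CARD('n)) * (X \<xi> + Y \<xi>)) p"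
        using p by (intro enn_powr_mono) auto
      also have "\<dots> = ennreal ((c / \<delta> ^ CARD('n)) powr p) * enn_powr (X \<xi> + Y \<xi>) p"
        using p c \<delta> by (subst enn_powr_mult) (auto simp: enn_powr_ennreal)
      also have "\<dots> \<le> ennreal ((c / \<delta> ^ CARD('n)) powr p) * (ennreal (2 powr p) * (enn_powr (X \<xi>) p + enn_powr (Y \<xi>) p))"
        using p by (intro mult_left_mono enn_powr_add_le) auto
      finally show "enn_powr (green_potential \<mu> ((1 - \<delta>) *\<^sub>R \<xi>)) p \<le> \<dots>" .
    qed
    also have "\<dots> = ennreal ((c / \<delta> ^ CARD('n)) powr p) * (ennreal (2 powr p) *
        ((\<integral>\<^sup>+\<xi>. enn_powr (X \<xi>) p \<partial>sphere_measure) + (\<integral>\<^sup>+\<xi>. enn_powr (Y \<xi>) p \<partial>sphere_measure)))"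
      by (simp add: nn_integral_cmult nn_integral_add)
    also have "\<dots> \<le> ennreal ((c / \<delta> ^ CARD('n)) powr p) * (ennreal (2 powr p) *
        (ennreal (A * B) + ennreal (C * 192 powr (\<beta> * p) * B)))"
      by (intro mult_left_mono add_mono intX intY) auto
    also have "\<dots> = ennreal ((c / \<delta> ^ CARD('n)) powr p * (2 powr p * (A * B + C * 192 powr (\<beta> * p) * B)))"
      using A B C by (simp add: ennreal_mult)
    also have "(c / \<delta> ^ CARD('n)) powr p * (2 powr p * (A * B + C * 192 powr (\<beta> * p) * B)) =
        K * (\<delta> powr (- real CARD('n) * p) * B)"
      unfolding d K_def by (simp add: algebra_simps)
    finally show "(\<integral>\<^sup>+\<xi>. enn_powr (green_potential \<mu> ((1 - \<delta>) *\<^sub>R \<xi>)) p \<partial>sphere_measure) \<le>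
       ennreal (K * (\<delta> powr (- real CARD('n) * p) * (\<epsilon> * \<delta> powr (\<gamma> * p) + N * \<delta> powr (\<beta> * p))))"
      unfolding B_def .
  qed
qed

theorem theorem4:
  fixes \<mu> :: "(complex ^ 'n) measure" and p \<gamma> :: real
  assumes "CARD('n) > 1"
    and "1 < p" and "p < (2 * real CARD('n) - 1) / (2 * (real CARD('n) - 1))"
    and "0 \<le> \<gamma>" and "\<gamma> < 2 * real CARD('n)"
    and "sets \<mu> = sets (restrict_space borel (ball 0 1))"
    and "(\<integral>\<^sup>+ w. ennreal ((1 - (norm w)\<^sup>2) ^ CARD('n)) \<partial>\<mu>) < \<infinity>"
  shows "enn_smallo (at_left 1)
           (\<lambda>r. integral_mean p r (green_potential \<mu>))
           (\<lambda>r. (1 - r) powr (\<gamma> - real CARD('n)))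
     \<longleftrightarrow> enn_smallo (at_right 0)
           (\<lambda>\<delta>. enn_powr
              (\<integral>\<^sup>+ \<xi>. enn_powr (emeasure (weighted \<mu>) (koranyi_region \<xi> \<delta>)) p \<partial>sphere_measure)
              (1 / p))
           (\<lambda>\<delta>. \<delta> powr \<gamma>)"
proof -
  have p: "0 < p" using assms(2) by simp
  have fin: "finite_measure (weighted \<mu>)" by (rule finite_measure_weighted[OF assms(6,7)])
  have W: "sets (weighted \<mu>) = sets (restrict_space borel (ball 0 1))" by (simp add: sets_weighted assms(6))
  define I where "I \<delta> = (\<integral>\<^sup>+\<xi>. enn_powr (green_potential \<mu> ((1 - \<delta>) *\<^sub>R \<xi>)) p \<partial>sphere_measure)" for \<delta>
  define \<omega> where "\<omega> \<delta> = (\<integral>\<^sup>+\<xi>. enn_powr (emeasure (weighted \<mu>) (koranyi_region \<xi> \<delta>)) p \<partial>sphere_measure)" for \<delta>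
  define n where "n = real CARD('n)"
  have "enn_smallo (at_left 1) (\<lambda>r. integral_mean p r (green_potential \<mu>)) (\<lambda>r. (1 - r) powr (\<gamma> - n)) \<longleftrightarrow>
     (\<forall>c>0. eventually (\<lambda>\<delta>. I \<delta> \<le> ennreal (c * \<delta> powr ((\<gamma> - n) * p))) (at_right 0))"
    unfolding integral_mean_def enn_smallo_root_iff[OF p] eventually_at_left_1_iff
    by (simp add: I_def powr_powr)
  moreover have "enn_smallo (at_right 0) (\<lambda>\<delta>. enn_powr (\<omega> \<delta>) (1 / p)) (\<lambda>\<delta>. \<delta> powr \<gamma>) \<longleftrightarrow>
     (\<forall>c>0. eventually (\<lambda>\<delta>. \<omega> \<delta> \<le> ennreal (c * \<delta> powr (\<gamma> * p))) (at_right 0))"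
    unfolding enn_smallo_root_iff[OF p] by (simp add: powr_powr)
  moreover have "(\<forall>c>0. eventually (\<lambda>\<delta>. I \<delta> \<le> ennreal (c * \<delta> powr ((\<gamma> - n) * p))) (at_right 0)) \<longleftrightarrow>
     (\<forall>c>0. eventually (\<lambda>\<delta>. \<omega> \<delta> \<le> ennreal (c * \<delta> powr (\<gamma> * p))) (at_right 0))"
  proof (intro iffI allI impI)
    fix c :: real
    assume L: "\<forall>c>0. eventually (\<lambda>\<delta>. I \<delta> \<le> ennreal (c * \<delta> powr ((\<gamma> - n) * p))) (at_right 0)" and c: "c > 0"
    \<comment> \<open>The constant of the lower bound for the potential with \<delta>^(-n) split
      off. The hypothesis is applied to \<open>c * a powr p\<close> so that \<open>a\<close> cancels
      at the end.\<close>
    define a where "a = (n + 1) / (2 * n) / (2 * n) * (1 / 4) ^ CARD('n)"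
    have a: "a > 0" by (simp add: a_def n_def)
    have "eventually (\<lambda>\<delta>. I \<delta> \<le> ennreal ((c * a powr p) * \<delta> powr ((\<gamma> - n) * p))) (at_right 0)"
      using L a c by simp
    moreover have "eventually (\<lambda>\<delta>::real. \<delta> < 1) (at_right 0)"
      unfolding eventually_at_right_field by (intro exI[of _ 1]) auto
    ultimately show "eventually (\<lambda>\<delta>. \<omega> \<delta> \<le> ennreal (c * \<delta> powr (\<gamma> * p))) (at_right 0)"
      using eventually_at_right_less[of "0::real"]
    proof eventually_elim
      case (elim \<delta>)
      define b where "b = a * (1 / \<delta>) ^ CARD('n)"
      have b: "b > 0" using a elim by (simp add: b_def)
      have "b = a * \<delta> powr (- n)"
        using elim by (simp add: b_def n_def powr_minus_divide powr_realpow power_divide)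
      then have bp: "b powr p = a powr p * \<delta> powr (- n * p)"
        using a by (simp add: powr_mult powr_powr)
      have "ennreal (b powr p) * \<omega> \<delta> = (\<integral>\<^sup>+\<xi>. ennreal (b powr p) *
          enn_powr (emeasure (weighted \<mu>) (koranyi_region \<xi> \<delta>)) p \<partial>sphere_measure)"
        unfolding \<omega>_def
        by (intro nn_integral_cmult[symmetric] measurable_enn_powr borel_measurable_emeasure_koranyi fin W)
      also have "\<dots> \<le> I \<delta>"
        unfolding I_def
      proof (intro nn_integral_mono)
        fix \<xi> :: "complex ^ 'n" assume "\<xi> \<in> space sphere_measure"
        then have \<xi>: "norm \<xi> = 1" by (simp add: space_sphere_measure)
        have "b = (n + 1) / (2 * n) / (2 * n) * (1 / (4 * \<delta>)) ^ CARD('n)"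
          by (simp add: b_def a_def power_divide power_mult_distrib)
        then have "ennreal b * emeasure (weighted \<mu>) (koranyi_region \<xi> \<delta>) \<le> green_potential \<mu> ((1 - \<delta>) *\<^sub>R \<xi>)"
          using green_potential_ge[OF assms(6) \<xi>, of \<delta>] elim by (simp add: n_def)
        then have "enn_powr (ennreal b * emeasure (weighted \<mu>) (koranyi_region \<xi> \<delta>)) p \<le>
           enn_powr (green_potential \<mu> ((1 - \<delta>) *\<^sub>R \<xi>)) p"
          using p by (intro enn_powr_mono) auto
        then show "ennreal (b powr p) * enn_powr (emeasure (weighted \<mu>) (koranyi_region \<xi> \<delta>)) p \<le>
           enn_powr (green_potential \<mu> ((1 - \<delta>) *\<^sub>R \<xi>)) p"
          using p b by (simp add: enn_powr_mult enn_powr_ennreal)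
      qed
      also have "\<dots> \<le> ennreal ((c * a powr p) * \<delta> powr ((\<gamma> - n) * p))" by (rule elim)
      also have "(c * a powr p) * \<delta> powr ((\<gamma> - n) * p) = b powr p * (c * \<delta> powr (\<gamma> * p))"
      proof -
        have "(\<gamma> - n) * p = - n * p + \<gamma> * p" by (simp add: algebra_simps)
        then have "\<delta> powr ((\<gamma> - n) * p) = \<delta> powr (- n * p) * \<delta> powr (\<gamma> * p)" by (simp only: powr_add)
        then show ?thesis unfolding bp by (simp only: mult_ac)
      qed
      also have "ennreal \<dots> = ennreal (b powr p) * ennreal (c * \<delta> powr (\<gamma> * p))"
        using c by (intro ennreal_mult) auto
      finally show ?case
        using b by (simp add: ennreal_mult_le_mult_iff)
    qed
  next
    fix c :: real
    assume R: "\<forall>c>0. eventually (\<lambda>\<delta>. \<omega> \<delta> \<le> ennreal (c * \<delta> powr (\<gamma> * p))) (at_right 0)" and c: "c > 0"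
    \<comment> \<open>The midpoint of \<gamma> and 2n; any value strictly between would
      serve.\<close>
    define \<beta> where "\<beta> = (\<gamma> + 2 * n) / 2"
    have \<beta>: "\<gamma> < \<beta>" "\<beta> < 2 * n" using assms(5) by (auto simp: \<beta>_def n_def)
    have \<beta>': "\<gamma> \<le> \<beta>" "\<beta> < 2 * real CARD('n)" "0 \<le> \<beta>" using \<beta> assms(4) by (auto simp: n_def)
    obtain K where K: "K > 0"
      "\<And>(\<mu> :: (complex ^ 'n) measure) \<epsilon> N \<delta>. sets \<mu> = sets (restrict_space borel (ball 0 1)) \<Longrightarrow>
       finite_measure (weighted \<mu>) \<Longrightarrow> 0 \<le> \<epsilon> \<Longrightarrow> 0 \<le> N \<Longrightarrow>
       (\<And>t. 0 < t \<Longrightarrow> (\<integral>\<^sup>+\<xi>. enn_powr (emeasure (weighted \<mu>) (koranyi_region \<xi> t)) p \<partial>sphere_measure) \<le>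
         ennreal (\<epsilon> * t powr (\<gamma> * p) + N * t powr (\<beta> * p))) \<Longrightarrow> 0 < \<delta> \<Longrightarrow> \<delta> < 1 / 10 \<Longrightarrow>
       (\<integral>\<^sup>+\<xi>. enn_powr (green_potential \<mu> ((1 - \<delta>) *\<^sub>R \<xi>)) p \<partial>sphere_measure) \<le>
       ennreal (K * (\<delta> powr (- real CARD('n) * p) * (\<epsilon> * \<delta> powr (\<gamma> * p) + N * \<delta> powr (\<beta> * p))))"
      using potential_mean_le[OF assms(1-3) \<beta>'(1,2)] by blast
    \<comment> \<open>The \<epsilon>-term then takes half of the permitted constant
      \<open>c\<close>; the other half is left for the N-term.\<close>
    define \<epsilon> where "\<epsilon> = c / (2 * K)"
    have \<epsilon>: "\<epsilon> > 0" using c K by (simp add: \<epsilon>_def)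
    then have ev: "eventually (\<lambda>\<delta>. \<omega> \<delta> \<le> ennreal (\<epsilon> * \<delta> powr (\<gamma> * p))) (at_right 0)" using R by blast
    obtain N where N: "N \<ge> 0" "\<And>t. 0 < t \<Longrightarrow> \<omega> t \<le> ennreal (\<epsilon> * t powr (\<gamma> * p) + N * t powr (\<beta> * p))"
      using small_o_bound_global[OF fin assms(2) less_imp_le[OF \<epsilon>] ev[unfolded \<omega>_def] \<beta>'(3)]
      unfolding \<omega>_def by blast
    define e where "e = (\<beta> - \<gamma>) * p"
    have e: "e > 0" using \<beta> p by (simp add: e_def)
    \<comment> \<open>Below this threshold K N \<delta>^e \<le> c/2, where e is the positive excess
      exponent (\<beta> - \<gamma>)p. The added 1 keeps the denominator positive when N = 0.\<close>
    define d where "d = (c / (2 * (K * N + 1))) powr (1 / e)"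
    have KN: "K * N + 1 > 0" using K N by (intro add_nonneg_pos) auto
    have d: "d > 0" using c KN by (simp add: d_def)
    have "I \<delta> \<le> ennreal (c * \<delta> powr ((\<gamma> - n) * p))" if \<delta>: "0 < \<delta>" "\<delta> < min d (1 / 10)" for \<delta>
    proof -
      have "\<delta> powr e \<le> d powr e" using \<delta> e by (intro powr_mono2) auto
      also have "d powr e = c / (2 * (K * N + 1))" using e c KN by (simp add: d_def powr_powr)
      finally have "(K * N + 1) * \<delta> powr e \<le> c / 2" using KN by (simp add: field_simps)
      then have small: "K * N * \<delta> powr e \<le> c / 2"
        using powr_ge_zero[of \<delta> e] by (simp add: algebra_simps del: powr_ge_zero)
      have "I \<delta> \<le> ennreal (K * (\<delta> powr (- n * p) * (\<epsilon> * \<delta> powr (\<gamma> * p) + N * \<delta> powr (\<beta> * p))))"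
        unfolding I_def n_def using N \<epsilon> \<delta> by (intro K(2) assms(6) fin) (auto simp: \<omega>_def)
      also have "\<dots> \<le> ennreal (c * \<delta> powr ((\<gamma> - n) * p))"
      proof (rule ennreal_leI)
        have e1: "\<delta> powr ((\<gamma> - n) * p) = \<delta> powr (- n * p) * \<delta> powr (\<gamma> * p)"
        proof -
          have "(\<gamma> - n) * p = - n * p + \<gamma> * p" by (simp add: algebra_simps)
          then show ?thesis by (simp only: powr_add)
        qed
        have e2: "\<delta> powr (\<beta> * p) = \<delta> powr e * \<delta> powr (\<gamma> * p)"
          by (simp add: e_def algebra_simps flip: powr_add)
        have "K * (\<delta> powr (- n * p) * (\<epsilon> * \<delta> powr (\<gamma> * p) + N * \<delta> powr (\<beta> * p))) =
            (K * \<epsilon> + K * N * \<delta> powr e) * \<delta> powr ((\<gamma> - n) * p)"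
          unfolding e1 e2 by (simp add: algebra_simps)
        also have "\<dots> \<le> c * \<delta> powr ((\<gamma> - n) * p)"
          using small K by (intro mult_right_mono) (auto simp: \<epsilon>_def)
        finally show "K * (\<delta> powr (- n * p) * (\<epsilon> * \<delta> powr (\<gamma> * p) + N * \<delta> powr (\<beta> * p))) \<le> c * \<delta> powr ((\<gamma> - n) * p)" .
      qed
      finally show ?thesis .
    qed
    then show "eventually (\<lambda>\<delta>. I \<delta> \<le> ennreal (c * \<delta> powr ((\<gamma> - n) * p))) (at_right 0)"
      unfolding eventually_at_right_field using d by (intro exI[of _ "min d (1 / 10)"]) auto
  qed
  ultimately show ?thesis unfolding n_def \<omega>_def by simp
qed

end
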